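(* Let $d\ge1$ be an integer and let $\varphi\in H^1(\mathbb{T}^d)$ be such that $\Gamma_{\varphi*\varphi^\dagger}\in\mathrm{Hank}(\overline{H^2(\mathbb{T}^d)},H^2(\mathbb{T}^d))$. Then for any sequence $(f_k)_{k\ge1}$ in $H^2(\mathbb{T}^d)$, $$\Big\|\sum_{k=1}^\infty(\Gamma_{f_k*\varphi})^*\Gamma_{f_k*\varphi}\Big\|^{1/2}_{B(\overline{H^2(\mathbb{T}^d)})}\le\|\Gamma_{\varphi*\varphi^\dagger}\|^{1/2}_{\mathrm{Hank}(\overline{H^2(\mathbb{T}^d)},H^2(\mathbb{T}^d))}\Big(\sum_{k,l=1}^\infty|\langle f_k,f_l\rangle|^2\Big)^{1/4}.$$ In particular, if the $f_k$ are mutually orthogonal, then $$\Big\|\sum_{k=1}^\infty(\Gamma_{f_k*\varphi})^*\Gamma_{f_k*\varphi}\Big\|^{1/2}_{B(\overline{H^2(\mathbb{T}^d)})}\le\|\Gamma_{\varphi*\varphi^\dagger}\|^{1/2}_{\mathrm{Hank}(\overline{H^2(\mathbb{T}^d)},H^2(\mathbb{T}^d))}\Big(\sum_{k=1}^\infty\|f_k\|^4_{H^2(\mathbb{T}^d)}\Big)^{1/4}.$$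
   Context: $\mathbb{T}^d$ carries normalized Haar measure; $\mathbb{N}=\{0,1,2,\dots\}$; $H^p(\mathbb{T}^d)$ is the space of $f\in L^p(\mathbb{T}^d)$ whose Fourier coefficients vanish outside $\mathbb{N}^d$, and $\overline{H^2(\mathbb{T}^d)}$ is the space of complex conjugates of functions in $H^2(\mathbb{T}^d)$. $*$ is convolution on $\mathbb{T}^d$ (multiplication of Fourier coefficients). For $\varphi\in H^1(\mathbb{T}^d)$, $\varphi^\dagger(z_1,\dots,z_d)=\overline{\varphi(\overline z_1,\dots,\overline z_d)}$, so that $\widehat{\varphi*\varphi^\dagger}(n)=|\widehat\varphi(n)|^2$. The (small) Hankel operator $\Gamma_\psi:\overline{H^2(\mathbb{T}^d)}\to H^2(\mathbb{T}^d)$ with symbol $\psi$ is initially densely defined by $f\mapsto \mathcal{R}_+(\psi f)$, with $\mathcal{R}_+$ the projection onto Fourier frequencies in $\mathbb{N}^d$; equivalently, in the orthonormal bases $\{e^{-in\cdot\theta}\}_{n\in\mathbb{N}^d}$ and $\{e^{in\cdot\theta}\}_{n\in\mathbb{N}^d}$ it has matrix $[\widehat\psi(m+n)]_{m,n\in\mathbb{N}^d}$. $\mathrm{Hank}(\overline{H^2(\mathbb{T}^d)},H^2(\mathbb{T}^d))$ is the space of bounded such operators with the operator norm. *)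

theory Defs
  imports "HOL-Probability.Probability"
begin

section \<open>The torus and its Haar measure\<close>

definition circle_measure :: "complex measure" where
  "circle_measure =
     distr (uniform_measure lborel {0..<2 * pi}) (restrict_space borel (sphere 0 1)) cis"

text \<open>The dimension is \<open>d = CARD('d)\<close>, which is at least 1 because types are inhabited.
  The underlying space is the product of unit circles, so the values of a function outside the
  torus are irrelevant.\<close>

definition torus :: "('d::finite \<Rightarrow> complex) measure" where
  "torus = PiM UNIV (\<lambda>_. circle_measure)"

type_synonym 'd torus_fun = "('d \<Rightarrow> complex) \<Rightarrow> complex"

definition torus_char :: "('d::finite \<Rightarrow> int) \<Rightarrow> 'd torus_fun" where
  "torus_char n z = (\<Prod>i\<in>UNIV. z i powi n i)"

definition fourier_coeff :: "('d::finite) torus_fun \<Rightarrow> ('d \<Rightarrow> int) \<Rightarrow> complex" where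
  "fourier_coeff f n = (LINT z|torus. f z * cnj (torus_char n z))"

lemma space_circle_measure: "space circle_measure = sphere 0 1"
  by (simp add: circle_measure_def space_restrict_space)

lemma space_torus: "space torus = {z. \<forall>i. cmod (z i) = 1}"
  by (auto simp: torus_def space_PiM space_circle_measure PiE_def)

lemma measurable_cis_circle:
  "cis \<in> measurable (uniform_measure lborel {0..<2 * pi}) (restrict_space borel (sphere 0 1))"
proof (rule measurable_restrict_space2)
  have "cis \<in> borel_measurable borel"
    by (intro borel_measurable_continuous_onI continuous_intros)
  then show "cis \<in> borel_measurable (uniform_measure lborel {0..<2 * pi})"
    by (simp cong: measurable_cong_sets)
qed auto

lemma prob_space_circle_measure: "prob_space circle_measure"
  unfolding circle_measure_def
  by (rule prob_space.prob_space_distr[OF prob_space_uniform_measure measurable_cis_circle]) auto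

lemma prob_space_torus: "prob_space torus"
  unfolding torus_def by (rule prob_space_PiM) (rule prob_space_circle_measure)


section \<open>Function spaces\<close>

text \<open>Elements of these spaces are functions; equality in \<open>L\<^sup>p\<close> is equality almost everywhere.\<close>

definition Lp_fun :: "real \<Rightarrow> ('d::finite) torus_fun set" where
  "Lp_fun p = {f \<in> borel_measurable torus. integrable torus (\<lambda>z. cmod (f z) powr p)}"

definition Hardy :: "real \<Rightarrow> ('d::finite) torus_fun set" where
  "Hardy p = {f \<in> Lp_fun p. \<forall>n. (\<exists>i. n i < 0) \<longrightarrow> fourier_coeff f n = 0}"

definition conj_Hardy2 :: "('d::finite) torus_fun set" where
  "conj_Hardy2 = (\<lambda>f z. cnj (f z)) ` Hardy 2"

definition L2_inner :: "('d::finite) torus_fun \<Rightarrow> 'd torus_fun \<Rightarrow> complex" where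
  "L2_inner f g = (LINT z|torus. f z * cnj (g z))"

definition L2_fnorm :: "('d::finite) torus_fun \<Rightarrow> real" where
  "L2_fnorm f = sqrt (LINT z|torus. (cmod (f z))\<^sup>2)"

definition torus_conv :: "('d::finite) torus_fun \<Rightarrow> 'd torus_fun \<Rightarrow> 'd torus_fun"
    (infixl \<open>\<star>\<close> 70) where
  "(f \<star> g) z = (LINT w|torus. f (\<lambda>i. z i / w i) * g w)"

definition dagger :: "('d::finite) torus_fun \<Rightarrow> 'd torus_fun" where
  "dagger \<phi> z = cnj (\<phi> (\<lambda>i. cnj (z i)))"


section \<open>Operators between spaces of functions\<close>

text \<open>An operator is a map on functions, understood up to almost everywhere equality. Linearity
  and boundedness together make it well defined on almost everywhere classes.\<close>

type_synonym 'd torus_op = "'d torus_fun \<Rightarrow> 'd torus_fun"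

definition bounded_op ::
    "('d::finite) torus_fun set \<Rightarrow> 'd torus_fun set \<Rightarrow> 'd torus_op \<Rightarrow> bool" where
  "bounded_op V W T \<longleftrightarrow>
     (\<forall>f\<in>V. T f \<in> W) \<and>
     (\<forall>f\<in>V. \<forall>g\<in>V. \<forall>a b.
        AE z in torus. T (\<lambda>z. a * f z + b * g z) z = a * T f z + b * T g z) \<and>
     (\<exists>C. \<forall>f\<in>V. L2_fnorm (T f) \<le> C * L2_fnorm f)"

text \<open>The real supremum is meaningful only for bounded operators.\<close>

definition op_norm :: "('d::finite) torus_fun set \<Rightarrow> 'd torus_op \<Rightarrow> real" where
  "op_norm V T = (SUP f\<in>{f\<in>V. L2_fnorm f \<le> 1}. L2_fnorm (T f))"

definition op_adjoint :: "('d::finite) torus_fun set \<Rightarrow> 'd torus_op \<Rightarrow> 'd torus_op" where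
  "op_adjoint V T g = (SOME h. h \<in> V \<and> (\<forall>f\<in>V. L2_inner (T f) g = L2_inner f h))"

definition op_sums ::
    "('d::finite) torus_fun set \<Rightarrow> (nat \<Rightarrow> 'd torus_op) \<Rightarrow> 'd torus_op \<Rightarrow> bool" where
  "op_sums V A S \<longleftrightarrow>
     (\<forall>k. bounded_op V V (A k)) \<and> bounded_op V V S \<and>
     (\<lambda>N. op_norm V (\<lambda>h z. (\<Sum>k<N. A k h z) - S h z)) \<longlonglongrightarrow> 0"

text \<open>The norm of \<open>\<Sum>k. A k\<close> in \<open>B(V)\<close>, where the series is taken in the operator norm; it is
  infinite if the series does not converge to a bounded operator.\<close>

definition op_series_norm ::
    "('d::finite) torus_fun set \<Rightarrow> (nat \<Rightarrow> 'd torus_op) \<Rightarrow> ennreal" where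
  "op_series_norm V A =
     (if \<exists>S. op_sums V A S then ennreal (op_norm V (SOME S. op_sums V A S)) else \<infinity>)"


section \<open>Hankel operators\<close>

text \<open>\<open>h\<close> represents \<open>\<R>\<^sub>+ g\<close>. For \<open>g = \<psi> p\<close> with \<open>\<psi> \<in> H\<^sup>1\<close> and \<open>p\<close> a trigonometric polynomial,
  such an integrable \<open>h\<close> exists, and it is determined almost everywhere by its coefficients.\<close>

definition is_riesz_proj :: "('d::finite) torus_fun \<Rightarrow> 'd torus_fun \<Rightarrow> bool" where
  "is_riesz_proj g h \<longleftrightarrow>
     h \<in> Lp_fun 1 \<and>
     (\<forall>n. fourier_coeff h n = (if \<forall>i. 0 \<le> n i then fourier_coeff g n else 0))"

definition conj_analytic_polys :: "('d::finite) torus_fun set" where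
  "conj_analytic_polys =
     {p. \<exists>A c. finite A \<and> p = (\<lambda>z. \<Sum>n\<in>A. c n * cnj (torus_char (\<lambda>i. int (n i)) z))}"

text \<open>\<open>T\<close> is the bounded extension to the conjugate Hardy space of the map
  \<open>p \<mapsto> \<R>\<^sub>+(\<psi> p)\<close>, initially defined on conjugate analytic polynomials.\<close>

definition is_hankel :: "('d::finite) torus_fun \<Rightarrow> 'd torus_op \<Rightarrow> bool" where
  "is_hankel \<psi> T \<longleftrightarrow>
     bounded_op conj_Hardy2 (Hardy 2) T \<and>
     (\<forall>p\<in>conj_analytic_polys. is_riesz_proj (\<lambda>z. \<psi> z * p z) (T p))"

definition hankel_bounded :: "('d::finite) torus_fun \<Rightarrow> bool" where
  "hankel_bounded \<psi> \<longleftrightarrow> (\<exists>T. is_hankel \<psi> T)"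

text \<open>By density of the polynomials, \<open>\<Gamma> \<psi>\<close> is unique up to almost everywhere equality whenever
  \<^term>\<open>hankel_bounded \<psi>\<close> holds.\<close>

definition hankel :: "('d::finite) torus_fun \<Rightarrow> 'd torus_op" (\<open>\<Gamma>\<close>) where
  "\<Gamma> \<psi> = (SOME T. is_hankel \<psi> T)"


section \<open>Powers of extended nonnegative reals\<close>

text \<open>Used for positive exponents only.\<close>

definition epowr :: "ennreal \<Rightarrow> real \<Rightarrow> ennreal" (infixr \<open>epowr\<close> 80) where
  "x epowr r = (if x = \<infinity> then \<infinity> else ennreal (enn2real x powr r))"

end

theory Submission
  imports Defs "HOL-Library.Function_Algebras"
begin

text \<open>Write \<open>a\<close> for the sequence of Fourier coefficients of \<open>\<phi>\<close>, \<open>\<beta>\<close> for the norm of the Hankel operator with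
  symbol \<open>\<phi> \<star> dagger \<phi>\<close>, and let \<open>x\<close> be the coefficient sequence of a function \<open>h\<close> of the conjugate
  Hardy space, \<open>h = \<Sum>n. x(n) cnj(z^n)\<close>. In coefficients, convolution is multiplication, so that
  \<open>\<Gamma> (f\<^sub>k \<star> \<phi>)\<close> sends \<open>x\<close> to \<open>m \<mapsto> \<Sum>n. f\<^sub>k(m + n) a(m + n) x(n)\<close>, and the matrix with entries
  \<open>\<bar>a(m + n)\<bar>\<^sup>2\<close> has norm \<open>\<beta>\<close>. Write \<open>g\<^sub>m(i) = cnj (a(i) x(i - m))\<close>. Then the value above is \<open>\<langle>f\<^sub>k, g\<^sub>m\<rangle>\<close>,
  and the square function is
  \<open>\<Sum>k. norm(\<Gamma> (f\<^sub>k \<star> \<phi>) h)\<^sup>2 = \<Sum>k m. \<bar>\<langle>f\<^sub>k, g\<^sub>m\<rangle>\<bar>\<^sup>2\<close>.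

  The right-hand side is the Hilbert-Schmidt pairing of \<open>\<Sum>k. f\<^sub>k \<otimes> f\<^sub>k\<close> and \<open>\<Sum>m. g\<^sub>m \<otimes> g\<^sub>m\<close>, and
  the Hilbert-Schmidt norm of such an operator is the \<open>\<ell>\<^sup>2\<close> norm of the Gram matrix of the family. The first
  factor is thus \<open>(\<Sum>k l. \<bar>\<langle>f\<^sub>k, f\<^sub>l\<rangle>\<bar>\<^sup>2)\<^bsup>1/2\<^esup>\<close>. For the second, \<open>\<langle>g\<^sub>m, g\<^sub>l\<rangle>\<close> is, up to conjugation,
  \<open>\<Sum>n. \<bar>a(m + n)\<bar>\<^sup>2 x(n) cnj(x(n + m - l))\<close>: for each fixed difference \<open>t = m - l\<close> it is an entry of
  the Hankel matrix of \<open>\<phi> \<star> dagger \<phi>\<close> applied to the vector \<open>n \<mapsto> x(n) cnj(x(n + t))\<close>. Summing the squares over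
  \<open>m\<close> costs \<open>\<beta>\<^sup>2\<close> times the squared norm of that vector, and summing over \<open>t\<close> gives
  \<open>\<beta>\<^sup>2 norm(x)\<^sup>4\<close>. Hence
  \<open>\<Sum>k. norm(\<Gamma> (f\<^sub>k \<star> \<phi>) h)\<^sup>2 \<le> \<beta> (\<Sum>k l. \<bar>\<langle>f\<^sub>k, f\<^sub>l\<rangle>\<bar>\<^sup>2)\<^bsup>1/2\<^esup> norm(h)\<^sup>2\<close>.
  All of this is done with finite sums (\<open>hankel_square_function_bound\<close>) and carried over by density
  (\<open>hankel_square_function\<close>); one function \<open>f\<^sub>k\<close> alone gives the boundedness of \<open>\<Gamma> (f\<^sub>k \<star> \<phi>)\<close>.

  The same bound for the tail \<open>k \<ge> N\<close> has a constant tending to 0 when the double series converges.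
  By Cauchy-Schwarz the partial sums of the operator series are Cauchy in operator norm, and the bound
  on the quadratic forms passes to the limit (\<open>op_sums_adjoint_self\<close>). If the double series diverges, either
  \<open>\<beta> > 0\<close> and the right-hand side is infinite, or \<open>\<beta> = 0\<close> and every \<open>\<Gamma> (f\<^sub>k \<star> \<phi>)\<close> vanishes.

  The passage between functions and coefficients rests on Fourier analysis on the torus: the characters
  are complete (\<open>fourier_coeff_unique\<close>), Haar measure is invariant (\<open>distr_torus_eqI\<close>), every square-summable
  family is a family of coefficients (\<open>Riesz_Fischer\<close>), and Parseval's identity holds.\<close>

section \<open>A Hilbert-Schmidt bound for finite Hankel sections\<close>

text \<open>Expanding the squares and interchanging the two pairs of sums turns the sum into the
  Hilbert-Schmidt pairing of \<open>\<Sum>k. f\<^sub>k \<otimes> f\<^sub>k\<close> and \<open>\<Sum>m. g\<^sub>m \<otimes> g\<^sub>m\<close>. For \<open>g = f\<close> it says that the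
  Hilbert-Schmidt norm of the first is the \<open>\<ell>\<^sup>2\<close> norm of the Gram matrix.\<close>

lemma sum_cross_inner_eq_Hilbert_Schmidt:
  fixes f :: "'k \<Rightarrow> 'i \<Rightarrow> complex" and g :: "'m \<Rightarrow> 'i \<Rightarrow> complex"
  shows "complex_of_real (\<Sum>k\<in>K. \<Sum>m\<in>M. (cmod (\<Sum>i\<in>E. f k i * cnj (g m i)))\<^sup>2) =
    (\<Sum>(i, j)\<in>E \<times> E. (\<Sum>k\<in>K. f k i * cnj (f k j)) * cnj (\<Sum>m\<in>M. g m i * cnj (g m j)))"
proof -
  have "complex_of_real (\<Sum>k\<in>K. \<Sum>m\<in>M. (cmod (\<Sum>i\<in>E. f k i * cnj (g m i)))\<^sup>2) =
      (\<Sum>(k, m)\<in>K \<times> M. (\<Sum>i\<in>E. f k i * cnj (g m i)) * cnj (\<Sum>j\<in>E. f k j * cnj (g m j)))"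
    unfolding sum.cartesian_product[symmetric] of_real_sum
    by (intro sum.cong refl complex_norm_square)
  also have "\<dots> = (\<Sum>(k, m)\<in>K \<times> M. \<Sum>(i, j)\<in>E \<times> E.
      (f k i * cnj (f k j)) * cnj (g m i * cnj (g m j)))"
    by (intro sum.cong refl) (auto simp: sum_product sum.cartesian_product[symmetric] mult_ac)
  also have "\<dots> = (\<Sum>(i, j)\<in>E \<times> E. \<Sum>(k, m)\<in>K \<times> M.
      (f k i * cnj (f k j)) * cnj (g m i * cnj (g m j)))"
    unfolding case_prod_unfold by (rule sum.swap)
  also have "\<dots> = (\<Sum>(i, j)\<in>E \<times> E.
      (\<Sum>k\<in>K. f k i * cnj (f k j)) * cnj (\<Sum>m\<in>M. g m i * cnj (g m j)))"
    unfolding cnj_sum sum_product sum.cartesian_product[symmetric] ..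
  finally show ?thesis .
qed

text \<open>Cauchy-Schwarz for the Hilbert-Schmidt pairing, with both norms read off from Gram matrices.\<close>

lemma sum_cross_inner_le_Gram:
  fixes f :: "'k \<Rightarrow> 'i \<Rightarrow> complex" and g :: "'m \<Rightarrow> 'i \<Rightarrow> complex"
  shows "(\<Sum>k\<in>K. \<Sum>m\<in>M. (cmod (\<Sum>i\<in>E. f k i * cnj (g m i)))\<^sup>2) \<le>
    sqrt (\<Sum>k\<in>K. \<Sum>l\<in>K. (cmod (\<Sum>i\<in>E. f k i * cnj (f l i)))\<^sup>2) *
    sqrt (\<Sum>m\<in>M. \<Sum>l\<in>M. (cmod (\<Sum>i\<in>E. g m i * cnj (g l i)))\<^sup>2)"
proof -
  define P where "P = (\<lambda>(i, j). \<Sum>k\<in>K. f k i * cnj (f k j))"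
  define R where "R = (\<lambda>(i, j). \<Sum>m\<in>M. g m i * cnj (g m j))"
  have PP: "(\<Sum>k\<in>K. \<Sum>l\<in>K. (cmod (\<Sum>i\<in>E. f k i * cnj (f l i)))\<^sup>2) = (\<Sum>p\<in>E \<times> E. (cmod (P p))\<^sup>2)"
    by (rule of_real_eq_iff[where 'a = complex, THEN iffD1], unfold sum_cross_inner_eq_Hilbert_Schmidt)
      (auto simp: P_def of_real_sum complex_norm_square[symmetric] case_prod_unfold simp del: cnj_sum)
  have RR: "(\<Sum>k\<in>M. \<Sum>l\<in>M. (cmod (\<Sum>i\<in>E. g k i * cnj (g l i)))\<^sup>2) = (\<Sum>p\<in>E \<times> E. (cmod (R p))\<^sup>2)"
    by (rule of_real_eq_iff[where 'a = complex, THEN iffD1], unfold sum_cross_inner_eq_Hilbert_Schmidt)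
      (auto simp: R_def of_real_sum complex_norm_square[symmetric] case_prod_unfold simp del: cnj_sum)
  have "(\<Sum>k\<in>K. \<Sum>m\<in>M. (cmod (\<Sum>i\<in>E. f k i * cnj (g m i)))\<^sup>2) =
      cmod (complex_of_real (\<Sum>k\<in>K. \<Sum>m\<in>M. (cmod (\<Sum>i\<in>E. f k i * cnj (g m i)))\<^sup>2))"
    unfolding norm_of_real by (intro abs_of_nonneg[symmetric] sum_nonneg) auto
  also have "\<dots> = cmod (\<Sum>p\<in>E \<times> E. P p * cnj (R p))"
    unfolding sum_cross_inner_eq_Hilbert_Schmidt P_def R_def case_prod_unfold ..
  also have "\<dots> \<le> (\<Sum>p\<in>E \<times> E. \<bar>cmod (P p)\<bar> * \<bar>cmod (R p)\<bar>)"
    by (rule order_trans[OF norm_sum]) (simp add: norm_mult)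
  also have "\<dots> \<le> L2_set (\<lambda>p. cmod (P p)) (E \<times> E) * L2_set (\<lambda>p. cmod (R p)) (E \<times> E)"
    by (rule L2_set_mult_ineq)
  finally show ?thesis unfolding PP RR L2_set_def .
qed

text \<open>Each of the sums over \<open>t\<close> of \<open>h(n + t)\<^sup>2\<close> is at most the full sum of squares, because the shifts by
  different \<open>t\<close> hit different points.\<close>

lemma sum_shifted_products_le:
  fixes h :: "'a::ab_group_add \<Rightarrow> real"
  assumes "finite G" "finite T" and "\<And>n. n \<notin> G \<Longrightarrow> h n = 0"
  shows "(\<Sum>t\<in>T. \<Sum>n\<in>G. (h n * h (n + t))\<^sup>2) \<le> (\<Sum>n\<in>G. (h n)\<^sup>2)\<^sup>2"
proof -
  have shift: "(\<Sum>t\<in>T. (h (n + t))\<^sup>2) \<le> (\<Sum>n\<in>G. (h n)\<^sup>2)" for n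
  proof -
    have "(\<Sum>t\<in>T. (h (n + t))\<^sup>2) = (\<Sum>j\<in>(+) n ` T. (h j)\<^sup>2)"
      by (subst sum.reindex) auto
    also have "\<dots> \<le> (\<Sum>j\<in>(+) n ` T \<union> G. (h j)\<^sup>2)"
      using assms by (intro sum_mono2) auto
    also have "\<dots> = (\<Sum>j\<in>G. (h j)\<^sup>2)"
      using assms by (intro sum.mono_neutral_right) auto
    finally show ?thesis .
  qed
  have "(\<Sum>t\<in>T. \<Sum>n\<in>G. (h n * h (n + t))\<^sup>2) = (\<Sum>n\<in>G. (h n)\<^sup>2 * (\<Sum>t\<in>T. (h (n + t))\<^sup>2))"
    by (subst sum.swap) (simp add: power_mult_distrib sum_distrib_left)
  also have "\<dots> \<le> (\<Sum>n\<in>G. (h n)\<^sup>2 * (\<Sum>n\<in>G. (h n)\<^sup>2))"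
    by (intro sum_mono mult_left_mono shift) auto
  finally show ?thesis by (simp add: sum_distrib_right power2_eq_square)
qed

text \<open>The decisive use of the Hankel structure: the entry at \<open>(m, l)\<close> depends on \<open>l\<close> only through
  \<open>t = m - l\<close>, and for fixed \<open>t\<close> it is the entry at \<open>m\<close> of the Hankel matrix of \<open>b\<close> applied to
  \<open>n \<mapsto> h(n) h(n + t)\<close>. So the norm bound for the matrix is applied once for each \<open>t\<close>.\<close>

lemma hankel_Gram_bound:
  fixes b h :: "'a::ab_group_add \<Rightarrow> real"
  assumes fin: "finite F" "finite G" and h0: "\<And>n. n \<notin> G \<Longrightarrow> h n = 0"
    and B: "\<And>u. (\<Sum>m\<in>F. (\<Sum>n\<in>G. b (m + n) * u n)\<^sup>2) \<le> \<beta>\<^sup>2 * (\<Sum>n\<in>G. (u n)\<^sup>2)"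
  shows "(\<Sum>m\<in>F. \<Sum>l\<in>F. (\<Sum>n\<in>G. b (m + n) * (h n * h (n + (m - l))))\<^sup>2) \<le> (\<beta> * (\<Sum>n\<in>G. (h n)\<^sup>2))\<^sup>2"
proof -
  \<comment> \<open>the differences that occur; extending the sum over \<open>l\<close> to all of them only adds nonnegative terms\<close>
  define T where "T = (\<lambda>(m, l). m - l) ` (F \<times> F)"
  have finT: "finite T" unfolding T_def using fin by auto
  define S where "S m t = (\<Sum>n\<in>G. b (m + n) * (h n * h (n + t)))\<^sup>2" for m t
  have "(\<Sum>m\<in>F. \<Sum>l\<in>F. S m (m - l)) \<le> (\<Sum>m\<in>F. \<Sum>t\<in>T. S m t)"
  proof (rule sum_mono)
    fix m assume m: "m \<in> F"
    have "(\<Sum>l\<in>F. S m (m - l)) = (\<Sum>t\<in>(\<lambda>l. m - l) ` F. S m t)"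
      by (subst sum.reindex) (auto simp: inj_on_def)
    also have "\<dots> \<le> (\<Sum>t\<in>T. S m t)"
      using m finT by (intro sum_mono2) (auto simp: T_def S_def)
    finally show "(\<Sum>l\<in>F. S m (m - l)) \<le> (\<Sum>t\<in>T. S m t)" .
  qed
  also have "\<dots> = (\<Sum>t\<in>T. \<Sum>m\<in>F. S m t)" by (rule sum.swap)
  also have "\<dots> \<le> (\<Sum>t\<in>T. \<beta>\<^sup>2 * (\<Sum>n\<in>G. (h n * h (n + t))\<^sup>2))"
    unfolding S_def by (intro sum_mono B)
  also have "\<dots> \<le> \<beta>\<^sup>2 * (\<Sum>n\<in>G. (h n)\<^sup>2)\<^sup>2"
    unfolding sum_distrib_left[symmetric]
    by (intro mult_left_mono sum_shifted_products_le fin finT h0) auto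
  finally show ?thesis by (simp add: S_def power_mult_distrib)
qed

text \<open>The set \<open>E\<close> only has to contain the finitely many frequencies that occur on the left; the inner
  products on the right are then truncated to \<open>E\<close>, and \<open>E\<close> can be enlarged to recover the full ones.\<close>

theorem hankel_square_function_bound:
  fixes a x :: "'a::ab_group_add \<Rightarrow> complex" and f :: "'k \<Rightarrow> 'a \<Rightarrow> complex"
  assumes fin: "finite F" "finite G" and beta: "0 \<le> \<beta>"
    and B: "\<And>u. (\<Sum>m\<in>F. (\<Sum>n\<in>G. (cmod (a (m + n)))\<^sup>2 * u n)\<^sup>2) \<le> \<beta>\<^sup>2 * (\<Sum>n\<in>G. (u n)\<^sup>2)"
    and E: "finite E" "\<And>m n. m \<in> F \<Longrightarrow> n \<in> G \<Longrightarrow> m + n \<in> E"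
  shows "(\<Sum>k\<in>K. \<Sum>m\<in>F. (cmod (\<Sum>n\<in>G. f k (m + n) * a (m + n) * x n))\<^sup>2) \<le>
    \<beta> * sqrt (\<Sum>k\<in>K. \<Sum>l\<in>K. (cmod (\<Sum>i\<in>E. f k i * cnj (f l i)))\<^sup>2) * (\<Sum>n\<in>G. (cmod (x n))\<^sup>2)"
proof -
  \<comment> \<open>extended by zero, so that \<open>i \<mapsto> y (i - m)\<close> makes sense for all indices\<close>
  define y where "y n = (if n \<in> G then x n else 0)" for n
  \<comment> \<open>the matrix coefficient at \<open>m\<close> becomes the inner product of \<open>f k\<close> and \<open>g m\<close>\<close>
  define g where "g m i = cnj (a i * y (i - m))" for m i
  define h where "h n = cmod (y n)" for n
  have sum_E: "(\<Sum>i\<in>E. c i * y (i - m)) = (\<Sum>n\<in>G. c (m + n) * x n)" if "m \<in> F" for m c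
  proof -
    have "(\<Sum>i\<in>E. c i * y (i - m)) = (\<Sum>i\<in>(+) m ` G. c i * y (i - m))"
    proof (rule sum.mono_neutral_right[OF E(1)])
      show "(+) m ` G \<subseteq> E" using E(2) that by auto
      show "\<forall>i\<in>E - (+) m ` G. c i * y (i - m) = 0"
      proof
        fix i assume i: "i \<in> E - (+) m ` G"
        have "i - m \<notin> G"
        proof
          assume "i - m \<in> G"
          then have "m + (i - m) \<in> (+) m ` G" by blast
          with i show False by simp
        qed
        then show "c i * y (i - m) = 0" by (simp add: y_def)
      qed
    qed
    also have "\<dots> = (\<Sum>n\<in>G. c (m + n) * x n)"
      by (subst sum.reindex) (auto simp: y_def)
    finally show ?thesis .
  qed
  have g_Gram: "(\<Sum>m\<in>F. \<Sum>l\<in>F. (cmod (\<Sum>i\<in>E. g m i * cnj (g l i)))\<^sup>2) \<le> (\<beta> * (\<Sum>n\<in>G. (h n)\<^sup>2))\<^sup>2"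
  proof (rule order_trans[OF sum_mono[OF sum_mono]])
    fix m l assume ml: "m \<in> F" "l \<in> F"
    have "(\<Sum>i\<in>E. g m i * cnj (g l i)) =
        cnj (\<Sum>i\<in>E. (a i * cnj (a i) * cnj (y (i - l))) * y (i - m))"
      unfolding g_def cnj_sum by (intro sum.cong refl) (simp add: mult_ac)
    also have "\<dots> = cnj (\<Sum>n\<in>G. (a (m + n) * cnj (a (m + n)) * cnj (y (n + (m - l)))) * x n)"
      by (subst sum_E[OF ml(1)]) (simp add: algebra_simps)
    finally have "cmod (\<Sum>i\<in>E. g m i * cnj (g l i)) \<le>
        (\<Sum>n\<in>G. cmod ((a (m + n) * cnj (a (m + n)) * cnj (y (n + (m - l)))) * x n))"
      by (simp only: complex_mod_cnj) (rule norm_sum)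
    also have "\<dots> = (\<Sum>n\<in>G. (cmod (a (m + n)))\<^sup>2 * (h n * h (n + (m - l))))"
      by (intro sum.cong refl) (auto simp: h_def y_def norm_mult power2_eq_square)
    finally show "(cmod (\<Sum>i\<in>E. g m i * cnj (g l i)))\<^sup>2 \<le>
        (\<Sum>n\<in>G. (cmod (a (m + n)))\<^sup>2 * (h n * h (n + (m - l))))\<^sup>2"
      by (intro power_mono) auto
  qed (rule hankel_Gram_bound[OF fin _ B], auto simp: h_def y_def)
  have h_sum: "(\<Sum>n\<in>G. (h n)\<^sup>2) = (\<Sum>n\<in>G. (cmod (x n))\<^sup>2)"
    by (auto simp: h_def y_def)
  have "(\<Sum>k\<in>K. \<Sum>m\<in>F. (cmod (\<Sum>n\<in>G. f k (m + n) * a (m + n) * x n))\<^sup>2) =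
      (\<Sum>k\<in>K. \<Sum>m\<in>F. (cmod (\<Sum>i\<in>E. f k i * cnj (g m i)))\<^sup>2)"
    using sum_E[of _ "\<lambda>i. f k i * a i" for k] by (intro sum.cong refl) (simp add: g_def mult.assoc)
  also have "\<dots> \<le> sqrt (\<Sum>k\<in>K. \<Sum>l\<in>K. (cmod (\<Sum>i\<in>E. f k i * cnj (f l i)))\<^sup>2) *
      sqrt (\<Sum>m\<in>F. \<Sum>l\<in>F. (cmod (\<Sum>i\<in>E. g m i * cnj (g l i)))\<^sup>2)"
    by (rule sum_cross_inner_le_Gram)
  also have "\<dots> \<le> sqrt (\<Sum>k\<in>K. \<Sum>l\<in>K. (cmod (\<Sum>i\<in>E. f k i * cnj (f l i)))\<^sup>2) *
      (\<beta> * (\<Sum>n\<in>G. (h n)\<^sup>2))"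
    by (intro mult_left_mono real_le_lsqrt g_Gram) (auto intro!: sum_nonneg mult_nonneg_nonneg beta)
  finally show ?thesis unfolding h_sum by (simp add: mult_ac)
qed

section \<open>Characters of the torus\<close>

lemma sets_circle_measure: "sets circle_measure = sets (restrict_space borel (sphere 0 1))"
  by (simp add: circle_measure_def)

lemma measurable_torus_coord [measurable]: "(\<lambda>z. z i) \<in> borel_measurable (torus :: ('d::finite \<Rightarrow> complex) measure)"
proof -
  have "(\<lambda>z. z i) \<in> measurable torus circle_measure"
    unfolding torus_def by (rule measurable_component_singleton) simp
  moreover have "measurable (torus :: ('d \<Rightarrow> complex) measure) circle_measure =
      measurable torus (restrict_space borel (sphere 0 1))"
    by (rule measurable_cong_sets) (simp_all add: sets_circle_measure)
  ultimately show ?thesis by (simp add: measurable_restrict_space2_iff)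
qed

lemma measurable_torusI:
  assumes "\<And>i. (\<lambda>x. g x i) \<in> borel_measurable N" and "\<And>x i. x \<in> space N \<Longrightarrow> cmod (g x i) = 1"
  shows "g \<in> measurable N (torus :: ('d::finite \<Rightarrow> complex) measure)"
  unfolding torus_def
proof (rule measurable_PiM_single')
  fix i :: 'd
  have "measurable N circle_measure = measurable N (restrict_space borel (sphere 0 1))"
    by (rule measurable_cong_sets) (simp_all add: sets_circle_measure)
  then show "(\<lambda>x. g x i) \<in> measurable N circle_measure"
    using assms by (auto simp: measurable_restrict_space2_iff)
next
  show "g \<in> space N \<rightarrow> UNIV \<rightarrow>\<^sub>E space circle_measure"
    using assms by (auto simp: space_circle_measure)
qed

lemma measurable_cnj [measurable (raw)]:
  "g \<in> borel_measurable M \<Longrightarrow> (\<lambda>x. cnj (g x)) \<in> borel_measurable M"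
  by (rule measurable_compose[where N = borel])
    (auto intro!: borel_measurable_continuous_onI continuous_intros)

lemma norm_torus_divide:
  "z \<in> space torus \<Longrightarrow> w \<in> space torus \<Longrightarrow> cmod (z i / w i) = 1"
  by (simp add: space_torus norm_divide)

lemma torus_coord_nonzero: "z \<in> space torus \<Longrightarrow> z i \<noteq> 0"
  unfolding space_torus by (metis (mono_tags) mem_Collect_eq norm_zero zero_neq_one)

lemma inverse_torus_coord: "z \<in> space torus \<Longrightarrow> inverse (z i) = cnj (z i)"
  by (rule inverse_unique) (simp add: space_torus complex_norm_square[symmetric])

lemma measurable_power_int [measurable]:
  "(\<lambda>z::complex. z powi n) \<in> borel_measurable borel"
  by (cases "0 \<le> n") (simp_all add: power_int_def)

lemma measurable_torus_char [measurable]: "torus_char n \<in> borel_measurable torus"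
  unfolding torus_char_def[abs_def] by measurable

lemma torus_char_add:
  "z \<in> space torus \<Longrightarrow> torus_char (\<lambda>i. m i + n i) z = torus_char m z * torus_char n z"
  by (simp add: torus_char_def power_int_add torus_coord_nonzero prod.distrib)

lemma cnj_torus_char: "z \<in> space torus \<Longrightarrow> cnj (torus_char n z) = torus_char (\<lambda>i. - n i) z"
  by (simp add: torus_char_def power_int_minus inverse_torus_coord flip: power_int_inverse)

lemma norm_torus_char: "z \<in> space torus \<Longrightarrow> cmod (torus_char n z) = 1"
  by (simp add: torus_char_def prod_norm[symmetric] norm_power_int space_torus)

lemma torus_char_cnj: "torus_char n (\<lambda>i. cnj (z i)) = cnj (torus_char n z)"
  unfolding torus_char_def cnj_prod by (intro prod.cong refl) (simp add: power_int_def)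

lemma torus_char_zero: "torus_char (\<lambda>_. 0) z = 1"
  by (simp add: torus_char_def)

lemma torus_char_divide:
  "torus_char n (\<lambda>i. z i / w i) = torus_char n z / torus_char n w"
  by (simp add: torus_char_def power_int_divide_distrib prod_dividef)

lemma circle_integral_powi:
  "(LINT z|circle_measure. z powi n) = (if n = 0 then 1 else 0)"
proof -
  let ?U = "uniform_measure lborel {0..<2 * pi} :: real measure"
  have [measurable]: "(\<lambda>t. cis (of_int n * t)) \<in> borel_measurable borel"
    by (intro borel_measurable_continuous_onI continuous_intros)
  have meas: "(\<lambda>z::complex. z powi n) \<in> borel_measurable (restrict_space borel (sphere 0 1))"
    by (rule measurable_restrict_space1) (rule measurable_power_int)
  have "(LINT z|circle_measure. z powi n) = (LINT t|?U. cis t powi n)"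
    unfolding circle_measure_def by (rule integral_distr[OF measurable_cis_circle meas])
  also have "\<dots> = (LINT t|?U. cis (of_int n * t))"
    by (simp add: cis_power_int mult.commute)
  also have "\<dots> = (LINT t:{0..<2 * pi}|lborel. cis (of_int n * t)) / (2 * pi)"
  proof -
    have "?U = density lborel (\<lambda>t. ennreal (indicator {0..<2 * pi} t / (2 * pi)))"
      unfolding uniform_measure_def
      by (intro density_cong) (auto simp: indicator_def ennreal_1[symmetric] divide_ennreal simp del: ennreal_1)
    then have "(LINT t|?U. cis (of_int n * t)) =
        (LINT t|lborel. (indicator {0..<2 * pi} t / (2 * pi)) *\<^sub>R cis (of_int n * t))"
      by (simp only:) (rule integral_density,
        auto intro!: borel_measurable_continuous_onI continuous_intros)
    also have "\<dots> = (LINT t|lborel. (1 / (2 * pi)) *\<^sub>R (indicator {0..<2 * pi} t *\<^sub>R cis (of_int n * t)))"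
      by simp
    finally show ?thesis
      unfolding set_lebesgue_integral_def by (simp add: scaleR_conv_of_real field_simps)
  qed
  also have "(LINT t:{0..<2 * pi}|lborel. cis (of_int n * t)) = (LINT t:{0..2 * pi}|lborel. cis (of_int n * t))"
    unfolding set_lebesgue_integral_def
  proof (rule integral_cong_AE)
    show "AE t in lborel. indicat_real {0..<2 * pi} t *\<^sub>R cis (of_int n * t) =
        indicat_real {0..2 * pi} t *\<^sub>R cis (of_int n * t)"
      using AE_lborel_singleton[of "2 * pi"] by eventually_elim (auto simp: indicator_def)
  qed measurable
  also have "\<dots> = (if n = 0 then 2 * pi else 0)"
  proof (cases "n = 0")
    case False
    have "(LINT t:{0..2 * pi}|lborel. cis (of_int n * t)) =
        cis (of_int n * (2 * pi)) / (\<i> * of_int n) - cis (of_int n * 0) / (\<i> * of_int n)"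
      unfolding set_lebesgue_integral_def
    proof (rule integral_FTC_Icc)
      fix t :: real
      have "((\<lambda>t. exp (\<i> * of_int n * of_real t) / (\<i> * of_int n)) has_vector_derivative exp (\<i> * of_int n * of_real t)) (at t within {0..2 * pi})"
        using False by (auto intro!: derivative_eq_intros has_vector_derivative_real_field)
      then show "((\<lambda>t. cis (of_int n * t) / (\<i> * of_int n)) has_vector_derivative cis (of_int n * t)) (at t within {0..2 * pi})"
        by (simp add: cis_conv_exp mult_ac)
    qed (auto intro!: continuous_intros)
    also have "cis (of_int n * (2 * pi)) = 1"
      using cis_multiple_2pi[of "of_int n"] by (simp add: mult_ac)
    finally show ?thesis using False by simp
  qed (simp add: set_lebesgue_integral_def scaleR_conv_of_real)
  finally show ?thesis by simp
qed

lemma integrable_torus_bounded: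
  assumes "F \<in> borel_measurable torus" "\<And>z. z \<in> space torus \<Longrightarrow> norm (F z) \<le> C"
  shows "integrable (torus :: ('d::finite \<Rightarrow> complex) measure) (F :: _ \<Rightarrow> 'b::{banach, second_countable_topology})"
proof -
  interpret prob_space "torus :: ('d \<Rightarrow> complex) measure" by (rule prob_space_torus)
  show ?thesis
    by (rule integrable_const_bound[where B = C]) (use assms in \<open>auto intro: AE_I2\<close>)
qed

text \<open>The product structure of Haar measure reduces this to the circle.\<close>

lemma integral_torus_char:
  "(LINT z|(torus :: ('d::finite \<Rightarrow> complex) measure). torus_char n z) = (if n = (\<lambda>_. 0) then 1 else 0)"
proof -
  interpret prob_space circle_measure by (rule prob_space_circle_measure)
  interpret product_sigma_finite "\<lambda>_::'d. circle_measure" by standard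
  have "integrable circle_measure (\<lambda>z. z powi k)" for k
  proof (rule integrable_const_bound[where B = 1])
    have "(borel_measurable circle_measure :: (complex \<Rightarrow> complex) set) = borel_measurable (restrict_space borel (sphere (0::complex) 1))"
      by (rule measurable_cong_sets) (simp_all add: sets_circle_measure)
    moreover have "(\<lambda>z::complex. z powi k) \<in> borel_measurable (restrict_space borel (sphere (0::complex) 1))"
      by (rule measurable_restrict_space1) (rule measurable_power_int)
    ultimately show "(\<lambda>z. z powi k) \<in> borel_measurable circle_measure" by simp
    show "AE z in circle_measure. cmod (z powi k) \<le> 1"
      by (rule AE_I2) (auto simp: space_circle_measure norm_power_int)
  qed
  then have "(LINT z|(torus :: ('d \<Rightarrow> complex) measure). torus_char n z) = (\<Prod>i\<in>UNIV. LINT z|circle_measure. z powi n i)"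
    unfolding torus_def torus_char_def by (intro product_integral_prod) auto
  also have "\<dots> = (if n = (\<lambda>_. 0) then 1 else 0)"
    by (auto simp: circle_integral_powi fun_eq_iff prod_zero_iff)
  finally show ?thesis .
qed

section \<open>Functionals that vanish on the characters\<close>

definition bounded_borel :: "('d::finite) torus_fun set" where
  "bounded_borel = {F \<in> borel_measurable torus. \<exists>C. \<forall>z\<in>space torus. cmod (F z) \<le> C}"

text \<open>The same point in a Euclidean space, where the Stone-Weierstrass theorem for polynomials applies.\<close>

definition torus_vec :: "('d::finite \<Rightarrow> complex) \<Rightarrow> complex ^ 'd" where
  "torus_vec z = (\<chi> i. z i)"

lemma measurable_torus_vec [measurable]: "torus_vec \<in> borel_measurable torus"
proof (subst borel_measurable_euclidean_space, rule ballI)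
  fix b :: "complex ^ 'd" assume "b \<in> Basis"
  then obtain i u where "b = axis i u" by (auto simp: Basis_vec_def)
  then show "(\<lambda>z. torus_vec z \<bullet> b) \<in> borel_measurable torus"
    by (simp add: inner_axis torus_vec_def)
qed

lemma compact_torus_vec: "compact {x :: complex ^ 'd::finite. \<forall>i. cmod (x $ i) = 1}"
proof -
  have "closed {x :: complex ^ 'd. \<forall>i. cmod (x $ i) = 1}"
    by (intro closed_Collect_all closed_Collect_eq continuous_intros)
  moreover have "bounded {x :: complex ^ 'd. \<forall>i. cmod (x $ i) = 1}"
  proof (rule boundedI)
    fix x :: "complex ^ 'd" assume "x \<in> {x. \<forall>i. cmod (x $ i) = 1}"
    then have "(\<Sum>i\<in>UNIV. cmod (x $ i)) = real CARD('d)" by simp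
    then show "norm x \<le> real CARD('d)" using L2_set_le_sum[of UNIV "\<lambda>i. norm (x $ i)"] by (simp add: norm_vec_def)
  qed
  ultimately show ?thesis by (simp add: compact_eq_bounded_closed)
qed

lemma bounded_borelI:
  "F \<in> borel_measurable torus \<Longrightarrow> (\<And>z. z \<in> space torus \<Longrightarrow> cmod (F z) \<le> C) \<Longrightarrow> F \<in> bounded_borel"
  by (auto simp: bounded_borel_def)

lemma bounded_borel_measurable [measurable_dest]: "F \<in> bounded_borel \<Longrightarrow> F \<in> borel_measurable torus"
  by (simp add: bounded_borel_def)

lemma bounded_borel_add:
  assumes "F \<in> bounded_borel" "G \<in> bounded_borel"
  shows "(\<lambda>z. F z + G z) \<in> bounded_borel"
proof -
  obtain C D where "\<forall>z\<in>space torus. cmod (F z) \<le> C" "\<forall>z\<in>space torus. cmod (G z) \<le> D"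
    using assms by (auto simp: bounded_borel_def)
  then have "cmod (F z + G z) \<le> C + D" if "z \<in> space torus" for z
    using that by (auto intro!: norm_triangle_mono)
  then show ?thesis using assms by (intro bounded_borelI) auto
qed

lemma bounded_borel_mult:
  assumes "F \<in> bounded_borel" "G \<in> bounded_borel"
  shows "(\<lambda>z. F z * G z) \<in> bounded_borel"
proof -
  obtain C D where "\<forall>z\<in>space torus. cmod (F z) \<le> C" "\<forall>z\<in>space torus. cmod (G z) \<le> D"
    using assms by (auto simp: bounded_borel_def)
  then have "cmod (F z * G z) \<le> \<bar>C\<bar> * \<bar>D\<bar>" if "z \<in> space torus" for z
    using that unfolding norm_mult by (intro mult_mono) force+
  then show ?thesis using assms by (intro bounded_borelI) auto
qed

lemma bounded_borel_const: "(\<lambda>z. c) \<in> bounded_borel"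
  by (rule bounded_borelI) auto

lemma bounded_borel_char: "torus_char n \<in> bounded_borel"
  by (rule bounded_borelI[where C = 1]) (auto simp: norm_torus_char)

lemma bounded_borel_vec_Basis:
  assumes "b \<in> Basis"
  shows "(\<lambda>z. complex_of_real (torus_vec z \<bullet> b)) \<in> bounded_borel"
proof -
  obtain i u where b: "b = axis i u" "u \<in> Basis" using assms by (auto simp: Basis_vec_def)
  show ?thesis
    unfolding b(1) using b(2)
    by (intro bounded_borelI[where C = 1]) (auto simp: inner_axis torus_vec_def space_torus
        intro: order_trans[OF Basis_le_norm])
qed

text \<open>Completeness of the characters and invariance of Haar measure have a common core. A linear
  functional on bounded Borel functions that obeys the dominated convergence theorem and kills all
  characters kills all indicator functions: successively, it vanishes on polynomials in the coordinates and their
  conjugates, on continuous functions (Stone-Weierstrass), on indicators of open sets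
  (monotone limits of continuous functions), and on indicators of Borel sets (\<open>\<pi>\<close>-\<open>\<lambda>\<close> theorem).\<close>

locale torus_functional =
  fixes L :: "('d::finite) torus_fun \<Rightarrow> complex"
  assumes add: "F \<in> bounded_borel \<Longrightarrow> G \<in> bounded_borel \<Longrightarrow> L (\<lambda>z. F z + G z) = L F + L G"
    and scale: "F \<in> bounded_borel \<Longrightarrow> L (\<lambda>z. c * F z) = c * L F"
    and lim: "(\<And>k::nat. Fs k \<in> borel_measurable torus) \<Longrightarrow>
      (\<And>k z. z \<in> space torus \<Longrightarrow> cmod (Fs k z) \<le> C) \<Longrightarrow>
      (\<And>z. z \<in> space torus \<Longrightarrow> (\<lambda>k. Fs k z) \<longlonglongrightarrow> F z) \<Longrightarrow>
      F \<in> borel_measurable torus \<Longrightarrow> (\<lambda>k. L (Fs k)) \<longlonglongrightarrow> L F"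
    and char: "L (torus_char n) = 0"
begin

lemma cong: "F \<in> bounded_borel \<Longrightarrow> G \<in> bounded_borel \<Longrightarrow> (\<And>z. z \<in> space torus \<Longrightarrow> F z = G z) \<Longrightarrow> L F = L G"
proof -
  assume F: "F \<in> bounded_borel" and G: "G \<in> bounded_borel" and eq: "\<And>z. z \<in> space torus \<Longrightarrow> F z = G z"
  obtain C where C: "\<forall>z\<in>space torus. cmod (F z) \<le> C" using F by (auto simp: bounded_borel_def)
  have "(\<lambda>k::nat. L F) \<longlonglongrightarrow> L G"
    by (rule lim[where C = C]) (use F G eq C in auto)
  then show "L F = L G" by (simp add: LIMSEQ_const_iff)
qed

text \<open>That \<open>L\<close> kills \<open>F\<close> alone is not stable under multiplication by polynomials; that it kills \<open>F\<close> times
  every character is, and this is what the induction over polynomials needs.\<close>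

definition null :: "'d torus_fun \<Rightarrow> bool" where
  "null F \<longleftrightarrow> F \<in> bounded_borel \<and> (\<forall>n. L (\<lambda>z. F z * torus_char n z) = 0)"

lemma null_one: "null (\<lambda>_. 1)"
  by (auto simp: null_def bounded_borel_const char)

lemma null_zero: "null (\<lambda>_. 0)"
  using scale[OF bounded_borel_const, of 0] by (auto simp: null_def bounded_borel_const)

lemma null_add: "null F \<Longrightarrow> null G \<Longrightarrow> null (\<lambda>z. F z + G z)"
  by (auto simp: null_def bounded_borel_add distrib_right add bounded_borel_mult bounded_borel_char)

lemma null_scale: "null F \<Longrightarrow> null (\<lambda>z. c * F z)"
  by (auto simp: null_def bounded_borel_mult bounded_borel_const scale mult.assoc bounded_borel_char)

lemma null_sum: "finite A \<Longrightarrow> (\<And>a. a \<in> A \<Longrightarrow> null (F a)) \<Longrightarrow> null (\<lambda>z. \<Sum>a\<in>A. F a z)"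
  by (induction A rule: finite_induct) (auto simp: null_zero null_add)

lemma null_cong:
  assumes "null F" "G \<in> bounded_borel" "\<And>z. z \<in> space torus \<Longrightarrow> F z = G z"
  shows "null G"
proof -
  have "L (\<lambda>z. G z * torus_char n z) = L (\<lambda>z. F z * torus_char n z)" for n
    using assms by (intro cong bounded_borel_mult bounded_borel_char) (auto simp: null_def)
  with assms show ?thesis by (auto simp: null_def)
qed

lemma null_mult_char: "null F \<Longrightarrow> null (\<lambda>z. F z * torus_char m z)"
proof -
  assume F: "null F"
  have "L (\<lambda>z. F z * torus_char m z * torus_char n z) = L (\<lambda>z. F z * torus_char (\<lambda>i. m i + n i) z)" for n
    using F by (intro cong bounded_borel_mult bounded_borel_char)
      (auto simp: null_def torus_char_add)
  with F show "null (\<lambda>z. F z * torus_char m z)"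
    by (auto simp: null_def bounded_borel_mult bounded_borel_char)
qed

text \<open>A real coordinate function is \<open>Re (z i)\<close> or \<open>Im (z i)\<close>. On the torus \<open>cnj (z i) = inverse (z i)\<close>, so it
  is a combination of two characters.\<close>

lemma null_mult_coord:
  assumes F: "null F" and b: "b \<in> Basis"
  shows "null (\<lambda>z. F z * complex_of_real (torus_vec z \<bullet> b))"
proof -
  obtain i u where b': "b = axis i u" "u \<in> Basis" using b by (auto simp: Basis_vec_def)
  define \<delta> where "\<delta> = (\<lambda>j. if j = i then 1 else 0::int)"
  have char_i: "torus_char (\<lambda>j. \<delta> j) z = z i" "torus_char (\<lambda>j. - \<delta> j) z = cnj (z i)" if "z \<in> space torus" for z
  proof -
    show *: "torus_char (\<lambda>j. \<delta> j) z = z i"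
      unfolding torus_char_def \<delta>_def by (subst prod.remove[of _ i]) (auto simp: prod.neutral)
    show "torus_char (\<lambda>j. - \<delta> j) z = cnj (z i)"
      unfolding cnj_torus_char[OF that, of \<delta>, symmetric] * ..
  qed
  obtain c d where cd: "\<And>w. complex_of_real (w \<bullet> u) = c * w + d * cnj w"
  proof (cases "u = 1")
    case True
    then show ?thesis by (intro that[of "1/2" "1/2"]) (simp add: complex_eq_iff inner_complex_def)
  next
    case False
    then have "u = \<i>" using b'(2) by (auto simp: Basis_complex_def)
    then show ?thesis by (intro that[of "-\<i>/2" "\<i>/2"]) (simp add: complex_eq_iff inner_complex_def)
  qed
  have "null (\<lambda>z. c * (F z * torus_char (\<lambda>j. \<delta> j) z) + d * (F z * torus_char (\<lambda>j. - \<delta> j) z))"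
    by (intro null_add null_scale null_mult_char F)
  then show ?thesis
  proof (rule null_cong)
    show "(\<lambda>z. F z * complex_of_real (torus_vec z \<bullet> b)) \<in> bounded_borel"
      using F b by (intro bounded_borel_mult bounded_borel_vec_Basis) (auto simp: null_def)
    fix z :: "'d \<Rightarrow> complex" assume "z \<in> space torus"
    then show "c * (F z * torus_char (\<lambda>j. \<delta> j) z) + d * (F z * torus_char (\<lambda>j. - \<delta> j) z) =
        F z * complex_of_real (torus_vec z \<bullet> b)"
      by (simp add: char_i b'(1) inner_axis torus_vec_def cd algebra_simps)
  qed
qed

lemma null_mult_polynomial:
  "real_polynomial_function p \<Longrightarrow> null F \<Longrightarrow> null (\<lambda>z. F z * complex_of_real (p (torus_vec z)))"
proof (induction p arbitrary: F rule: real_polynomial_function.induct)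
  case (linear p)
  have p: "p x = (\<Sum>b\<in>Basis. (x \<bullet> b) * p b)" for x
  proof -
    interpret bounded_linear p by fact
    have "p x = p (\<Sum>b\<in>Basis. (x \<bullet> b) *\<^sub>R b)" by (simp add: euclidean_representation)
    then show ?thesis by (simp add: sum scale)
  qed
  have "null (\<lambda>z. \<Sum>b\<in>Basis. complex_of_real (p b) * (F z * complex_of_real (torus_vec z \<bullet> b)))"
    by (intro null_sum null_scale null_mult_coord linear) auto
  then show ?case by (subst p) (simp add: sum_distrib_left mult_ac)
next
  case (const c)
  then show ?case using null_scale[of F "complex_of_real c"] by (simp add: mult.commute)
next
  case (add p q)
  then show ?case using null_add[OF add.IH(1)[OF add.prems] add.IH(2)[OF add.prems]]
    by (simp add: algebra_simps)
next
  case (mult p q)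
  then show ?case using mult.IH(2)[OF mult.IH(1)[OF mult.prems]] by (simp add: mult.assoc)
qed

lemma continuous_eq_0:
  assumes f: "continuous_on UNIV f"
  shows "L (\<lambda>z. complex_of_real (f (torus_vec z))) = 0"
proof -
  let ?S = "{x :: complex ^ 'd. \<forall>i. cmod (x $ i) = 1}"
  have S: "torus_vec z \<in> ?S" if "z \<in> space torus" for z :: "'d \<Rightarrow> complex"
    using that by (simp add: space_torus torus_vec_def)
  have "\<forall>k. \<exists>g. real_polynomial_function g \<and> (\<forall>x\<in>?S. \<bar>f x - g x\<bar> < 1 / real (Suc k))"
  proof
    fix k
    show "\<exists>g. real_polynomial_function g \<and> (\<forall>x\<in>?S. \<bar>f x - g x\<bar> < 1 / real (Suc k))"
      by (rule Stone_Weierstrass_real_polynomial_function[OF compact_torus_vec, of f "1 / real (Suc k)"])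
        (use f in \<open>auto intro: continuous_on_subset\<close>)
  qed
  then obtain g where g: "\<And>k. real_polynomial_function (g k)"
    and approx: "\<And>k x. x \<in> ?S \<Longrightarrow> \<bar>f x - g k x\<bar> < 1 / real (Suc k)"
    by metis
  have "bounded (f ` ?S)"
    by (intro compact_imp_bounded compact_continuous_image compact_torus_vec continuous_on_subset[OF f]) auto
  then obtain C where C: "\<And>x. x \<in> ?S \<Longrightarrow> \<bar>f x\<bar> \<le> C" by (auto simp: bounded_iff)
  have g0: "L (\<lambda>z. complex_of_real (g k (torus_vec z))) = 0" for k
  proof -
    have "L (\<lambda>z. 1 * complex_of_real (g k (torus_vec z)) * torus_char (\<lambda>_. 0) z) = 0"
      using null_mult_polynomial[OF g null_one, of k] unfolding null_def by blast
    then show ?thesis by (simp add: torus_char_zero)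
  qed
  have "(\<lambda>k. L (\<lambda>z. complex_of_real (g k (torus_vec z)))) \<longlonglongrightarrow> L (\<lambda>z. complex_of_real (f (torus_vec z)))"
  proof (rule lim)
    show "(\<lambda>z. complex_of_real (g k (torus_vec z))) \<in> borel_measurable torus" for k
      using null_mult_polynomial[OF g null_one, of k] by (simp add: null_def bounded_borel_measurable)
    have [measurable]: "f \<in> borel_measurable borel" by (rule borel_measurable_continuous_onI[OF f])
    show "(\<lambda>z. complex_of_real (f (torus_vec z))) \<in> borel_measurable torus" by measurable
    fix z :: "'d \<Rightarrow> complex" assume z: "z \<in> space torus"
    show "cmod (complex_of_real (g k (torus_vec z))) \<le> C + 1" for k
    proof -
      have "1 / real (Suc k) \<le> 1" by simp
      then show ?thesis using approx[OF S[OF z], of k] C[OF S[OF z]] by (simp only: norm_of_real)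
    qed
    have "(\<lambda>k. g k (torus_vec z)) \<longlonglongrightarrow> f (torus_vec z)"
    proof (rule metric_LIMSEQ_I)
      fix e :: real assume "0 < e"
      then obtain N where N: "1 / real (Suc N) < e" using nat_approx_posE by blast
      show "\<exists>N. \<forall>k\<ge>N. dist (g k (torus_vec z)) (f (torus_vec z)) < e"
      proof (intro exI allI impI)
        fix k assume "N \<le> k"
        then have "1 / real (Suc k) \<le> 1 / real (Suc N)" by (intro divide_left_mono) auto
        with N approx[OF S[OF z], of k] show "dist (g k (torus_vec z)) (f (torus_vec z)) < e"
          by (simp only: dist_real_def)
      qed
    qed
    then show "(\<lambda>k. complex_of_real (g k (torus_vec z))) \<longlonglongrightarrow> complex_of_real (f (torus_vec z))"
      by (rule tendsto_of_real)
  qed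
  then show ?thesis by (simp add: g0 LIMSEQ_const_iff)
qed

lemma indicator_open_eq_0:
  assumes U: "open U"
  shows "L (\<lambda>z. indicator U (torus_vec z)) = 0"
proof (cases "U = UNIV")
  case True
  then show ?thesis using char[of "\<lambda>_. 0"] by (simp add: torus_char_zero[abs_def])
next
  case False
  \<comment> \<open>continuous functions that increase to the indicator of \<open>U\<close>; the case \<open>U = UNIV\<close> is separate
    because \<open>infdist\<close> to the empty set is 0\<close>
  define f where "f k x = min 1 (real k * infdist x (- U))" for k x
  have [measurable]: "U \<in> sets borel" using U by simp
  have cont: "continuous_on UNIV (f k)" for k
    unfolding f_def by (intro continuous_intros)
  have "(\<lambda>k. L (\<lambda>z. complex_of_real (f k (torus_vec z)))) \<longlonglongrightarrow> L (\<lambda>z. indicator U (torus_vec z))"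
  proof (rule lim)
    show "(\<lambda>z. complex_of_real (f k (torus_vec z))) \<in> borel_measurable torus" for k
    proof -
      have [measurable]: "f k \<in> borel_measurable borel" by (rule borel_measurable_continuous_onI[OF cont])
      show ?thesis by measurable
    qed
    show "cmod (complex_of_real (f k (torus_vec z))) \<le> 1" for k z
      by (simp add: f_def infdist_nonneg)
    show "(\<lambda>k. complex_of_real (f k (torus_vec z))) \<longlonglongrightarrow> indicator U (torus_vec z)" for z
    proof (cases "torus_vec z \<in> U")
      case False
      then show ?thesis by (simp add: f_def)
    next
      case in_U: True
      let ?r = "infdist (torus_vec z) (- U)"
      have "closed (- U)" "- U \<noteq> {}" using U False by auto
      then have "?r \<noteq> 0" using in_U by (simp add: in_closed_iff_infdist_zero[symmetric])
      then have r: "0 < ?r" using infdist_nonneg[of "torus_vec z" "- U"] by linarith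
      obtain N where N: "1 < real N * ?r" using reals_Archimedean3[OF r] by blast
      have "eventually (\<lambda>k. complex_of_real (f k (torus_vec z)) = 1) sequentially"
      proof (rule eventually_sequentiallyI[of N])
        fix k assume "N \<le> k"
        then have "real N * ?r \<le> real k * ?r" using r by (intro mult_right_mono) auto
        then show "complex_of_real (f k (torus_vec z)) = 1" using N by (simp add: f_def)
      qed
      then show ?thesis using in_U by (simp add: tendsto_eventually)
    qed
  qed measurable
  then show ?thesis by (simp add: continuous_eq_0[OF cont] LIMSEQ_const_iff)
qed

lemma indicator_borel_eq_0:
  assumes B: "B \<in> sets borel"
  shows "L (\<lambda>z. indicator B (torus_vec z)) = 0"
proof -
  have bb: "(\<lambda>z. indicator A (torus_vec z)) \<in> bounded_borel" if "A \<in> sets borel" for A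
    using that by (intro bounded_borelI[where C = 1]) (auto simp: indicator_def)
  have "Int_stable {S :: (complex ^ 'd) set. open S}" "{S :: (complex ^ 'd) set. open S} \<subseteq> Pow UNIV"
    by (auto simp: Int_stable_def)
  moreover have "B \<in> sigma_sets UNIV {S. open S}" using B by (simp add: borel_def)
  ultimately show ?thesis
  proof (induction rule: sigma_sets_induct_disjoint)
    case (basic A)
    then show ?case by (auto intro: indicator_open_eq_0)
  next
    case empty
    show ?case by (rule indicator_open_eq_0) auto
  next
    case (compl A)
    then have A: "A \<in> sets borel" by (simp add: borel_def)
    have "L (\<lambda>z. 1 + (-1) * indicator A (torus_vec z)) = L (\<lambda>z. 1) + (-1) * L (\<lambda>z. indicator A (torus_vec z))"
      by (subst add, (intro bounded_borel_const bounded_borel_mult bb A)+, subst scale[OF bb[OF A]]) simp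
    also have "\<dots> = 0" using char[of "\<lambda>_. 0"] compl(2) by (simp add: torus_char_zero[abs_def])
    also have "(\<lambda>z. 1 + (-1) * indicator A (torus_vec z)) = (\<lambda>z. indicator (UNIV - A) (torus_vec z) :: complex)"
      by (auto simp: fun_eq_iff split: split_indicator)
    finally show ?case .
  next
    case (union A)
    then have A: "A i \<in> sets borel" for i by (auto simp: borel_def)
    have sum0: "L (\<lambda>z. \<Sum>i<k. indicator (A i) (torus_vec z)) = 0
        \<and> (\<lambda>z. \<Sum>i<k. indicator (A i) (torus_vec z)) \<in> bounded_borel" for k
    proof (induction k)
      case 0
      then show ?case using scale[OF bounded_borel_const, of 0] by (auto simp: bounded_borel_const)
    next
      case (Suc k)
      then show ?case by (simp add: add bounded_borel_add bb[OF A] union(3))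
    qed
    have sums: "(\<lambda>i. indicator (A i) x) sums (indicator (\<Union>i. A i) x :: complex)" for x
      using sums_of_real[OF indicator_sums[of A x], where 'a = complex] union(1)
      by (simp add: disjoint_family_on_def of_real_indicator)
    have "(\<lambda>k. L (\<lambda>z. \<Sum>i<k. indicator (A i) (torus_vec z))) \<longlonglongrightarrow> L (\<lambda>z. indicator (\<Union>i. A i) (torus_vec z))"
    proof (rule lim)
      show "(\<lambda>z. \<Sum>i<k. indicator (A i) (torus_vec z) :: complex) \<in> borel_measurable torus" for k
        by (rule bounded_borel_measurable, rule conjunct2[OF sum0])
      show "(\<lambda>k. \<Sum>i<k. indicator (A i) (torus_vec z)) \<longlonglongrightarrow> (indicator (\<Union>i. A i) (torus_vec z) :: complex)" for z
        using sums by (simp add: sums_def)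
      show "(\<lambda>z. indicator (\<Union>i. A i) (torus_vec z) :: complex) \<in> borel_measurable torus"
        using A by (intro bounded_borel_measurable bb) auto
      fix k and z :: "'d \<Rightarrow> complex"
      have "cmod (\<Sum>i<k. indicator (A i) (torus_vec z)) = cmod (indicator (\<Union>i<k. A i) (torus_vec z))"
        using union(1) by (subst indicator_UN_disjoint) (auto simp: disjoint_family_on_def)
      then show "cmod (\<Sum>i<k. indicator (A i) (torus_vec z)) \<le> 1"
        by (simp add: indicator_def)
    qed
    then show ?case by (simp add: sum0 LIMSEQ_const_iff)
  qed
qed

theorem indicator_eq_0:
  assumes A: "A \<in> sets torus"
  shows "L (indicator A) = 0"
proof -
  let ?S = "{x :: complex ^ 'd. \<forall>i. cmod (x $ i) = 1}"
  have "(\<lambda>x i. x $ i) \<in> measurable (restrict_space borel ?S) torus"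
    by (rule measurable_torusI)
      (auto simp: space_restrict_space intro!: measurable_restrict_space1 borel_measurable_continuous_onI continuous_intros)
  from measurable_sets[OF this A]
  have "(\<lambda>x i. x $ i) -` A \<inter> ?S \<in> sets (restrict_space borel ?S)"
    by (simp add: space_restrict_space)
  then obtain B where B: "B \<in> sets borel" "(\<lambda>x i. x $ i) -` A \<inter> ?S = ?S \<inter> B"
    by (auto simp: sets_restrict_space)
  have "L (indicator A) = L (\<lambda>z. indicator B (torus_vec z))"
  proof (rule cong)
    show "indicator A \<in> bounded_borel"
      using A by (intro bounded_borelI[where C = 1]) (auto simp: indicator_def)
    show "(\<lambda>z. indicator B (torus_vec z)) \<in> bounded_borel"
      using B by (intro bounded_borelI[where C = 1]) (auto simp: indicator_def)
    fix z :: "'d \<Rightarrow> complex" assume z: "z \<in> space torus"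
    then have "torus_vec z \<in> ?S" by (simp add: space_torus torus_vec_def)
    then have "z \<in> A \<longleftrightarrow> torus_vec z \<in> B" using set_eq_iff[THEN iffD1, OF B(2), rule_format, of "torus_vec z"]
        vec_lambda_inverse[of z]
      by (auto simp: torus_vec_def)
    then show "indicator A z = (indicator B (torus_vec z) :: complex)" by (simp add: indicator_def)
  qed
  then show ?thesis by (simp add: indicator_borel_eq_0[OF B(1)])
qed

end


section \<open>Fourier coefficients and invariance of Haar measure\<close>

lemma integrable_mult_bounded:
  assumes f: "integrable (torus :: ('d::finite \<Rightarrow> complex) measure) f" and F: "F \<in> bounded_borel"
  shows "integrable torus (\<lambda>z. f z * F z)"
proof -
  obtain C where C: "\<forall>z\<in>space torus. cmod (F z) \<le> C" using F by (auto simp: bounded_borel_def)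
  show ?thesis
  proof (rule Bochner_Integration.integrable_bound)
    show "integrable torus (\<lambda>z. C * cmod (f z))" using f by auto
    show "(\<lambda>z. f z * F z) \<in> borel_measurable torus"
      using borel_measurable_integrable[OF f] bounded_borel_measurable[OF F] by measurable
    show "AE z in torus. norm (f z * F z) \<le> norm (C * cmod (f z))"
    proof (rule AE_I2)
      fix z :: "'d \<Rightarrow> complex" assume "z \<in> space torus"
      then have "cmod (F z) \<le> \<bar>C\<bar>" using C by force
      then show "norm (f z * F z) \<le> norm (C * cmod (f z))"
        by (simp add: norm_mult abs_mult mult.commute mult_right_mono)
    qed
  qed
qed

lemma integrable_mult_cnj_char:
  "integrable torus f \<Longrightarrow> integrable torus (\<lambda>z. f z * cnj (torus_char n z))"
  by (rule integrable_mult_bounded, assumption, rule bounded_borelI[where C = 1])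
    (auto simp: norm_torus_char intro!: measurable_cnj)

text \<open>The functional is \<open>F \<mapsto> \<integral> f F\<close>: if it vanishes on indicators then so does \<open>f\<close> almost everywhere.\<close>

theorem fourier_coeff_unique:
  fixes f :: "('d::finite) torus_fun"
  assumes f: "integrable torus f" and 0: "\<And>n. fourier_coeff f n = 0"
  shows "AE z in torus. f z = 0"
proof -
  interpret L: torus_functional "\<lambda>F. LINT z|torus. f z * F z"
  proof
    show "(LINT z|torus. f z * (F z + G z)) = (LINT z|torus. f z * F z) + (LINT z|torus. f z * G z)"
      if "F \<in> bounded_borel" "G \<in> bounded_borel" for F G
      using that f by (simp add: distrib_left integrable_mult_bounded)
    show "(LINT z|torus. f z * (c * F z)) = c * (LINT z|torus. f z * F z)" for F c
      by (subst integral_mult_right_zero[symmetric]) (simp add: mult_ac)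
    show "(\<lambda>k. LINT z|torus. f z * Fs k z) \<longlonglongrightarrow> (LINT z|torus. f z * F z)"
      if "\<And>k::nat. Fs k \<in> borel_measurable torus" "\<And>k z. z \<in> space torus \<Longrightarrow> cmod (Fs k z) \<le> C"
        "\<And>z. z \<in> space torus \<Longrightarrow> (\<lambda>k. Fs k z) \<longlonglongrightarrow> F z" "F \<in> borel_measurable torus" for Fs F C
    proof (rule integral_dominated_convergence[where w = "\<lambda>z. C * cmod (f z)"])
      note [measurable] = that(1,4) borel_measurable_integrable[OF f]
      show "(\<lambda>z. f z * F z) \<in> borel_measurable torus" "(\<lambda>z. f z * Fs k z) \<in> borel_measurable torus" for k
        by measurable
      show "AE z in torus. (\<lambda>k. f z * Fs k z) \<longlonglongrightarrow> f z * F z"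
        by (rule AE_I2) (intro tendsto_intros that)
      show "AE z in torus. norm (f z * Fs k z) \<le> C * cmod (f z)" for k
        by (rule AE_I2) (subst norm_mult, subst mult.commute, intro mult_right_mono that, auto)
    qed (use f in auto)
    show "(LINT z|torus. f z * torus_char n z) = 0" for n
    proof -
      have "(LINT z|torus. f z * torus_char n z) = fourier_coeff f (\<lambda>i. - n i)"
        unfolding fourier_coeff_def
        by (rule Bochner_Integration.integral_cong) (auto simp: cnj_torus_char)
      then show ?thesis by (simp add: 0)
    qed
  qed
  interpret prob_space "torus :: ('d \<Rightarrow> complex) measure" by (rule prob_space_torus)
  show ?thesis
  proof (rule density_zero[OF f])
    fix A assume "A \<in> sets (torus :: ('d \<Rightarrow> complex) measure)"
    then have "(LINT z|torus. f z * indicator A z) = 0" by (rule L.indicator_eq_0)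
    moreover have "f z * indicator A z = indicator A z *\<^sub>R f z" for z
      by (simp add: indicator_def)
    ultimately show "set_lebesgue_integral torus A f = 0"
      by (simp add: set_lebesgue_integral_def)
  qed
qed

text \<open>The functional is the difference of the two integrals. Applied to rotations and to complex
  conjugation, this yields the symmetries of Haar measure from the orthogonality of the characters.\<close>

theorem distr_torus_eqI:
  fixes T :: "('d::finite \<Rightarrow> complex) \<Rightarrow> 'd \<Rightarrow> complex"
  assumes T [measurable]: "T \<in> measurable torus torus"
    and char: "\<And>n. (LINT z|torus. torus_char n (T z)) = (LINT z|torus. torus_char n z)"
  shows "distr torus torus T = torus"
proof (rule measure_eqI)
  interpret prob_space "torus :: ('d \<Rightarrow> complex) measure" by (rule prob_space_torus)
  have int: "integrable torus F" if "F \<in> bounded_borel" for F :: "'d torus_fun"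
    using that by (auto simp: bounded_borel_def intro: integrable_torus_bounded)
  have comp: "(\<lambda>z. F (T z)) \<in> bounded_borel" if "F \<in> bounded_borel" for F
    using that measurable_space[OF T] by (force simp: bounded_borel_def intro: measurable_compose[OF T])
  have dct: "(\<lambda>k. LINT z|torus. Fs k z) \<longlonglongrightarrow> (LINT z|torus. F z)"
    if "\<And>k::nat. Fs k \<in> borel_measurable torus" "\<And>k z. z \<in> space torus \<Longrightarrow> cmod (Fs k z) \<le> C"
      "\<And>z. z \<in> space torus \<Longrightarrow> (\<lambda>k. Fs k z) \<longlonglongrightarrow> F z" "F \<in> borel_measurable torus"
    for Fs C and F :: "'d torus_fun"
    by (rule integral_dominated_convergence[where w = "\<lambda>z. C"])
      (use that in \<open>auto intro!: AE_I2\<close>)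
  interpret L: torus_functional "\<lambda>F. (LINT z|torus. F (T z)) - (LINT z|torus. F z)"
  proof
    show "(LINT z|torus. F (T z) + G (T z)) - (LINT z|torus. F z + G z) =
        (LINT z|torus. F (T z)) - (LINT z|torus. F z) + ((LINT z|torus. G (T z)) - (LINT z|torus. G z))"
      if "F \<in> bounded_borel" "G \<in> bounded_borel" for F G
      using that by (simp add: int comp)
    show "(LINT z|torus. c * F (T z)) - (LINT z|torus. c * F z) = c * ((LINT z|torus. F (T z)) - (LINT z|torus. F z))"
      for F :: "'d torus_fun" and c
      by (simp add: right_diff_distrib)
    show "(\<lambda>k. (LINT z|torus. Fs k (T z)) - (LINT z|torus. Fs k z)) \<longlonglongrightarrow> (LINT z|torus. F (T z)) - (LINT z|torus. F z)"
      if "\<And>k::nat. Fs k \<in> borel_measurable torus" "\<And>k z. z \<in> space torus \<Longrightarrow> cmod (Fs k z) \<le> C"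
        "\<And>z. z \<in> space torus \<Longrightarrow> (\<lambda>k. Fs k z) \<longlonglongrightarrow> F z" "F \<in> borel_measurable torus" for Fs F C
    proof (rule tendsto_diff)
      show "(\<lambda>k. LINT z|torus. Fs k z) \<longlonglongrightarrow> (LINT z|torus. F z)"
        by (rule dct) (use that in auto)
      show "(\<lambda>k. LINT z|torus. Fs k (T z)) \<longlonglongrightarrow> (LINT z|torus. F (T z))"
        by (rule dct[of "\<lambda>k z. Fs k (T z)" C]) (use that measurable_space[OF T] in \<open>auto intro: measurable_compose[OF T]\<close>)
    qed
  qed (simp add: char)
  fix A assume "A \<in> sets (distr torus torus T)"
  then have A [measurable]: "A \<in> sets torus" by simp
  have ind: "(LINT z|torus. indicator B z :: complex) = of_real (measure torus B)" if "B \<in> sets torus"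
    for B :: "('d \<Rightarrow> complex) set"
  proof -
    have "(LINT z|torus. indicator B z :: complex) = (LINT z|torus. complex_of_real (indicator B z))"
      by (rule Bochner_Integration.integral_cong) (auto simp: indicator_def)
    also have "\<dots> = of_real (LINT z|torus. indicator B z)"
      using that by (intro integral_of_real integrable_real_indicator) (auto simp: emeasure_eq_measure)
    finally show ?thesis using that by (simp add: sets.Int_space_eq2)
  qed
  have "(LINT z|torus. indicator A (T z)) = (LINT z|torus. indicator (T -` A \<inter> space torus) z :: complex)"
    by (rule Bochner_Integration.integral_cong) (auto simp: indicator_def)
  then have "measure torus (T -` A \<inter> space torus) = measure torus A"
    using L.indicator_eq_0[OF A] by (simp add: ind)
  then show "emeasure (distr torus torus T) A = emeasure torus A"
    by (simp add: emeasure_distr emeasure_eq_measure)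
qed simp

lemma measurable_torus_divide:
  "(\<lambda>(z, w) i. z i / w i) \<in> measurable (torus \<Otimes>\<^sub>M torus) (torus :: ('d::finite \<Rightarrow> complex) measure)"
  by (rule measurable_torusI) (auto simp: case_prod_unfold space_pair_measure norm_torus_divide simp del: norm_divide)

lemma distr_torus_divide:
  assumes w: "w \<in> space torus"
  shows "distr torus torus (\<lambda>z i. z i / w i) = (torus :: ('d::finite \<Rightarrow> complex) measure)"
proof (rule distr_torus_eqI)
  show "(\<lambda>z i. z i / w i) \<in> measurable torus torus"
    using w by (intro measurable_torusI) (auto simp: norm_torus_divide)
  show "(LINT z|torus. torus_char n (\<lambda>i. z i / w i)) = (LINT z|torus. torus_char n z)" for n
    by (cases "n = (\<lambda>_. 0)") (simp_all add: torus_char_divide integral_torus_char torus_char_zero)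
qed

lemma distr_torus_cnj: "distr torus torus (\<lambda>z i. cnj (z i)) = (torus :: ('d::finite \<Rightarrow> complex) measure)"
proof (rule distr_torus_eqI)
  show "(\<lambda>z i. cnj (z i)) \<in> measurable torus (torus :: ('d::finite \<Rightarrow> complex) measure)"
    by (intro measurable_torusI) (auto simp: space_torus)
  fix n :: "'d \<Rightarrow> int"
  have "(LINT z|torus. torus_char n (\<lambda>i. cnj (z i))) = (LINT z|torus. torus_char (\<lambda>i. - n i) z)"
    by (rule Bochner_Integration.integral_cong)
      (auto simp: cnj_torus_char torus_char_cnj)
  then show "(LINT z|torus. torus_char n (\<lambda>i. cnj (z i))) = (LINT z|torus. torus_char n z)"
    by (simp add: integral_torus_char fun_eq_iff)
qed

lemma dagger_integrable:
  fixes \<phi> :: "('d::finite) torus_fun"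
  assumes "integrable torus \<phi>"
  shows "integrable torus (dagger \<phi>)"
proof -
  have "(\<lambda>z i. cnj (z i)) \<in> measurable torus (torus :: ('d \<Rightarrow> complex) measure)"
    by (intro measurable_torusI) (auto simp: space_torus)
  from integrable_distr[OF this, of \<phi>] have "integrable torus (\<lambda>z. \<phi> (\<lambda>i. cnj (z i)))"
    using assms by (simp add: distr_torus_cnj)
  then show ?thesis unfolding dagger_def[abs_def] by simp
qed

lemma fourier_coeff_dagger:
  fixes \<phi> :: "('d::finite) torus_fun"
  assumes \<phi>: "integrable torus \<phi>"
  shows "fourier_coeff (dagger \<phi>) n = cnj (fourier_coeff \<phi> n)"
proof -
  have meas: "(\<lambda>z i. cnj (z i)) \<in> measurable torus (torus :: ('d \<Rightarrow> complex) measure)"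
    by (intro measurable_torusI) (auto simp: space_torus)
  have "(LINT z|torus. \<phi> z * cnj (torus_char n z)) =
      (LINT z|distr torus torus (\<lambda>z i. cnj (z i)). \<phi> z * cnj (torus_char n z))"
    by (simp add: distr_torus_cnj)
  also have "\<dots> = (LINT z|torus. \<phi> (\<lambda>i. cnj (z i)) * cnj (torus_char n (\<lambda>i. cnj (z i))))"
    by (rule integral_distr[OF meas]) (use \<phi> in measurable)
  also have "\<dots> = (LINT z|torus. cnj (dagger \<phi> z * cnj (torus_char n z)))"
    by (rule Bochner_Integration.integral_cong) (auto simp: dagger_def torus_char_cnj)
  also have "\<dots> = cnj (LINT z|torus. dagger \<phi> z * cnj (torus_char n z))"
    by (rule Bochner_Integration.integral_cnj)
  finally show ?thesis by (simp add: fourier_coeff_def)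
qed

text \<open>Fubini's theorem and the invariance under \<open>z \<mapsto> z / w\<close>. The function \<open>f \<star> g\<close> is defined by its integral
  at every point, so its integrability is part of the claim.\<close>

theorem fourier_coeff_conv:
  fixes f g :: "('d::finite) torus_fun"
  assumes f: "integrable torus f" and g: "integrable torus g"
  shows "integrable torus (f \<star> g)"
    and "fourier_coeff (f \<star> g) n = fourier_coeff f n * fourier_coeff g n"
proof -
  let ?T = "torus :: ('d \<Rightarrow> complex) measure"
  interpret prob_space ?T by (rule prob_space_torus)
  interpret P: pair_prob_space ?T ?T by standard
  note [measurable] = borel_measurable_integrable[OF f] borel_measurable_integrable[OF g]
  have fdiv [measurable]: "(\<lambda>p. f (\<lambda>i. fst p i / snd p i)) \<in> borel_measurable (?T \<Otimes>\<^sub>M ?T)"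
    using measurable_compose[OF measurable_torus_divide borel_measurable_integrable[OF f]]
    by (simp add: case_prod_unfold)
  have rot: "integrable torus (\<lambda>z. F (\<lambda>i. z i / w i)) = integrable torus F"
    "(LINT z|torus. F (\<lambda>i. z i / w i)) = (LINT z|torus. F z)"
    if w: "w \<in> space torus" and F: "F \<in> borel_measurable torus"
    for w and F :: "('d \<Rightarrow> complex) \<Rightarrow> 'b::{banach, second_countable_topology}"
  proof -
    have meas: "(\<lambda>z i. z i / w i) \<in> measurable torus ?T"
      using w by (intro measurable_torusI) (auto simp: norm_torus_divide)
    show "integrable torus (\<lambda>z. F (\<lambda>i. z i / w i)) = integrable torus F"
      using integrable_distr_eq[OF meas F] by (simp add: distr_torus_divide w)
    show "(LINT z|torus. F (\<lambda>i. z i / w i)) = (LINT z|torus. F z)"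
      using integral_distr[OF meas F] by (simp add: distr_torus_divide w)
  qed
  have pair_int: "integrable (?T \<Otimes>\<^sub>M ?T) (\<lambda>(w, z). f (\<lambda>i. z i / w i) * g w)"
  proof (rule P.Fubini_integrable)
    have "(\<lambda>p. f (\<lambda>i. snd p i / fst p i)) \<in> borel_measurable (?T \<Otimes>\<^sub>M ?T)"
      using measurable_compose[OF measurable_pair_swap' fdiv] by (simp add: case_prod_unfold)
    then show "(\<lambda>(w, z). f (\<lambda>i. z i / w i) * g w) \<in> borel_measurable (?T \<Otimes>\<^sub>M ?T)"
      by (simp add: case_prod_unfold)
    have "(LINT z|torus. norm (case (w, z) of (w, z) \<Rightarrow> f (\<lambda>i. z i / w i) * g w)) =
        (LINT z|torus. cmod (f z)) * cmod (g w)" if "w \<in> space torus" for w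
      using rot(2)[OF that, of "\<lambda>z. cmod (f z)"] by (simp add: norm_mult)
    then show "integrable torus (\<lambda>w. LINT z|torus. norm (case (w, z) of (w, z) \<Rightarrow> f (\<lambda>i. z i / w i) * g w))"
      using g by (subst Bochner_Integration.integrable_cong[OF refl]) auto
    show "AE w in torus. integrable torus (\<lambda>z. case (w, z) of (w, z) \<Rightarrow> f (\<lambda>i. z i / w i) * g w)"
      by (rule AE_I2) (simp add: rot(1)[of _ f] f)
  qed
  then have pair_int': "integrable (?T \<Otimes>\<^sub>M ?T) (\<lambda>(z, w). f (\<lambda>i. z i / w i) * g w)"
    by (subst P.integrable_product_swap_iff[symmetric]) (simp add: case_prod_unfold)
  from P.integrable_fst'[OF pair_int'] show "integrable torus (f \<star> g)"
    unfolding torus_conv_def[abs_def] by (simp add: case_prod_unfold)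
  have pair_char: "integrable (?T \<Otimes>\<^sub>M ?T) (\<lambda>(z, w). f (\<lambda>i. z i / w i) * g w * cnj (torus_char n z))"
  proof (rule Bochner_Integration.integrable_bound[OF pair_int'])
    show "(\<lambda>(z, w). f (\<lambda>i. z i / w i) * g w * cnj (torus_char n z)) \<in> borel_measurable (?T \<Otimes>\<^sub>M ?T)"
      using fdiv by (simp add: case_prod_unfold)
    show "AE p in ?T \<Otimes>\<^sub>M ?T. norm (case p of (z, w) \<Rightarrow> f (\<lambda>i. z i / w i) * g w * cnj (torus_char n z)) \<le>
        norm (case p of (z, w) \<Rightarrow> f (\<lambda>i. z i / w i) * g w)"
      by (rule AE_I2) (auto simp: space_pair_measure norm_mult norm_torus_char)
  qed
  have "fourier_coeff (f \<star> g) n = (LINT z|torus. LINT w|torus. f (\<lambda>i. z i / w i) * g w * cnj (torus_char n z))"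
    unfolding fourier_coeff_def torus_conv_def by simp
  also have "\<dots> = (LINT w|torus. LINT z|torus. f (\<lambda>i. z i / w i) * g w * cnj (torus_char n z))"
    by (rule P.Fubini_integral[OF pair_char, symmetric])
  also have "\<dots> = (LINT w|torus. fourier_coeff f n * (g w * cnj (torus_char n w)))"
  proof (rule Bochner_Integration.integral_cong[OF refl])
    fix w assume w: "w \<in> space ?T"
    have "(LINT z|torus. f (\<lambda>i. z i / w i) * g w * cnj (torus_char n z)) =
        (LINT z|torus. (g w * cnj (torus_char n w)) * (f (\<lambda>i. z i / w i) * cnj (torus_char n (\<lambda>i. z i / w i))))"
    proof (rule Bochner_Integration.integral_cong[OF refl])
      fix z :: "'d \<Rightarrow> complex"
      have "torus_char n w \<noteq> 0" using norm_torus_char[OF w, of n] by auto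
      then show "f (\<lambda>i. z i / w i) * g w * cnj (torus_char n z) =
          (g w * cnj (torus_char n w)) * (f (\<lambda>i. z i / w i) * cnj (torus_char n (\<lambda>i. z i / w i)))"
        by (simp add: torus_char_divide)
    qed
    also have "\<dots> = (g w * cnj (torus_char n w)) * (LINT z|torus. f z * cnj (torus_char n z))"
      using rot(2)[OF w, of "\<lambda>z. f z * cnj (torus_char n z)"] by simp
    finally show "(LINT z|torus. f (\<lambda>i. z i / w i) * g w * cnj (torus_char n z)) =
        fourier_coeff f n * (g w * cnj (torus_char n w))"
      by (simp add: fourier_coeff_def mult_ac)
  qed
  finally show "fourier_coeff (f \<star> g) n = fourier_coeff f n * fourier_coeff g n"
    by (simp add: fourier_coeff_def)
qed

section \<open>Square-integrable functions on the torus\<close>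

lemma Lp_fun_1_iff: "f \<in> Lp_fun 1 \<longleftrightarrow> integrable torus f"
  by (auto simp: Lp_fun_def integrable_iff_bounded)

lemma Lp_fun_2_iff:
  "f \<in> Lp_fun 2 \<longleftrightarrow> f \<in> borel_measurable torus \<and> integrable torus (\<lambda>z. (cmod (f z))\<^sup>2)"
  by (simp add: Lp_fun_def)

lemma Lp_fun_2_measurable [measurable_dest]: "f \<in> Lp_fun 2 \<Longrightarrow> f \<in> borel_measurable torus"
  by (simp add: Lp_fun_2_iff)

lemma L2_mult_cnj_integrable:
  fixes f g :: "('d::finite) torus_fun"
  assumes "f \<in> Lp_fun 2" "g \<in> Lp_fun 2"
  shows "integrable torus (\<lambda>z. f z * cnj (g z))"
proof (rule Bochner_Integration.integrable_bound)
  show "integrable torus (\<lambda>z. (cmod (f z))\<^sup>2 + (cmod (g z))\<^sup>2)"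
    using assms by (auto simp: Lp_fun_2_iff)
  show "(\<lambda>z. f z * cnj (g z)) \<in> borel_measurable torus"
    using assms by measurable
  show "AE z in torus. norm (f z * cnj (g z)) \<le> norm ((cmod (f z))\<^sup>2 + (cmod (g z))\<^sup>2)"
  proof (rule AE_I2)
    fix z
    have "2 * cmod (f z) * cmod (g z) \<le> (cmod (f z))\<^sup>2 + (cmod (g z))\<^sup>2"
      by (rule sum_squares_bound)
    moreover have "0 \<le> cmod (f z) * cmod (g z)" by simp
    ultimately have "cmod (f z) * cmod (g z) \<le> (cmod (f z))\<^sup>2 + (cmod (g z))\<^sup>2" by linarith
    then show "norm (f z * cnj (g z)) \<le> norm ((cmod (f z))\<^sup>2 + (cmod (g z))\<^sup>2)"
      by (simp add: norm_mult)
  qed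
qed

lemma bounded_borel_L2: "F \<in> bounded_borel \<Longrightarrow> F \<in> Lp_fun 2"
proof -
  assume F: "F \<in> bounded_borel"
  then obtain C where C: "\<forall>z\<in>space torus. cmod (F z) \<le> C" by (auto simp: bounded_borel_def)
  have "integrable torus (\<lambda>z. (cmod (F z))\<^sup>2)"
    using bounded_borel_measurable[OF F]
    by (intro integrable_torus_bounded[where C = "C\<^sup>2"]) (use C in \<open>auto intro: power_mono\<close>)
  then show "F \<in> Lp_fun 2" by (simp add: Lp_fun_2_iff bounded_borel_measurable[OF F])
qed

lemma L2_integrable: "f \<in> Lp_fun 2 \<Longrightarrow> integrable torus f"
  using L2_mult_cnj_integrable[OF _ bounded_borel_L2[OF bounded_borel_const], of f 1] by simp

lemma L2_lincomb:
  assumes f: "f \<in> Lp_fun 2" and g: "g \<in> Lp_fun 2"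
  shows "(\<lambda>z. a * f z + b * g z) \<in> Lp_fun 2"
proof -
  note [simp] = L2_mult_cnj_integrable[OF f f] L2_mult_cnj_integrable[OF f g]
    L2_mult_cnj_integrable[OF g f] L2_mult_cnj_integrable[OF g g]
  have "integrable torus (\<lambda>z. Re (a * cnj a * (f z * cnj (f z)) + a * cnj b * (f z * cnj (g z)) +
      b * cnj a * (g z * cnj (f z)) + b * cnj b * (g z * cnj (g z))))"
    by (intro integrable_Re Bochner_Integration.integrable_add integrable_mult_right) auto
  also have "(\<lambda>z. Re (a * cnj a * (f z * cnj (f z)) + a * cnj b * (f z * cnj (g z)) +
      b * cnj a * (g z * cnj (f z)) + b * cnj b * (g z * cnj (g z)))) =
      (\<lambda>z. (cmod (a * f z + b * g z))\<^sup>2)"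
  proof
    fix z
    have "complex_of_real ((cmod (a * f z + b * g z))\<^sup>2) = a * cnj a * (f z * cnj (f z)) + a * cnj b * (f z * cnj (g z)) +
      b * cnj a * (g z * cnj (f z)) + b * cnj b * (g z * cnj (g z))"
      unfolding complex_norm_square by (simp add: algebra_simps)
    then show "Re (a * cnj a * (f z * cnj (f z)) + a * cnj b * (f z * cnj (g z)) +
      b * cnj a * (g z * cnj (f z)) + b * cnj b * (g z * cnj (g z))) = (cmod (a * f z + b * g z))\<^sup>2"
      by (metis Re_complex_of_real)
  qed
  finally have "integrable torus (\<lambda>z. (cmod (a * f z + b * g z))\<^sup>2)" .
  moreover have "(\<lambda>z. a * f z + b * g z) \<in> borel_measurable torus"
    using f g by measurable
  ultimately show ?thesis by (simp add: Lp_fun_2_iff)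
qed

lemma L2_zero: "(\<lambda>_. 0) \<in> Lp_fun 2"
  by (rule bounded_borel_L2[OF bounded_borel_const])

lemma L2_char: "torus_char n \<in> Lp_fun 2"
  by (rule bounded_borel_L2[OF bounded_borel_char])

lemma L2_scale: "f \<in> Lp_fun 2 \<Longrightarrow> (\<lambda>z. a * f z) \<in> Lp_fun 2"
  using L2_lincomb[of f f a 0] by simp

lemma L2_add: "f \<in> Lp_fun 2 \<Longrightarrow> g \<in> Lp_fun 2 \<Longrightarrow> (\<lambda>z. f z + g z) \<in> Lp_fun 2"
  using L2_lincomb[of f g 1 1] by simp

lemma L2_diff: "f \<in> Lp_fun 2 \<Longrightarrow> g \<in> Lp_fun 2 \<Longrightarrow> (\<lambda>z. f z - g z) \<in> Lp_fun 2"
  using L2_lincomb[of f g 1 "-1"] by simp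

lemma L2_cnj: "f \<in> Lp_fun 2 \<Longrightarrow> (\<lambda>z. cnj (f z)) \<in> Lp_fun 2"
  by (simp add: Lp_fun_2_iff measurable_cnj)

lemma L2_inner_lincomb:
  "f \<in> Lp_fun 2 \<Longrightarrow> g \<in> Lp_fun 2 \<Longrightarrow> h \<in> Lp_fun 2 \<Longrightarrow>
    L2_inner (\<lambda>z. a * f z + b * g z) h = a * L2_inner f h + b * L2_inner g h"
  unfolding L2_inner_def by (simp add: distrib_right mult.assoc L2_mult_cnj_integrable)

lemma L2_inner_commute: "L2_inner g f = cnj (L2_inner f g)"
  unfolding L2_inner_def Bochner_Integration.integral_cnj[symmetric] by (simp add: mult.commute)

lemma L2_inner_diff:
  "f \<in> Lp_fun 2 \<Longrightarrow> g \<in> Lp_fun 2 \<Longrightarrow> h \<in> Lp_fun 2 \<Longrightarrow>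
    L2_inner (\<lambda>z. f z - g z) h = L2_inner f h - L2_inner g h"
  using L2_inner_lincomb[of f g h 1 "-1"] by simp

lemma L2_inner_lincomb_right:
  "f \<in> Lp_fun 2 \<Longrightarrow> g \<in> Lp_fun 2 \<Longrightarrow> h \<in> Lp_fun 2 \<Longrightarrow>
    L2_inner h (\<lambda>z. a * f z + b * g z) = cnj a * L2_inner h f + cnj b * L2_inner h g"
  by (subst L2_inner_commute, subst L2_inner_lincomb) (auto simp: L2_inner_commute[of f h] L2_inner_commute[of g h])

lemma L2_fnorm_nonneg [simp]: "0 \<le> L2_fnorm f"
  by (simp add: L2_fnorm_def)

lemma L2_fnorm_square: "(L2_fnorm f)\<^sup>2 = (LINT z|torus. (cmod (f z))\<^sup>2)"
  by (simp add: L2_fnorm_def)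

lemma L2_inner_self: "L2_inner f f = complex_of_real ((L2_fnorm f)\<^sup>2)"
  unfolding L2_fnorm_square L2_inner_def complex_norm_square[symmetric] by (rule integral_complex_of_real)

lemma L2_fnorm_lincomb_square:
  assumes "f \<in> Lp_fun 2" "g \<in> Lp_fun 2"
  shows "(L2_fnorm (\<lambda>z. a * f z + b * g z))\<^sup>2 =
    (cmod a)\<^sup>2 * (L2_fnorm f)\<^sup>2 + 2 * Re (a * cnj b * L2_inner f g) + (cmod b)\<^sup>2 * (L2_fnorm g)\<^sup>2"
proof -
  let ?h = "\<lambda>z. a * f z + b * g z"
  have "complex_of_real ((L2_fnorm ?h)\<^sup>2) = L2_inner ?h ?h" by (rule L2_inner_self[symmetric])
  also have "\<dots> = a * (cnj a * L2_inner f f + cnj b * L2_inner f g) + b * (cnj a * L2_inner g f + cnj b * L2_inner g g)"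
    using assms by (simp add: L2_inner_lincomb L2_inner_lincomb_right L2_lincomb)
  also have "\<dots> = a * cnj a * of_real ((L2_fnorm f)\<^sup>2) + (a * cnj b * L2_inner f g + cnj (a * cnj b * L2_inner f g))
      + b * cnj b * of_real ((L2_fnorm g)\<^sup>2)"
    by (simp add: L2_inner_self L2_inner_commute[of g f] algebra_simps)
  also have "\<dots> = of_real ((cmod a)\<^sup>2 * (L2_fnorm f)\<^sup>2 + 2 * Re (a * cnj b * L2_inner f g) + (cmod b)\<^sup>2 * (L2_fnorm g)\<^sup>2)"
    unfolding complex_norm_square[symmetric] complex_add_cnj by simp
  finally show ?thesis by (simp only: of_real_eq_iff)
qed

lemma L2_fnorm_scale: "L2_fnorm (\<lambda>z. a * f z) = cmod a * L2_fnorm f"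
  unfolding L2_fnorm_def by (simp add: norm_mult power_mult_distrib real_sqrt_mult)

lemma L2_Cauchy_Schwarz:
  assumes f: "f \<in> Lp_fun 2" and g: "g \<in> Lp_fun 2"
  shows "cmod (L2_inner f g) \<le> L2_fnorm f * L2_fnorm g"
proof -
  let ?I = "LINT z|torus. cmod (f z) * cmod (g z)"
  have int: "integrable torus (\<lambda>z. cmod (f z) * cmod (g z))"
    using integrable_norm[OF L2_mult_cnj_integrable[OF f g]] by (simp add: norm_mult)
  have sq: "(\<integral>\<^sup>+z. (ennreal (cmod (h z)))\<^sup>2 \<partial>torus) = ennreal ((L2_fnorm h)\<^sup>2)" if "h \<in> Lp_fun 2" for h :: "'a torus_fun"
    using that unfolding L2_fnorm_square
    by (subst nn_integral_eq_integral[symmetric]) (auto simp: Lp_fun_2_iff ennreal_power)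
  have "ennreal (?I\<^sup>2) = (\<integral>\<^sup>+z. ennreal (cmod (f z)) * ennreal (cmod (g z)) \<partial>torus)\<^sup>2"
    using nn_integral_eq_integral[OF int] by (simp add: ennreal_mult ennreal_power integral_nonneg)
  also have "\<dots> \<le> (\<integral>\<^sup>+z. (ennreal (cmod (f z)))\<^sup>2 \<partial>torus) * (\<integral>\<^sup>+z. (ennreal (cmod (g z)))\<^sup>2 \<partial>torus)"
    using f[THEN Lp_fun_2_measurable] g[THEN Lp_fun_2_measurable]
    by (intro Cauchy_Schwarz_nn_integral) simp_all
  also have "\<dots> = ennreal ((L2_fnorm f * L2_fnorm g)\<^sup>2)"
    by (simp add: sq f g ennreal_mult power_mult_distrib)
  finally have "?I\<^sup>2 \<le> (L2_fnorm f * L2_fnorm g)\<^sup>2" by simp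
  then have "?I \<le> L2_fnorm f * L2_fnorm g" by (rule power2_le_imp_le) simp
  moreover have "cmod (L2_inner f g) \<le> ?I"
    unfolding L2_inner_def by (rule order_trans[OF integral_norm_bound]) (simp add: norm_mult)
  ultimately show ?thesis by linarith
qed

lemma L2_fnorm_triangle:
  assumes "f \<in> Lp_fun 2" "g \<in> Lp_fun 2"
  shows "L2_fnorm (\<lambda>z. f z + g z) \<le> L2_fnorm f + L2_fnorm g"
proof (rule power2_le_imp_le)
  have "Re (L2_inner f g) \<le> L2_fnorm f * L2_fnorm g"
    using L2_Cauchy_Schwarz[OF assms] complex_Re_le_cmod order_trans by blast
  then show "(L2_fnorm (\<lambda>z. f z + g z))\<^sup>2 \<le> (L2_fnorm f + L2_fnorm g)\<^sup>2"
    using L2_fnorm_lincomb_square[OF assms, of 1 1] by (simp add: power2_sum)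
qed auto

lemma L2_fnorm_eq_0_AE:
  assumes "f \<in> Lp_fun 2" "L2_fnorm f = 0"
  shows "AE z in torus. f z = 0"
proof -
  have "(LINT z|torus. (cmod (f z))\<^sup>2) = 0" using assms(2) by (simp add: L2_fnorm_def)
  then have "AE z in torus. (cmod (f z))\<^sup>2 = 0"
    using assms(1) by (subst (asm) integral_nonneg_eq_0_iff_AE) (auto simp: Lp_fun_2_iff)
  then show ?thesis by simp
qed

lemma L2_fnorm_cong_AE:
  "f \<in> borel_measurable torus \<Longrightarrow> g \<in> borel_measurable torus \<Longrightarrow> AE z in torus. f z = g z \<Longrightarrow> L2_fnorm f = L2_fnorm g"
  unfolding L2_fnorm_def by (intro arg_cong[where f = sqrt] integral_cong_AE) auto

lemma L2_inner_cong_AE: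
  "f \<in> borel_measurable torus \<Longrightarrow> g \<in> borel_measurable torus \<Longrightarrow> h \<in> borel_measurable torus \<Longrightarrow>
    AE z in torus. f z = g z \<Longrightarrow> L2_inner f h = L2_inner g h"
  unfolding L2_inner_def by (intro integral_cong_AE) auto

lemma fourier_coeff_eq_inner: "fourier_coeff f n = L2_inner f (torus_char n)"
  by (simp add: fourier_coeff_def L2_inner_def)

lemma fourier_coeff_lincomb:
  "f \<in> Lp_fun 2 \<Longrightarrow> g \<in> Lp_fun 2 \<Longrightarrow>
    fourier_coeff (\<lambda>z. a * f z + b * g z) n = a * fourier_coeff f n + b * fourier_coeff g n"
  by (simp add: fourier_coeff_eq_inner L2_inner_lincomb L2_char)

lemma L2_fnorm_char [simp]: "L2_fnorm (torus_char n :: ('d::finite) torus_fun) = 1"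
proof -
  interpret prob_space "torus :: ('d \<Rightarrow> complex) measure" by (rule prob_space_torus)
  have "(LINT z|(torus :: ('d \<Rightarrow> complex) measure). (cmod (torus_char n z))\<^sup>2) = (LINT z|(torus :: ('d \<Rightarrow> complex) measure). 1)"
    by (rule Bochner_Integration.integral_cong) (auto simp: norm_torus_char)
  then show ?thesis by (simp add: L2_fnorm_def prob_space)
qed

lemma norm_fourier_coeff_le: "f \<in> Lp_fun 2 \<Longrightarrow> cmod (fourier_coeff f n) \<le> L2_fnorm f"
  using L2_Cauchy_Schwarz[OF _ L2_char, of f n] by (simp add: fourier_coeff_eq_inner)

lemma fourier_coeff_char: "fourier_coeff (torus_char m :: ('d::finite) torus_fun) n = (if m = n then 1 else 0)"
proof -
  have "fourier_coeff (torus_char m :: ('d::finite) torus_fun) n =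
      (LINT z|(torus :: ('d \<Rightarrow> complex) measure). torus_char (\<lambda>i. m i + - n i) z)"
    unfolding fourier_coeff_def
    by (rule Bochner_Integration.integral_cong) (auto simp: torus_char_add[of _ m "\<lambda>i. - n i", simplified] cnj_torus_char)
  also have "\<dots> = (if m = n then 1 else 0)"
    by (simp add: integral_torus_char fun_eq_iff)
  finally show ?thesis .
qed

subsection \<open>Trigonometric polynomials\<close>

definition trig :: "(('d::finite \<Rightarrow> int) \<Rightarrow> complex) \<Rightarrow> ('d \<Rightarrow> int) set \<Rightarrow> 'd torus_fun" where
  "trig c A z = (\<Sum>n\<in>A. c n * torus_char n z)"

lemma trig_empty: "trig c {} = (\<lambda>z. 0)"
  by (simp add: trig_def fun_eq_iff)

lemma trig_insert:
  "finite A \<Longrightarrow> n \<notin> A \<Longrightarrow> trig c (insert n A) = (\<lambda>z. c n * torus_char n z + 1 * trig c A z)"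
  by (simp add: trig_def fun_eq_iff)

lemma L2_trig: "trig c A \<in> Lp_fun 2"
proof (cases "finite A")
  case True
  then show ?thesis
  proof (induction A rule: finite_induct)
    case (insert n A)
    then show ?case by (simp only: trig_insert[OF insert.hyps(1,2)] L2_lincomb L2_char)
  qed (simp add: trig_empty L2_zero)
next
  case False
  then show ?thesis using L2_zero by (simp add: trig_def[abs_def])
qed

lemma L2_inner_trig:
  assumes "finite A" "f \<in> Lp_fun 2"
  shows "L2_inner (trig c A) f = (\<Sum>n\<in>A. c n * cnj (fourier_coeff f n))"
  using assms(1)
proof (induction A rule: finite_induct)
  case empty
  then show ?case by (simp add: trig_empty L2_inner_def)
next
  case (insert n A)
  then show ?case
    by (simp only: trig_insert[OF insert.hyps] L2_inner_lincomb[OF L2_char L2_trig assms(2)])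
      (simp add: fourier_coeff_eq_inner L2_inner_commute[of f])
qed

lemma fourier_coeff_trig: "finite A \<Longrightarrow> fourier_coeff (trig c A) n = (if n \<in> A then c n else 0)"
  by (simp add: fourier_coeff_eq_inner L2_inner_trig L2_char)
    (simp add: fourier_coeff_eq_inner[symmetric] fourier_coeff_char if_distrib sum.delta cong: if_cong)

lemma L2_fnorm_trig_square: "finite A \<Longrightarrow> (L2_fnorm (trig c A))\<^sup>2 = (\<Sum>n\<in>A. (cmod (c n))\<^sup>2)"
proof -
  assume A: "finite A"
  have "complex_of_real ((L2_fnorm (trig c A))\<^sup>2) = L2_inner (trig c A) (trig c A)"
    by (rule L2_inner_self[symmetric])
  also have "\<dots> = complex_of_real (\<Sum>n\<in>A. (cmod (c n))\<^sup>2)"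
    using A by (simp add: L2_inner_trig L2_trig fourier_coeff_trig complex_norm_square del: of_real_power)
  finally show ?thesis by (simp only: of_real_eq_iff)
qed

lemma L2_fnorm_trig_diff_square:
  assumes "finite A" "finite B"
  shows "(L2_fnorm (\<lambda>z. trig c A z - trig c B z))\<^sup>2 = (\<Sum>n\<in>A - B. (cmod (c n))\<^sup>2) + (\<Sum>n\<in>B - A. (cmod (c n))\<^sup>2)"
proof -
  define d where "d n = (if n \<in> A then c n else - c n)" for n
  have "trig c A z - trig c B z = trig d ((A - B) \<union> (B - A)) z" for z
  proof -
    have "trig c A z = (\<Sum>n\<in>A - B. c n * torus_char n z) + (\<Sum>n\<in>A \<inter> B. c n * torus_char n z)"
      "trig c B z = (\<Sum>n\<in>B - A. c n * torus_char n z) + (\<Sum>n\<in>A \<inter> B. c n * torus_char n z)"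
      unfolding trig_def using assms
      by (subst sum.union_disjoint[symmetric]; auto intro!: sum.cong)+
    moreover have "trig d ((A - B) \<union> (B - A)) z =
        (\<Sum>n\<in>A - B. c n * torus_char n z) + (\<Sum>n\<in>B - A. - (c n * torus_char n z))"
      unfolding trig_def using assms
      by (subst sum.union_disjoint) (auto simp: d_def)
    ultimately show ?thesis by (simp add: sum_negf)
  qed
  then have "(L2_fnorm (\<lambda>z. trig c A z - trig c B z))\<^sup>2 = (\<Sum>n\<in>(A - B) \<union> (B - A). (cmod (d n))\<^sup>2)"
    using assms by (simp add: L2_fnorm_trig_square[symmetric] del: L2_fnorm_char)
  also have "\<dots> = (\<Sum>n\<in>A - B. (cmod (c n))\<^sup>2) + (\<Sum>n\<in>B - A. (cmod (c n))\<^sup>2)"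
    using assms by (subst sum.union_disjoint) (auto simp: d_def)
  finally show ?thesis .
qed

lemma L1_le_L2:
  fixes f :: "('d::finite) torus_fun"
  assumes "f \<in> Lp_fun 2"
  shows "(LINT z|torus. cmod (f z)) \<le> L2_fnorm f"
proof -
  interpret prob_space "torus :: ('d \<Rightarrow> complex) measure" by (rule prob_space_torus)
  let ?a = "\<lambda>z. complex_of_real (cmod (f z))"
  have a: "?a \<in> Lp_fun 2" using assms by (auto simp: Lp_fun_2_iff)
  have "cmod (L2_inner ?a (\<lambda>_. 1)) \<le> L2_fnorm ?a * L2_fnorm (\<lambda>_::'d \<Rightarrow> complex. 1)"
    by (intro L2_Cauchy_Schwarz a bounded_borel_L2 bounded_borel_const)
  moreover have "L2_inner ?a (\<lambda>_. 1) = of_real (LINT z|torus. cmod (f z))"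
    by (simp add: L2_inner_def)
  moreover have "0 \<le> (LINT z|torus. cmod (f z))" by simp
  ultimately show ?thesis by (simp add: L2_fnorm_def prob_space)
qed

text \<open>Cauchy's criterion, in the form in which the exhausting sets of frequencies are chosen below.\<close>

lemma summable_on_tail:
  fixes g :: "'i \<Rightarrow> real"
  assumes "g summable_on UNIV" "\<And>n. 0 \<le> g n" "0 < e"
  obtains A where "finite A" "\<And>B. finite B \<Longrightarrow> B \<inter> A = {} \<Longrightarrow> sum g B < e"
proof -
  have "(sum g \<longlongrightarrow> infsum g UNIV) (finite_subsets_at_top UNIV)"
    using assms(1) by (simp add: has_sum_def[symmetric])
  then have "eventually (\<lambda>F. dist (sum g F) (infsum g UNIV) < e / 2) (finite_subsets_at_top UNIV)"
    by (rule tendstoD) (use assms(3) in simp)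
  then obtain A where A: "finite A" "\<And>F. finite F \<Longrightarrow> A \<subseteq> F \<Longrightarrow> dist (sum g F) (infsum g UNIV) < e / 2"
    by (auto simp: eventually_finite_subsets_at_top)
  show ?thesis
  proof (rule that[OF A(1)])
    fix B :: "'i set" assume B: "finite B" "B \<inter> A = {}"
    have "sum g (B \<union> A) = sum g B + sum g A" using A(1) B by (intro sum.union_disjoint)
    then show "sum g B < e"
      using A(2)[OF A(1) order_refl, unfolded dist_real_def]
        A(2)[of "B \<union> A", unfolded dist_real_def, OF finite_UnI[OF B(1) A(1)] Un_upper2]
      by linarith
  qed
qed

text \<open>Partial sums over a suitable sequence of frequency sets are Cauchy in \<open>L\<^sup>2\<close>, hence in \<open>L\<^sup>1\<close>, and a
  subsequence converges almost everywhere. Fatou's lemma transfers the \<open>L\<^sup>2\<close> estimates to the limit.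
  The last conclusion gives unconditional convergence of the Fourier series for this particular \<open>f\<close>;
  completeness of the characters extends it to all of \<open>L\<^sup>2\<close> afterwards.\<close>

theorem Riesz_Fischer:
  fixes c :: "('d::finite \<Rightarrow> int) \<Rightarrow> complex"
  assumes sm: "(\<lambda>n. (cmod (c n))\<^sup>2) summable_on UNIV"
  obtains f where "f \<in> Lp_fun 2" "\<And>n. fourier_coeff f n = c n"
    "((\<lambda>A. L2_fnorm (\<lambda>z. f z - trig c A z)) \<longlongrightarrow> 0) (finite_subsets_at_top UNIV)"
proof -
  have "\<exists>A. finite A \<and> (\<forall>B. finite B \<longrightarrow> B \<inter> A = {} \<longrightarrow> (\<Sum>n\<in>B. (cmod (c n))\<^sup>2) < 1 / real (Suc N))" for N
    by (rule summable_on_tail[OF sm, of "1 / real (Suc N)"]) auto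
  \<comment> \<open>sets of frequencies outside of which the squares sum to less than \<open>1 / (N + 1)\<close>\<close>
  then obtain A where A: "\<And>N. finite (A N)"
    and tail: "\<And>N B. finite B \<Longrightarrow> B \<inter> A N = {} \<Longrightarrow> (\<Sum>n\<in>B. (cmod (c n))\<^sup>2) < 1 / real (Suc N)"
    by metis
  define s where "s N = trig c (A N)" for N
  have s: "s N \<in> Lp_fun 2" for N by (simp add: s_def L2_trig)
  have diff: "(L2_fnorm (\<lambda>z. s i z - trig c B z))\<^sup>2 \<le> 1 / real (Suc i) + 1 / real (Suc N)"
    if "finite B" "A N \<subseteq> B" for i N B
  proof -
    have "(\<Sum>n\<in>A i - B. (cmod (c n))\<^sup>2) < 1 / real (Suc N)"
      using that by (intro tail) (auto simp: A)
    moreover have "(\<Sum>n\<in>B - A i. (cmod (c n))\<^sup>2) < 1 / real (Suc i)"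
      using that by (intro tail) (auto simp: A)
    ultimately show ?thesis unfolding s_def by (subst L2_fnorm_trig_diff_square[OF A that(1)]) linarith
  qed
  obtain r where r: "strict_mono r" and Cauchy: "AE z in torus. Cauchy (\<lambda>i. s (r i) z)"
  proof (rule cauchy_L1_AE_cauchy_subseq[of torus s])
    show "integrable torus (s n)" for n by (rule L2_integrable[OF s])
    fix e :: real assume e: "0 < e"
    then have "0 < e\<^sup>2 / 2" by simp
    then obtain N where N: "1 / real (Suc N) < e\<^sup>2 / 2" using nat_approx_posE by blast
    show "\<exists>N. \<forall>i\<ge>N. \<forall>j\<ge>N. LINT z|torus. norm (s i z - s j z) < e"
    proof (intro exI allI impI)
      fix i j assume ij: "N \<le> i" "N \<le> j"
      have "1 / real (Suc i) \<le> 1 / real (Suc N)" "1 / real (Suc j) \<le> 1 / real (Suc N)"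
        using ij by (auto intro!: divide_left_mono)
      then have "(L2_fnorm (\<lambda>z. s i z - s j z))\<^sup>2 < e\<^sup>2"
        using diff[OF A order_refl, of i j] N unfolding s_def by linarith
      then have "L2_fnorm (\<lambda>z. s i z - s j z) < e" by (rule power2_less_imp_less) (use e in simp)
      then show "(LINT z|torus. norm (s i z - s j z)) < e"
        using L1_le_L2[OF L2_diff[OF s s], of i j] by linarith
    qed
  qed (rule that)
  define f where "f z = lim (\<lambda>i. s (r i) z)" for z
  have sm': "s i \<in> borel_measurable torus" for i using s by (rule Lp_fun_2_measurable)
  have f_meas: "f \<in> borel_measurable torus"
    unfolding f_def using sm' by (intro borel_measurable_lim_metric)
  have lim: "AE z in torus. (\<lambda>i. s (r i) z) \<longlonglongrightarrow> f z"
    using Cauchy by eventually_elim (simp add: f_def convergent_LIMSEQ_iff[symmetric] Cauchy_convergent)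
  have Fatou: "(\<integral>\<^sup>+z. ennreal ((cmod (f z - trig c B z))\<^sup>2) \<partial>torus) \<le> ennreal (1 / real (Suc N))"
    if B: "finite B" "A N \<subseteq> B" for B N
  proof -
    note [measurable] = f_meas sm' Lp_fun_2_measurable[OF L2_trig]
    have "(\<integral>\<^sup>+z. ennreal ((cmod (f z - trig c B z))\<^sup>2) \<partial>torus) =
        (\<integral>\<^sup>+z. liminf (\<lambda>i. ennreal ((cmod (s (r i) z - trig c B z))\<^sup>2)) \<partial>torus)"
    proof (rule nn_integral_cong_AE)
      show "AE z in torus. ennreal ((cmod (f z - trig c B z))\<^sup>2) =
          liminf (\<lambda>i. ennreal ((cmod (s (r i) z - trig c B z))\<^sup>2))"
        using lim
      proof eventually_elim
        case (elim z)
        then have "(\<lambda>i. ennreal ((cmod (s (r i) z - trig c B z))\<^sup>2)) \<longlonglongrightarrow> ennreal ((cmod (f z - trig c B z))\<^sup>2)"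
          by (intro tendsto_ennrealI tendsto_intros)
        then show ?case by (intro lim_imp_Liminf[symmetric]) auto
      qed
    qed
    also have "\<dots> \<le> liminf (\<lambda>i. \<integral>\<^sup>+z. ennreal ((cmod (s (r i) z - trig c B z))\<^sup>2) \<partial>torus)"
      by (rule nn_integral_liminf) measurable
    also have "\<dots> \<le> liminf (\<lambda>i. ennreal (1 / real (Suc (r i)) + 1 / real (Suc N)))"
    proof (rule Liminf_mono, rule always_eventually, rule allI)
      fix i
      have "(\<integral>\<^sup>+z. ennreal ((cmod (s (r i) z - trig c B z))\<^sup>2) \<partial>torus) =
          ennreal ((L2_fnorm (\<lambda>z. s (r i) z - trig c B z))\<^sup>2)"
        unfolding L2_fnorm_square using L2_diff[OF s L2_trig, of "r i" c B]
        by (intro nn_integral_eq_integral) (auto simp: Lp_fun_2_iff)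
      then show "(\<integral>\<^sup>+z. ennreal ((cmod (s (r i) z - trig c B z))\<^sup>2) \<partial>torus) \<le>
          ennreal (1 / real (Suc (r i)) + 1 / real (Suc N))"
        by (simp only:) (rule ennreal_leI, rule diff[OF B])
    qed
    also have "\<dots> = ennreal (0 + 1 / real (Suc N))"
    proof (rule lim_imp_Liminf)
      have "(\<lambda>i. 1 / real (Suc (r i))) \<longlonglongrightarrow> 0"
        using LIMSEQ_subseq_LIMSEQ[OF LIMSEQ_inverse_real_of_nat r] by (simp add: o_def inverse_eq_divide)
      then show "(\<lambda>i. ennreal (1 / real (Suc (r i)) + 1 / real (Suc N))) \<longlonglongrightarrow> ennreal (0 + 1 / real (Suc N))"
        by (intro tendsto_ennrealI tendsto_intros)
    qed simp
    finally show ?thesis by simp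
  qed
  have fB: "(\<lambda>z. f z - trig c B z) \<in> Lp_fun 2" "(L2_fnorm (\<lambda>z. f z - trig c B z))\<^sup>2 \<le> 1 / real (Suc N)"
    if B: "finite B" "A N \<subseteq> B" for B N
  proof -
    have meas: "(\<lambda>z. f z - trig c B z) \<in> borel_measurable torus"
      using f_meas Lp_fun_2_measurable[OF L2_trig] by measurable
    have int: "integrable torus (\<lambda>z. (cmod (f z - trig c B z))\<^sup>2)"
    proof (rule integrableI_bounded)
      show "(\<integral>\<^sup>+z. ennreal (norm ((cmod (f z - trig c B z))\<^sup>2)) \<partial>torus) < \<infinity>"
        using Fatou[OF B] by (auto intro: order_le_less_trans)
    qed (use meas in measurable)
    with meas show "(\<lambda>z. f z - trig c B z) \<in> Lp_fun 2" by (simp add: Lp_fun_2_iff)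
    have "ennreal ((L2_fnorm (\<lambda>z. f z - trig c B z))\<^sup>2) = (\<integral>\<^sup>+z. ennreal ((cmod (f z - trig c B z))\<^sup>2) \<partial>torus)"
      unfolding L2_fnorm_square using int by (intro nn_integral_eq_integral[symmetric]) auto
    with Fatou[OF B] have "ennreal ((L2_fnorm (\<lambda>z. f z - trig c B z))\<^sup>2) \<le> ennreal (1 / real (Suc N))"
      by simp
    then show "(L2_fnorm (\<lambda>z. f z - trig c B z))\<^sup>2 \<le> 1 / real (Suc N)"
      by (rule ennreal_le_iff[THEN iffD1, rotated]) simp
  qed
  have f: "f \<in> Lp_fun 2"
    using L2_add[OF fB(1)[OF A order_refl, of 0] L2_trig[of c "A 0"]] by simp
  have conv: "((\<lambda>B. L2_fnorm (\<lambda>z. f z - trig c B z)) \<longlongrightarrow> 0) (finite_subsets_at_top UNIV)"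
  proof (rule tendstoI)
    fix e :: real assume e: "0 < e"
    then have "0 < e\<^sup>2" by simp
    then obtain N where N: "1 / real (Suc N) < e\<^sup>2" using nat_approx_posE by blast
    have "dist (L2_fnorm (\<lambda>z. f z - trig c B z)) 0 < e" if "finite B" "A N \<subseteq> B" for B
    proof -
      have "(L2_fnorm (\<lambda>z. f z - trig c B z))\<^sup>2 < e\<^sup>2" using fB(2)[OF that] N by linarith
      then have "L2_fnorm (\<lambda>z. f z - trig c B z) < e" by (rule power2_less_imp_less) (use e in simp)
      then show ?thesis by simp
    qed
    then show "eventually (\<lambda>B. dist (L2_fnorm (\<lambda>z. f z - trig c B z)) 0 < e) (finite_subsets_at_top UNIV)"
      using A by (auto simp: eventually_finite_subsets_at_top)
  qed
  have coef: "fourier_coeff f n = c n" for n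
  proof -
    have "eventually (\<lambda>B. dist (fourier_coeff f n) (c n) \<le> L2_fnorm (\<lambda>z. f z - trig c B z)) (finite_subsets_at_top UNIV)"
      unfolding eventually_finite_subsets_at_top
    proof (intro exI[of _ "{n}"] conjI allI impI)
      fix B :: "('d \<Rightarrow> int) set" assume B: "finite B \<and> {n} \<subseteq> B \<and> B \<subseteq> UNIV"
      have "fourier_coeff (\<lambda>z. f z - trig c B z) n = fourier_coeff f n - c n"
        using fourier_coeff_lincomb[OF f L2_trig, of 1 "-1" c B n] B by (simp add: fourier_coeff_trig)
      then show "dist (fourier_coeff f n) (c n) \<le> L2_fnorm (\<lambda>z. f z - trig c B z)"
        using norm_fourier_coeff_le[OF L2_diff[OF f L2_trig], of c B n] by (simp add: dist_norm)
    qed auto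
    from tendsto_lowerbound[OF conv this] show ?thesis by simp
  qed
  show ?thesis by (rule that[OF f coef conv])
qed

lemma Bessel:
  assumes f: "f \<in> Lp_fun 2" and A: "finite A"
  shows "(\<Sum>n\<in>A. (cmod (fourier_coeff f n))\<^sup>2) \<le> (L2_fnorm f)\<^sup>2"
proof -
  let ?p = "trig (fourier_coeff f) A"
  have "complex_of_real ((L2_fnorm ?p)\<^sup>2) = L2_inner ?p f"
    unfolding L2_fnorm_trig_square[OF A] L2_inner_trig[OF A f] by (simp add: complex_norm_square del: of_real_power)
  then have "(L2_fnorm ?p)\<^sup>2 \<le> L2_fnorm ?p * L2_fnorm f"
    using L2_Cauchy_Schwarz[OF L2_trig f, of "fourier_coeff f" A]
    by (metis abs_of_nonneg norm_of_real zero_le_power2)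
  then have "L2_fnorm ?p \<le> L2_fnorm f"
    using L2_fnorm_nonneg[of ?p] L2_fnorm_nonneg[of f] by (cases "L2_fnorm ?p = 0") (auto simp: power2_eq_square mult_le_cancel_left)
  then have "(L2_fnorm ?p)\<^sup>2 \<le> (L2_fnorm f)\<^sup>2" by (intro power_mono) auto
  then show ?thesis by (simp add: L2_fnorm_trig_square[OF A])
qed

lemma fourier_coeff_square_summable:
  "f \<in> Lp_fun 2 \<Longrightarrow> (\<lambda>n. (cmod (fourier_coeff f n))\<^sup>2) summable_on UNIV"
  by (rule nonneg_bdd_above_summable_on) (auto intro!: bdd_aboveI[of _ "(L2_fnorm f)\<^sup>2"] Bessel)

text \<open>The function that the Riesz-Fischer theorem builds from the coefficients of \<open>f\<close> has the coefficients of
  \<open>f\<close>, hence agrees with \<open>f\<close> almost everywhere.\<close>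

theorem fourier_series_converges:
  assumes f: "f \<in> Lp_fun 2"
  shows "((\<lambda>A. L2_fnorm (\<lambda>z. f z - trig (fourier_coeff f) A z)) \<longlongrightarrow> 0) (finite_subsets_at_top UNIV)"
proof (rule Riesz_Fischer[OF fourier_coeff_square_summable[OF f]])
  fix g assume g: "g \<in> Lp_fun 2" "\<And>n. fourier_coeff g n = fourier_coeff f n"
    and conv: "((\<lambda>A. L2_fnorm (\<lambda>z. g z - trig (fourier_coeff f) A z)) \<longlongrightarrow> 0) (finite_subsets_at_top UNIV)"
  have "AE z in torus. 1 * f z + (-1) * g z = 0"
    by (rule fourier_coeff_unique[OF L2_integrable[OF L2_lincomb[OF f g(1)]]])
      (subst fourier_coeff_lincomb[OF f g(1)], simp add: g(2))
  then have "AE z in torus. g z = f z" by eventually_elim simp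
  then have "AE z in torus. g z - trig (fourier_coeff f) A z = f z - trig (fourier_coeff f) A z" for A
    by eventually_elim simp
  then have "L2_fnorm (\<lambda>z. g z - trig (fourier_coeff f) A z) = L2_fnorm (\<lambda>z. f z - trig (fourier_coeff f) A z)" for A
    by (intro L2_fnorm_cong_AE Lp_fun_2_measurable L2_diff f g(1) L2_trig)
  with conv show ?thesis by simp
qed

theorem Parseval_inner:
  assumes f: "f \<in> Lp_fun 2" and g: "g \<in> Lp_fun 2"
  shows "((\<lambda>n. fourier_coeff f n * cnj (fourier_coeff g n)) has_sum L2_inner f g) UNIV"
  unfolding has_sum_def
proof (rule tendstoI)
  fix e :: real assume e: "0 < e"
  have "((\<lambda>A. L2_fnorm (\<lambda>z. f z - trig (fourier_coeff f) A z) * L2_fnorm g) \<longlongrightarrow> 0 * L2_fnorm g) (finite_subsets_at_top UNIV)"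
    by (intro tendsto_mult fourier_series_converges f tendsto_const)
  then have "eventually (\<lambda>A. L2_fnorm (\<lambda>z. f z - trig (fourier_coeff f) A z) * L2_fnorm g < e) (finite_subsets_at_top UNIV)"
    using e by (auto dest: order_tendstoD)
  moreover have "eventually finite (finite_subsets_at_top (UNIV :: ('a \<Rightarrow> int) set))"
    by (auto simp: eventually_finite_subsets_at_top)
  ultimately show "eventually (\<lambda>A. dist (\<Sum>n\<in>A. fourier_coeff f n * cnj (fourier_coeff g n)) (L2_inner f g) < e) (finite_subsets_at_top UNIV)"
  proof eventually_elim
    case (elim A)
    have "L2_inner f g - (\<Sum>n\<in>A. fourier_coeff f n * cnj (fourier_coeff g n)) =
        L2_inner (\<lambda>z. f z - trig (fourier_coeff f) A z) g"
      by (simp add: L2_inner_diff f g L2_trig L2_inner_trig elim)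
    then show ?case
      using L2_Cauchy_Schwarz[OF L2_diff[OF f L2_trig] g, of "fourier_coeff f" A] elim(1)
      by (simp add: dist_norm norm_minus_commute)
  qed
qed

theorem Parseval:
  assumes f: "f \<in> Lp_fun 2"
  shows "((\<lambda>n. (cmod (fourier_coeff f n))\<^sup>2) has_sum (L2_fnorm f)\<^sup>2) UNIV"
proof -
  have "((\<lambda>n. Re (fourier_coeff f n * cnj (fourier_coeff f n))) has_sum Re (L2_inner f f)) UNIV"
    by (rule has_sum_Re[OF Parseval_inner[OF f f]])
  then show ?thesis
    by (simp add: complex_norm_square[symmetric] L2_inner_self del: of_real_power)
qed

section \<open>Functions with prescribed spectrum\<close>

text \<open>Both the Hardy space and its conjugate have this form, for the frequencies in the nonnegative and in
  the nonpositive orthant.\<close>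

definition spectral_L2 :: "('d::finite \<Rightarrow> int) set \<Rightarrow> 'd torus_fun set" where
  "spectral_L2 S = {f \<in> Lp_fun 2. \<forall>n. n \<notin> S \<longrightarrow> fourier_coeff f n = 0}"

lemma spectral_L2_D: "f \<in> spectral_L2 S \<Longrightarrow> f \<in> Lp_fun 2"
  by (simp add: spectral_L2_def)

lemma spectral_L2_zero: "(\<lambda>_. 0) \<in> spectral_L2 S"
  using L2_zero by (simp add: spectral_L2_def fourier_coeff_def)

lemma spectral_L2_lincomb:
  "f \<in> spectral_L2 S \<Longrightarrow> g \<in> spectral_L2 S \<Longrightarrow> (\<lambda>z. a * f z + b * g z) \<in> spectral_L2 S"
  by (simp add: spectral_L2_def L2_lincomb fourier_coeff_lincomb)

lemma spectral_L2_char: "n \<in> S \<Longrightarrow> torus_char n \<in> spectral_L2 S"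
  by (auto simp: spectral_L2_def L2_char fourier_coeff_char)

lemma spectral_L2_trig: "finite A \<Longrightarrow> A \<subseteq> S \<Longrightarrow> trig c A \<in> spectral_L2 S"
  by (auto simp: spectral_L2_def L2_trig fourier_coeff_trig)

lemma spectral_L2_partial_sum:
  "f \<in> spectral_L2 S \<Longrightarrow> finite A \<Longrightarrow> trig (fourier_coeff f) A = trig (fourier_coeff f) (A \<inter> S)"
  unfolding trig_def fun_eq_iff
  by (intro allI sum.mono_neutral_right) (auto simp: spectral_L2_def)

text \<open>The coefficients of the representing function are forced to be \<open>cnj (l (torus_char n))\<close>. Testing
  \<open>l\<close> on the trigonometric polynomial with these coefficients shows that they are square-summable.\<close>

theorem spectral_L2_Riesz:
  fixes l :: "('d::finite) torus_fun \<Rightarrow> complex"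
  assumes lin: "\<And>f g a b. f \<in> spectral_L2 S \<Longrightarrow> g \<in> spectral_L2 S \<Longrightarrow>
      l (\<lambda>z. a * f z + b * g z) = a * l f + b * l g"
    and bd: "\<And>f. f \<in> spectral_L2 S \<Longrightarrow> cmod (l f) \<le> C * L2_fnorm f"
  obtains h where "h \<in> spectral_L2 S" "\<And>f. f \<in> spectral_L2 S \<Longrightarrow> l f = L2_inner f h"
proof -
  define c where "c n = (if n \<in> S then cnj (l (torus_char n)) else 0)" for n
  have l_trig: "l (trig d A) = (\<Sum>n\<in>A. d n * cnj (c n))" if "finite A" "A \<subseteq> S" for d A
    using that
  proof (induction A rule: finite_induct)
    case empty
    have "l (\<lambda>z. 0) = 0" using lin[OF spectral_L2_zero spectral_L2_zero, of 0 0] by simp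
    then show ?case by (simp add: trig_empty)
  next
    case (insert n A)
    then show ?case
      by (simp only: trig_insert[OF insert.hyps(1,2)]) (subst lin, auto simp: spectral_L2_char spectral_L2_trig c_def)
  qed
  have bound: "(\<Sum>n\<in>A. (cmod (c n))\<^sup>2) \<le> C\<^sup>2" if A: "finite A" for A
  proof -
    let ?p = "trig c (A \<inter> S)"
    have p: "?p \<in> spectral_L2 S" using A by (intro spectral_L2_trig) auto
    have sum_p: "(L2_fnorm ?p)\<^sup>2 = (\<Sum>n\<in>A \<inter> S. (cmod (c n))\<^sup>2)"
      using A by (intro L2_fnorm_trig_square) auto
    have "l ?p = complex_of_real ((L2_fnorm ?p)\<^sup>2)"
      unfolding sum_p using A by (subst l_trig) (auto simp: complex_norm_square simp del: of_real_power)
    then have le: "(L2_fnorm ?p)\<^sup>2 \<le> C * L2_fnorm ?p"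
      using bd[OF p] by (metis abs_of_nonneg norm_of_real zero_le_power2)
    have "(L2_fnorm ?p)\<^sup>2 \<le> C\<^sup>2"
    proof (cases "L2_fnorm ?p = 0")
      case False
      then have "L2_fnorm ?p \<le> C"
        using le L2_fnorm_nonneg[of ?p] by (simp add: power2_eq_square mult_le_cancel_right)
      then show ?thesis by (intro power_mono) auto
    qed simp
    moreover have "(\<Sum>n\<in>A. (cmod (c n))\<^sup>2) = (\<Sum>n\<in>A \<inter> S. (cmod (c n))\<^sup>2)"
      using A by (intro sum.mono_neutral_right) (auto simp: c_def)
    ultimately show ?thesis by (simp add: sum_p)
  qed
  have "(\<lambda>n. (cmod (c n))\<^sup>2) summable_on UNIV"
    by (rule nonneg_bdd_above_summable_on) (auto intro!: bdd_aboveI[of _ "C\<^sup>2"] bound)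
  then obtain h where h: "h \<in> Lp_fun 2" "\<And>n. fourier_coeff h n = c n"
    by (rule Riesz_Fischer) blast
  then have hS: "h \<in> spectral_L2 S" by (auto simp: spectral_L2_def c_def)
  have "l f = L2_inner f h" if f: "f \<in> spectral_L2 S" for f
  proof -
    let ?d = "\<lambda>A. L2_fnorm (\<lambda>z. f z - trig (fourier_coeff f) A z)"
    have "eventually (\<lambda>A. dist (l f) (L2_inner f h) \<le> (C + L2_fnorm h) * ?d A) (finite_subsets_at_top UNIV)"
      unfolding eventually_finite_subsets_at_top
    proof (intro exI[of _ "{}"] conjI allI impI)
      fix A :: "('d \<Rightarrow> int) set" assume "finite A \<and> {} \<subseteq> A \<and> A \<subseteq> UNIV"
      then have A: "finite A" by simp
      let ?p = "trig (fourier_coeff f) A"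
      have p: "?p \<in> spectral_L2 S" unfolding spectral_L2_partial_sum[OF f A]
        using A by (intro spectral_L2_trig) auto
      have "l ?p = L2_inner ?p h"
        unfolding spectral_L2_partial_sum[OF f A]
        using A by (subst l_trig) (auto simp: L2_inner_trig h)
      moreover have fp: "(\<lambda>z. 1 * f z + (-1) * ?p z) \<in> spectral_L2 S"
        using f p by (rule spectral_L2_lincomb)
      ultimately have "l f - L2_inner f h =
          l (\<lambda>z. 1 * f z + (-1) * ?p z) - L2_inner (\<lambda>z. 1 * f z + (-1) * ?p z) h"
        by (subst lin[OF f p], subst L2_inner_lincomb) (auto simp: spectral_L2_D[OF f] spectral_L2_D[OF p] h)
      then have "cmod (l f - L2_inner f h) \<le> cmod (l (\<lambda>z. 1 * f z + (-1) * ?p z)) + cmod (L2_inner (\<lambda>z. 1 * f z + (-1) * ?p z) h)"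
        by (simp only: norm_triangle_ineq4)
      also have "\<dots> \<le> C * L2_fnorm (\<lambda>z. 1 * f z + (-1) * ?p z) + L2_fnorm (\<lambda>z. 1 * f z + (-1) * ?p z) * L2_fnorm h"
        by (intro add_mono bd fp L2_Cauchy_Schwarz h spectral_L2_D[OF fp])
      finally show "dist (l f) (L2_inner f h) \<le> (C + L2_fnorm h) * ?d A"
        by (simp add: dist_norm algebra_simps)
    qed auto
    moreover have "((\<lambda>A. (C + L2_fnorm h) * ?d A) \<longlongrightarrow> (C + L2_fnorm h) * 0) (finite_subsets_at_top UNIV)"
      by (intro tendsto_mult tendsto_const fourier_series_converges spectral_L2_D[OF f])
    ultimately have "dist (l f) (L2_inner f h) \<le> (C + L2_fnorm h) * 0"
      by (intro tendsto_lowerbound) auto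
    then show ?thesis by simp
  qed
  with hS show ?thesis by (rule that)
qed

lemma Hardy_2_eq: "Hardy 2 = spectral_L2 {n. \<forall>i. 0 \<le> n i}"
  by (auto simp: Hardy_def spectral_L2_def not_le)

lemma fourier_coeff_cnj: "fourier_coeff (\<lambda>z. cnj (f z)) n = cnj (fourier_coeff f (\<lambda>i. - n i))"
  unfolding fourier_coeff_def Bochner_Integration.integral_cnj[symmetric]
  by (rule Bochner_Integration.integral_cong) (auto simp: cnj_torus_char)

lemma conj_Hardy2_eq: "conj_Hardy2 = spectral_L2 {n. \<forall>i. n i \<le> 0}"
proof (intro equalityI subsetI)
  fix f :: "'a torus_fun" assume "f \<in> conj_Hardy2"
  then obtain g where g: "g \<in> spectral_L2 {n. \<forall>i. 0 \<le> n i}" "f = (\<lambda>z. cnj (g z))"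
    by (auto simp: conj_Hardy2_def Hardy_2_eq)
  then show "f \<in> spectral_L2 {n. \<forall>i. n i \<le> 0}"
    by (auto simp: spectral_L2_def fourier_coeff_cnj intro: L2_cnj)
next
  fix f :: "'a torus_fun" assume "f \<in> spectral_L2 {n. \<forall>i. n i \<le> 0}"
  then have "(\<lambda>z. cnj (f z)) \<in> spectral_L2 {n. \<forall>i. 0 \<le> n i}"
    by (auto simp: spectral_L2_def fourier_coeff_cnj intro: L2_cnj)
  then show "f \<in> conj_Hardy2"
    unfolding conj_Hardy2_def Hardy_2_eq by (rule image_eqI[rotated]) simp
qed

section \<open>Bounded operators between spaces of prescribed spectrum\<close>

lemma bounded_op_maps: "bounded_op V W T \<Longrightarrow> f \<in> V \<Longrightarrow> T f \<in> W"
  by (simp add: bounded_op_def)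

lemma bounded_op_linear:
  "bounded_op V W T \<Longrightarrow> f \<in> V \<Longrightarrow> g \<in> V \<Longrightarrow>
    AE z in torus. T (\<lambda>z. a * f z + b * g z) z = a * T f z + b * T g z"
  by (simp add: bounded_op_def)

lemma bounded_op_bound:
  assumes "bounded_op V W T"
  obtains C where "0 \<le> C" "\<And>f. f \<in> V \<Longrightarrow> L2_fnorm (T f) \<le> C * L2_fnorm f"
proof -
  have "\<exists>C. \<forall>f\<in>V. L2_fnorm (T f) \<le> C * L2_fnorm f"
    using assms by (simp add: bounded_op_def)
  then obtain C where C: "\<And>f. f \<in> V \<Longrightarrow> L2_fnorm (T f) \<le> C * L2_fnorm f"
    by blast
  have "L2_fnorm (T f) \<le> \<bar>C\<bar> * L2_fnorm f" if "f \<in> V" for f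
    by (rule order_trans[OF C[OF that]]) (intro mult_right_mono, auto)
  then show ?thesis by (intro that[of "\<bar>C\<bar>"]) auto
qed

lemma bounded_op_norm_lincomb:
  assumes T: "bounded_op (spectral_L2 S) (spectral_L2 R) T" and f: "f \<in> spectral_L2 S" and g: "g \<in> spectral_L2 S"
  shows "L2_fnorm (T (\<lambda>z. a * f z + b * g z)) = L2_fnorm (\<lambda>z. a * T f z + b * T g z)"
  using bounded_op_linear[OF T f g]
  by (intro L2_fnorm_cong_AE Lp_fun_2_measurable L2_lincomb spectral_L2_D[OF bounded_op_maps[OF T]]
      spectral_L2_lincomb f g)

lemma bounded_op_inner_lincomb:
  assumes T: "bounded_op (spectral_L2 S) (spectral_L2 R) T" and f: "f \<in> spectral_L2 S" and g: "g \<in> spectral_L2 S"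
    and u: "u \<in> Lp_fun 2"
  shows "L2_inner (T (\<lambda>z. a * f z + b * g z)) u = a * L2_inner (T f) u + b * L2_inner (T g) u"
proof -
  have "L2_inner (T (\<lambda>z. a * f z + b * g z)) u = L2_inner (\<lambda>z. a * T f z + b * T g z) u"
    using bounded_op_linear[OF T f g] u
    by (intro L2_inner_cong_AE Lp_fun_2_measurable L2_lincomb spectral_L2_D[OF bounded_op_maps[OF T]]
      spectral_L2_lincomb f g)
  then show ?thesis
    by (simp add: L2_inner_lincomb u spectral_L2_D[OF bounded_op_maps[OF T f]] spectral_L2_D[OF bounded_op_maps[OF T g]])
qed

lemma bounded_op_norm_diff:
  assumes T: "bounded_op (spectral_L2 S) (spectral_L2 R) T" and f: "f \<in> spectral_L2 S" and g: "g \<in> spectral_L2 S"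
  shows "L2_fnorm (T (\<lambda>z. f z - g z)) = L2_fnorm (\<lambda>z. T f z - T g z)"
  using bounded_op_norm_lincomb[OF T f g, of 1 "-1"] by simp

lemma bounded_op_zero: "bounded_op (spectral_L2 S) (spectral_L2 R) (\<lambda>h z. 0)"
  unfolding bounded_op_def by (auto simp: spectral_L2_zero L2_fnorm_def intro!: exI[of _ 0])

lemma bounded_op_lincomb:
  assumes A: "bounded_op (spectral_L2 S) (spectral_L2 R) A" and B: "bounded_op (spectral_L2 S) (spectral_L2 R) B"
  shows "bounded_op (spectral_L2 S) (spectral_L2 R) (\<lambda>h z. a * A h z + b * B h z)"
  unfolding bounded_op_def
proof (intro conjI ballI allI)
  fix f assume "f \<in> spectral_L2 S"
  then show "(\<lambda>z. a * A f z + b * B f z) \<in> spectral_L2 R"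
    by (intro spectral_L2_lincomb bounded_op_maps[OF A] bounded_op_maps[OF B])
next
  fix f g c d assume f: "f \<in> spectral_L2 S" and g: "g \<in> spectral_L2 S"
  show "AE z in torus. a * A (\<lambda>z. c * f z + d * g z) z + b * B (\<lambda>z. c * f z + d * g z) z =
      c * (a * A f z + b * B f z) + d * (a * A g z + b * B g z)"
    using bounded_op_linear[OF A f g, of c d] bounded_op_linear[OF B f g, of c d]
    by eventually_elim (simp add: algebra_simps)
next
  obtain C D where C: "\<And>f. f \<in> spectral_L2 S \<Longrightarrow> L2_fnorm (A f) \<le> C * L2_fnorm f"
    and D: "\<And>f. f \<in> spectral_L2 S \<Longrightarrow> L2_fnorm (B f) \<le> D * L2_fnorm f"
    using bounded_op_bound[OF A] bounded_op_bound[OF B] by metis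
  show "\<exists>C. \<forall>f\<in>spectral_L2 S. L2_fnorm (\<lambda>z. a * A f z + b * B f z) \<le> C * L2_fnorm f"
  proof (intro exI ballI)
    fix f assume f: "f \<in> spectral_L2 S"
    have "L2_fnorm (\<lambda>z. a * A f z + b * B f z) \<le> L2_fnorm (\<lambda>z. a * A f z) + L2_fnorm (\<lambda>z. b * B f z)"
      by (intro L2_fnorm_triangle L2_scale spectral_L2_D[OF bounded_op_maps[OF A f]] spectral_L2_D[OF bounded_op_maps[OF B f]])
    also have "\<dots> \<le> cmod a * (C * L2_fnorm f) + cmod b * (D * L2_fnorm f)"
      unfolding L2_fnorm_scale by (intro add_mono mult_left_mono C D f) auto
    finally show "L2_fnorm (\<lambda>z. a * A f z + b * B f z) \<le> (cmod a * C + cmod b * D) * L2_fnorm f"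
      by (simp add: algebra_simps)
  qed
qed

lemma bounded_op_sum:
  "(\<And>k. bounded_op (spectral_L2 S) (spectral_L2 R) (A k)) \<Longrightarrow>
    bounded_op (spectral_L2 S) (spectral_L2 R) (\<lambda>h z. \<Sum>k<(N::nat). A k h z)"
proof (induction N)
  case (Suc N)
  then show ?case using bounded_op_lincomb[of S R "\<lambda>h z. \<Sum>k<N. A k h z" "A N" 1 1] by simp
qed (simp add: bounded_op_zero)

lemma bounded_op_diff:
  "bounded_op (spectral_L2 S) (spectral_L2 R) A \<Longrightarrow> bounded_op (spectral_L2 S) (spectral_L2 R) B \<Longrightarrow>
    bounded_op (spectral_L2 S) (spectral_L2 R) (\<lambda>h z. A h z - B h z)"
  using bounded_op_lincomb[of S R A B 1 "-1"] by simp

lemma op_norm_upper: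
  assumes T: "bounded_op V W T" and "f \<in> V" "L2_fnorm f \<le> 1"
  shows "L2_fnorm (T f) \<le> op_norm V T"
proof -
  obtain C where C: "0 \<le> C" "\<And>f. f \<in> V \<Longrightarrow> L2_fnorm (T f) \<le> C * L2_fnorm f"
    by (rule bounded_op_bound[OF T]) blast
  have "bdd_above ((\<lambda>f. L2_fnorm (T f)) ` {f \<in> V. L2_fnorm f \<le> 1})"
  proof (intro bdd_aboveI[of _ C])
    fix x assume "x \<in> (\<lambda>f. L2_fnorm (T f)) ` {f \<in> V. L2_fnorm f \<le> 1}"
    then obtain f where f: "f \<in> V" "L2_fnorm f \<le> 1" "x = L2_fnorm (T f)" by auto
    then show "x \<le> C" using C(2)[of f] mult_left_mono[OF f(2) C(1)] by simp
  qed
  then show ?thesis unfolding op_norm_def using assms(2,3) by (intro cSUP_upper) auto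
qed

lemma op_norm_nonneg: "bounded_op (spectral_L2 S) W T \<Longrightarrow> 0 \<le> op_norm (spectral_L2 S) T"
  by (rule order_trans[OF L2_fnorm_nonneg op_norm_upper[OF _ spectral_L2_zero]])
    (auto simp: L2_fnorm_def)

lemma norm_le_op_norm:
  assumes T: "bounded_op (spectral_L2 S) (spectral_L2 R) T" and f: "f \<in> spectral_L2 S"
  shows "L2_fnorm (T f) \<le> op_norm (spectral_L2 S) T * L2_fnorm f"
proof (cases "L2_fnorm f = 0")
  case True
  then show ?thesis using bounded_op_bound[OF T] f by (metis mult_zero_right)
next
  case False
  let ?r = "complex_of_real (1 / L2_fnorm f)"
  \<comment> \<open>the rescaled function, in the shape to which the linearity of \<open>T\<close> applies literally\<close>
  let ?g = "\<lambda>z. ?r * f z + 0 * f z"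
  have r: "cmod ?r = 1 / L2_fnorm f" by (simp only: norm_of_real) simp
  have "L2_fnorm ?g = 1" using False L2_fnorm_scale[of ?r f] by (simp add: r del: of_real_divide)
  then have "L2_fnorm (T ?g) \<le> op_norm (spectral_L2 S) T"
    by (intro op_norm_upper[OF T] spectral_L2_lincomb f) auto
  moreover have "L2_fnorm (T ?g) = (1 / L2_fnorm f) * L2_fnorm (T f)"
    unfolding bounded_op_norm_lincomb[OF T f f] using L2_fnorm_scale[of ?r "T f"] by (simp add: r del: of_real_divide)
  ultimately have "L2_fnorm (T f) / L2_fnorm f \<le> op_norm (spectral_L2 S) T" by simp
  moreover have "0 < L2_fnorm f" using False L2_fnorm_nonneg[of f] by linarith
  ultimately show ?thesis by (simp add: pos_divide_le_eq)
qed

lemma op_norm_le: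
  assumes "0 \<le> C" "\<And>f. f \<in> spectral_L2 S \<Longrightarrow> L2_fnorm (T f) \<le> C * L2_fnorm f"
  shows "op_norm (spectral_L2 S) T \<le> C"
  unfolding op_norm_def
proof (rule cSUP_least)
  show "{f \<in> spectral_L2 S. L2_fnorm f \<le> 1} \<noteq> {}"
    using spectral_L2_zero[of S] by (auto simp: L2_fnorm_def intro!: exI[of _ "\<lambda>_. 0"])
  fix f :: "'a torus_fun" assume "f \<in> {f \<in> spectral_L2 S. L2_fnorm f \<le> 1}"
  then show "L2_fnorm (T f) \<le> C"
    using assms(2)[of f] mult_left_mono[of "L2_fnorm f" 1 C] assms(1) by auto
qed

lemma spectral_L2_eqI:
  assumes u: "u \<in> spectral_L2 S" and v: "v \<in> spectral_L2 S"
    and eq: "\<And>f. f \<in> spectral_L2 S \<Longrightarrow> L2_inner f u = L2_inner f v"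
  shows "AE z in torus. u z = v z"
proof -
  let ?d = "\<lambda>z. 1 * u z + (-1) * v z"
  have d: "?d \<in> spectral_L2 S" by (rule spectral_L2_lincomb[OF u v])
  have "L2_inner ?d ?d = 0"
    using eq[OF d] by (subst L2_inner_lincomb_right) (auto simp: spectral_L2_D[OF u] spectral_L2_D[OF v] spectral_L2_D[OF d, simplified])
  then have "L2_fnorm ?d = 0" by (simp add: L2_inner_self del: mult_minus_left)
  from L2_fnorm_eq_0_AE[OF spectral_L2_D[OF d] this] show ?thesis
    by eventually_elim simp
qed

lemma L2_fnorm_le_by_duality:
  assumes u: "u \<in> spectral_L2 S" and C: "0 \<le> C"
    and le: "\<And>f. f \<in> spectral_L2 S \<Longrightarrow> cmod (L2_inner f u) \<le> C * L2_fnorm f"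
  shows "L2_fnorm u \<le> C"
proof (cases "L2_fnorm u = 0")
  case False
  have "(L2_fnorm u)\<^sup>2 = cmod (L2_inner u u)" unfolding L2_inner_self norm_of_real by simp
  also have "\<dots> \<le> C * L2_fnorm u" by (rule le[OF u])
  finally show ?thesis using False L2_fnorm_nonneg[of u] by (simp add: power2_eq_square mult_le_cancel_right)
qed (simp add: C)

subsection \<open>Adjoints\<close>

text \<open>The Riesz representation theorem shows that the choice in the definition of the adjoint has a witness.\<close>

lemma op_adjoint:
  assumes T: "bounded_op (spectral_L2 S) (spectral_L2 R) T" and g: "g \<in> Lp_fun 2"
  shows "op_adjoint (spectral_L2 S) T g \<in> spectral_L2 S"
    and "f \<in> spectral_L2 S \<Longrightarrow> L2_inner f (op_adjoint (spectral_L2 S) T g) = L2_inner (T f) g"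
proof -
  obtain C where C: "0 \<le> C" "\<And>f. f \<in> spectral_L2 S \<Longrightarrow> L2_fnorm (T f) \<le> C * L2_fnorm f"
    by (rule bounded_op_bound[OF T]) blast
  have "\<exists>h. h \<in> spectral_L2 S \<and> (\<forall>f\<in>spectral_L2 S. L2_inner (T f) g = L2_inner f h)"
  proof (rule spectral_L2_Riesz[of S "\<lambda>f. L2_inner (T f) g" "C * L2_fnorm g"])
    show "cmod (L2_inner (T f) g) \<le> C * L2_fnorm g * L2_fnorm f" if f: "f \<in> spectral_L2 S" for f
    proof -
      have "cmod (L2_inner (T f) g) \<le> L2_fnorm (T f) * L2_fnorm g"
        by (intro L2_Cauchy_Schwarz spectral_L2_D[OF bounded_op_maps[OF T f]] g)
      also have "\<dots> \<le> (C * L2_fnorm f) * L2_fnorm g" by (intro mult_right_mono C f) auto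
      finally show ?thesis by (simp add: mult_ac)
    qed
  qed (auto intro: bounded_op_inner_lincomb[OF T _ _ g])
  from someI_ex[OF this] show "op_adjoint (spectral_L2 S) T g \<in> spectral_L2 S"
    and "f \<in> spectral_L2 S \<Longrightarrow> L2_inner f (op_adjoint (spectral_L2 S) T g) = L2_inner (T f) g"
    by (auto simp: op_adjoint_def)
qed

text \<open>An operator whose sesquilinear form is a sum of forms \<open>\<langle>T\<^sub>k f, T\<^sub>k h\<rangle>\<close> inherits linearity almost everywhere
  from the \<open>T\<^sub>k\<close>. It is used for a single adjoint product and for the limit of the series.\<close>

lemma bounded_op_of_form:
  assumes T: "\<And>k::nat. bounded_op (spectral_L2 S) (spectral_L2 R) (T k)"
    and A: "\<And>h. h \<in> spectral_L2 S \<Longrightarrow> A h \<in> spectral_L2 S"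
    and summ: "\<And>f h. f \<in> spectral_L2 S \<Longrightarrow> h \<in> spectral_L2 S \<Longrightarrow> summable (\<lambda>k. L2_inner (T k f) (T k h))"
    and form: "\<And>f h. f \<in> spectral_L2 S \<Longrightarrow> h \<in> spectral_L2 S \<Longrightarrow> L2_inner f (A h) = (\<Sum>k. L2_inner (T k f) (T k h))"
    and C: "0 \<le> C" "\<And>f h. f \<in> spectral_L2 S \<Longrightarrow> h \<in> spectral_L2 S \<Longrightarrow>
      cmod (L2_inner f (A h)) \<le> C * L2_fnorm f * L2_fnorm h"
  shows "bounded_op (spectral_L2 S) (spectral_L2 S) A"
  unfolding bounded_op_def
proof (intro conjI ballI allI A)
  fix h k a b assume h: "h \<in> spectral_L2 S" and k: "k \<in> spectral_L2 S"
  let ?c = "\<lambda>z. a * h z + b * k z"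
  have c: "?c \<in> spectral_L2 S" by (rule spectral_L2_lincomb[OF h k])
  note L2 = spectral_L2_D[OF bounded_op_maps[OF T]]
  show "AE z in torus. A ?c z = a * A h z + b * A k z"
  proof (rule spectral_L2_eqI[where S = S])
    fix f assume f: "f \<in> spectral_L2 S"
    have "L2_inner (T j f) (T j ?c) = cnj a * L2_inner (T j f) (T j h) + cnj b * L2_inner (T j f) (T j k)" for j
      unfolding L2_inner_commute[of "T j f"] bounded_op_inner_lincomb[OF T h k L2[OF f]] by simp
    then have "L2_inner f (A ?c) = (\<Sum>j. cnj a * L2_inner (T j f) (T j h) + cnj b * L2_inner (T j f) (T j k))"
      by (simp add: form f c)
    also have "\<dots> = cnj a * L2_inner f (A h) + cnj b * L2_inner f (A k)"
      by (simp add: suminf_add[symmetric] summable_mult summ form suminf_mult f h k)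
    also have "\<dots> = L2_inner f (\<lambda>z. a * A h z + b * A k z)"
      by (simp add: L2_inner_lincomb_right spectral_L2_D[OF A] spectral_L2_D[OF f] h k)
    finally show "L2_inner f (A ?c) = L2_inner f (\<lambda>z. a * A h z + b * A k z)" .
  qed (intro A c spectral_L2_lincomb h k)+
next
  show "\<exists>C. \<forall>f\<in>spectral_L2 S. L2_fnorm (A f) \<le> C * L2_fnorm f"
  proof (intro exI ballI)
    fix h assume h: "h \<in> spectral_L2 S"
    show "L2_fnorm (A h) \<le> C * L2_fnorm h"
      by (rule L2_fnorm_le_by_duality[OF A[OF h]]) (use C h in \<open>auto simp: mult_ac\<close>)
  qed
qed

lemma adjoint_self_bounded:
  assumes T: "bounded_op (spectral_L2 S) (spectral_L2 R) T"
  shows "bounded_op (spectral_L2 S) (spectral_L2 S) (op_adjoint (spectral_L2 S) T \<circ> T)"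
    and "f \<in> spectral_L2 S \<Longrightarrow> h \<in> spectral_L2 S \<Longrightarrow>
      L2_inner f ((op_adjoint (spectral_L2 S) T \<circ> T) h) = L2_inner (T f) (T h)"
proof -
  note L2 = spectral_L2_D[OF bounded_op_maps[OF T]]
  show inner: "L2_inner f ((op_adjoint (spectral_L2 S) T \<circ> T) h) = L2_inner (T f) (T h)"
    if "f \<in> spectral_L2 S" "h \<in> spectral_L2 S" for f h
    using op_adjoint(2)[OF T L2] that by simp
  obtain C where C: "0 \<le> C" "\<And>f. f \<in> spectral_L2 S \<Longrightarrow> L2_fnorm (T f) \<le> C * L2_fnorm f"
    by (rule bounded_op_bound[OF T]) blast
  \<comment> \<open>a series of forms with a single term\<close>
  define Ts where "Ts k = (if k = 0 then T else (\<lambda>h z. 0))" for k :: nat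
  have Ts_inner: "(\<lambda>k. L2_inner (Ts k f) (Ts k h)) = (\<lambda>k. if k = 0 then L2_inner (T f) (T h) else 0)" for f h
    by (auto simp: Ts_def L2_inner_def)
  show "bounded_op (spectral_L2 S) (spectral_L2 S) (op_adjoint (spectral_L2 S) T \<circ> T)"
  proof (rule bounded_op_of_form[of S R Ts _ "C * C"])
    show "bounded_op (spectral_L2 S) (spectral_L2 R) (Ts k)" for k
      by (simp add: Ts_def T bounded_op_zero)
    show "(op_adjoint (spectral_L2 S) T \<circ> T) h \<in> spectral_L2 S" if "h \<in> spectral_L2 S" for h
      using op_adjoint(1)[OF T L2] that by simp
    fix f h assume f: "f \<in> spectral_L2 S" and h: "h \<in> spectral_L2 S"
    show "summable (\<lambda>k. L2_inner (Ts k f) (Ts k h))" unfolding Ts_inner by simp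
    show "L2_inner f ((op_adjoint (spectral_L2 S) T \<circ> T) h) = (\<Sum>k. L2_inner (Ts k f) (Ts k h))"
      unfolding Ts_inner inner[OF f h] by (subst suminf_finite[of "{0}"]) auto
    have "cmod (L2_inner (T f) (T h)) \<le> L2_fnorm (T f) * L2_fnorm (T h)"
      by (intro L2_Cauchy_Schwarz L2 f h)
    also have "\<dots> \<le> (C * L2_fnorm f) * (C * L2_fnorm h)"
      by (intro mult_mono C f h) (auto intro: mult_nonneg_nonneg C)
    finally show "cmod (L2_inner f ((op_adjoint (spectral_L2 S) T \<circ> T) h)) \<le> C * C * L2_fnorm f * L2_fnorm h"
      unfolding inner[OF f h] by (simp add: mult_ac)
  qed (use C in auto)
qed

subsection \<open>Series of positive operators\<close>

text \<open>By Cauchy-Schwarz the bounds on the quadratic forms \<open>\<Sum>k. norm(T\<^sub>k h)\<^sup>2\<close> control the sesquilinear forms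
  \<open>\<Sum>k. \<langle>T\<^sub>k f, T\<^sub>k h\<rangle>\<close> and their tails, and by duality these control operator norms. The sum of the series is
  the operator that represents the full form. As the norm of a series refers to an arbitrary
  sum, the second claim is about all of them.\<close>

theorem op_sums_adjoint_self:
  fixes \<tau> :: "nat \<Rightarrow> real"
  assumes T: "\<And>k. bounded_op (spectral_L2 S) (spectral_L2 R) (T k)"
    and tau: "\<And>N. 0 \<le> \<tau> N" "\<tau> \<longlonglongrightarrow> 0"
    and tail: "\<And>N M h. h \<in> spectral_L2 S \<Longrightarrow> (\<Sum>k\<in>{N..<M}. (L2_fnorm (T k h))\<^sup>2) \<le> \<tau> N * (L2_fnorm h)\<^sup>2"
  shows "\<exists>A. op_sums (spectral_L2 S) (\<lambda>k. op_adjoint (spectral_L2 S) (T k) \<circ> T k) A"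
    and "op_sums (spectral_L2 S) (\<lambda>k. op_adjoint (spectral_L2 S) (T k) \<circ> T k) B \<Longrightarrow>
      op_norm (spectral_L2 S) B \<le> \<tau> 0"
proof -
  let ?V = "spectral_L2 S"
  let ?A = "\<lambda>k. op_adjoint ?V (T k) \<circ> T k"
  note L2 = spectral_L2_D[OF bounded_op_maps[OF T]]
  note A_bounded = adjoint_self_bounded(1)[OF T] and A_inner = adjoint_self_bounded(2)[OF T]
  have cross: "(\<Sum>k\<in>{N..<M}. cmod (L2_inner (T k f) (T k h))) \<le> \<tau> N * L2_fnorm f * L2_fnorm h"
    if f: "f \<in> ?V" and h: "h \<in> ?V" for N M f h
  proof -
    have root: "L2_set (\<lambda>k. L2_fnorm (T k g)) {N..<M} \<le> sqrt (\<tau> N) * L2_fnorm g" if "g \<in> ?V" for g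
      unfolding L2_set_def by (rule real_le_lsqrt) (use tail[OF that] tau in \<open>auto intro!: mult_nonneg_nonneg simp: power_mult_distrib\<close>)
    have "(\<Sum>k\<in>{N..<M}. cmod (L2_inner (T k f) (T k h))) \<le> (\<Sum>k\<in>{N..<M}. \<bar>L2_fnorm (T k f)\<bar> * \<bar>L2_fnorm (T k h)\<bar>)"
      by (intro sum_mono) (use L2_Cauchy_Schwarz[OF L2[OF f] L2[OF h]] in simp)
    also have "\<dots> \<le> L2_set (\<lambda>k. L2_fnorm (T k f)) {N..<M} * L2_set (\<lambda>k. L2_fnorm (T k h)) {N..<M}"
      by (rule L2_set_mult_ineq)
    also have "\<dots> \<le> (sqrt (\<tau> N) * L2_fnorm f) * (sqrt (\<tau> N) * L2_fnorm h)"
      by (intro mult_mono root f h) (auto intro!: mult_nonneg_nonneg tau simp: L2_set_nonneg)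
    also have "\<dots> = \<tau> N * L2_fnorm f * L2_fnorm h"
      using real_sqrt_mult_self[of "\<tau> N"] tau(1)[of N] by (simp add: algebra_simps)
    finally show ?thesis .
  qed
  have summ_norm: "summable (\<lambda>k. cmod (L2_inner (T k f) (T k h)))" if "f \<in> ?V" "h \<in> ?V" for f h
    by (rule summableI_nonneg_bounded[where x = "\<tau> 0 * L2_fnorm f * L2_fnorm h"])
      (use cross[OF that, of 0] in \<open>auto simp: atLeast0LessThan\<close>)
  have summ: "summable (\<lambda>k. L2_inner (T k f) (T k h))" if "f \<in> ?V" "h \<in> ?V" for f h
    by (rule summable_norm_cancel[OF summ_norm[OF that]])
  have rest: "cmod ((\<Sum>k. L2_inner (T k f) (T k h)) - (\<Sum>k<N. L2_inner (T k f) (T k h))) \<le> \<tau> N * L2_fnorm f * L2_fnorm h"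
    if f: "f \<in> ?V" and h: "h \<in> ?V" for N f h
  proof -
    let ?a = "\<lambda>k. L2_inner (T k f) (T k h)"
    have "(\<lambda>M. cmod ((\<Sum>k<M. ?a k) - (\<Sum>k<N. ?a k))) \<longlonglongrightarrow> cmod ((\<Sum>k. ?a k) - (\<Sum>k<N. ?a k))"
      by (intro tendsto_intros summable_LIMSEQ summ f h)
    moreover have "eventually (\<lambda>M. cmod ((\<Sum>k<M. ?a k) - (\<Sum>k<N. ?a k)) \<le> \<tau> N * L2_fnorm f * L2_fnorm h) sequentially"
    proof (rule eventually_sequentiallyI[of N])
      fix M assume "N \<le> M"
      then have "(\<Sum>k<M. ?a k) - (\<Sum>k<N. ?a k) = (\<Sum>k\<in>{N..<M}. ?a k)"
        by (simp add: sum_diff_nat_ivl[of 0 N M, simplified atLeast0LessThan])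
      then show "cmod ((\<Sum>k<M. ?a k) - (\<Sum>k<N. ?a k)) \<le> \<tau> N * L2_fnorm f * L2_fnorm h"
        using order_trans[OF norm_sum cross[OF f h, of N M]] by simp
    qed
    ultimately show ?thesis by (intro tendsto_upperbound[of _ _ sequentially]) auto
  qed
  have partial: "L2_inner f (\<lambda>z. \<Sum>k<N. ?A k h z) = (\<Sum>k<N. L2_inner (T k f) (T k h))"
    if f: "f \<in> ?V" and h: "h \<in> ?V" for N f h
  proof (induction N)
    case 0
    then show ?case by (simp add: L2_inner_def)
  next
    case (Suc N)
    have "(\<lambda>z. \<Sum>k<N. ?A k h z) \<in> ?V" by (rule bounded_op_maps[OF bounded_op_sum[OF A_bounded] h])
    then show ?case
      using L2_inner_lincomb_right[of "\<lambda>z. \<Sum>k<N. ?A k h z" "?A N h" f 1 1] Suc A_inner[OF f h, of N]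
        spectral_L2_D[OF bounded_op_maps[OF A_bounded h]] spectral_L2_D[OF f] by (auto dest: spectral_L2_D)
  qed
  have "\<forall>h\<in>?V. \<exists>u. u \<in> ?V \<and> (\<forall>f\<in>?V. L2_inner f u = (\<Sum>k. L2_inner (T k f) (T k h)))"
  proof
    fix h assume h: "h \<in> ?V"
    show "\<exists>u. u \<in> ?V \<and> (\<forall>f\<in>?V. L2_inner f u = (\<Sum>k. L2_inner (T k f) (T k h)))"
    proof (rule spectral_L2_Riesz[of S "\<lambda>f. \<Sum>k. L2_inner (T k f) (T k h)" "\<tau> 0 * L2_fnorm h"])
      fix f g a b assume f: "f \<in> ?V" and g: "g \<in> ?V"
      show "(\<Sum>k. L2_inner (T k (\<lambda>z. a * f z + b * g z)) (T k h)) =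
          a * (\<Sum>k. L2_inner (T k f) (T k h)) + b * (\<Sum>k. L2_inner (T k g) (T k h))"
        by (simp add: bounded_op_inner_lincomb[OF T f g L2[OF h]] suminf_add[symmetric] summable_mult summ f g h suminf_mult)
      show "cmod (\<Sum>k. L2_inner (T k f) (T k h)) \<le> \<tau> 0 * L2_fnorm h * L2_fnorm f"
        using rest[OF f h, of 0] by (simp add: mult_ac)
    qed auto
  qed
  then obtain U where U: "\<And>h. h \<in> ?V \<Longrightarrow> U h \<in> ?V"
    and U_inner: "\<And>f h. f \<in> ?V \<Longrightarrow> h \<in> ?V \<Longrightarrow> L2_inner f (U h) = (\<Sum>k. L2_inner (T k f) (T k h))"
    by metis
  have U_bounded: "bounded_op ?V ?V U"
  proof (rule bounded_op_of_form[OF T U summ U_inner, of "\<tau> 0"])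
    show "cmod (L2_inner f (U h)) \<le> \<tau> 0 * L2_fnorm f * L2_fnorm h" if "f \<in> ?V" "h \<in> ?V" for f h
      using rest[OF that, of 0] by (simp add: U_inner that)
  qed (use tau in auto)
  have D_bounded: "bounded_op ?V ?V (\<lambda>h z. (\<Sum>k<N. ?A k h z) - U h z)" for N
    by (intro bounded_op_diff bounded_op_sum A_bounded U_bounded)
  have "op_norm ?V (\<lambda>h z. (\<Sum>k<N. ?A k h z) - U h z) \<le> \<tau> N" for N
  proof (rule op_norm_le[OF tau(1)])
    fix h assume h: "h \<in> ?V"
    show "L2_fnorm (\<lambda>z. (\<Sum>k<N. ?A k h z) - U h z) \<le> \<tau> N * L2_fnorm h"
    proof (rule L2_fnorm_le_by_duality[OF bounded_op_maps[OF D_bounded h]])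
      fix f assume f: "f \<in> ?V"
      have "L2_inner f (\<lambda>z. (\<Sum>k<N. ?A k h z) - U h z) =
          (\<Sum>k<N. L2_inner (T k f) (T k h)) - (\<Sum>k. L2_inner (T k f) (T k h))"
        using L2_inner_lincomb_right[of "\<lambda>z. \<Sum>k<N. ?A k h z" "U h" f 1 "-1"] partial[OF f h] U_inner[OF f h]
          spectral_L2_D[OF bounded_op_maps[OF bounded_op_sum[OF A_bounded] h]] spectral_L2_D[OF U[OF h]] spectral_L2_D[OF f]
        by simp
      then show "cmod (L2_inner f (\<lambda>z. (\<Sum>k<N. ?A k h z) - U h z)) \<le> \<tau> N * L2_fnorm h * L2_fnorm f"
        using rest[OF f h, of N] by (simp add: norm_minus_commute mult_ac)
    qed (simp add: tau)
  qed
  then have "(\<lambda>N. op_norm ?V (\<lambda>h z. (\<Sum>k<N. ?A k h z) - U h z)) \<longlonglongrightarrow> 0"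
    by (intro tendsto_sandwich[OF _ _ tendsto_const tau(2)] always_eventually allI op_norm_nonneg[OF D_bounded])
  then show "\<exists>A. op_sums ?V ?A A"
    unfolding op_sums_def using A_bounded U_bounded by blast
  assume B: "op_sums ?V ?A B"
  then have B_bounded: "bounded_op ?V ?V B"
    and B_lim: "(\<lambda>N. op_norm ?V (\<lambda>h z. (\<Sum>k<N. ?A k h z) - B h z)) \<longlonglongrightarrow> 0"
    by (auto simp: op_sums_def)
  have DB_bounded: "bounded_op ?V ?V (\<lambda>h z. (\<Sum>k<N. ?A k h z) - B h z)" for N
    by (intro bounded_op_diff bounded_op_sum A_bounded B_bounded)
  have "op_norm ?V B \<le> \<tau> 0 + op_norm ?V (\<lambda>h z. (\<Sum>k<N. ?A k h z) - B h z)" for N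
  proof (rule op_norm_le)
    show "0 \<le> \<tau> 0 + op_norm ?V (\<lambda>h z. (\<Sum>k<N. ?A k h z) - B h z)"
      using tau(1)[of 0] op_norm_nonneg[OF DB_bounded] by simp
    fix h assume h: "h \<in> ?V"
    have sum_V: "(\<lambda>z. \<Sum>k<N. ?A k h z) \<in> ?V" by (rule bounded_op_maps[OF bounded_op_sum[OF A_bounded] h])
    have "L2_fnorm (B h) = L2_fnorm (\<lambda>z. (\<Sum>k<N. ?A k h z) + (-1) * ((\<Sum>k<N. ?A k h z) - B h z))"
      by simp
    also have "\<dots> \<le> L2_fnorm (\<lambda>z. \<Sum>k<N. ?A k h z) + L2_fnorm (\<lambda>z. (-1) * ((\<Sum>k<N. ?A k h z) - B h z))"
      by (intro L2_fnorm_triangle L2_scale spectral_L2_D[OF sum_V] spectral_L2_D[OF bounded_op_maps[OF DB_bounded h]])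
    also have "L2_fnorm (\<lambda>z. (-1) * ((\<Sum>k<N. ?A k h z) - B h z)) = L2_fnorm (\<lambda>z. (\<Sum>k<N. ?A k h z) - B h z)"
      by (subst L2_fnorm_scale) simp
    also have "\<dots> \<le> op_norm ?V (\<lambda>h z. (\<Sum>k<N. ?A k h z) - B h z) * L2_fnorm h"
      by (rule norm_le_op_norm[OF DB_bounded h])
    also have "L2_fnorm (\<lambda>z. \<Sum>k<N. ?A k h z) \<le> \<tau> 0 * L2_fnorm h"
    proof (rule L2_fnorm_le_by_duality[OF sum_V])
      fix f assume f: "f \<in> ?V"
      have "cmod (\<Sum>k<N. L2_inner (T k f) (T k h)) \<le> \<tau> 0 * L2_fnorm f * L2_fnorm h"
        using order_trans[OF norm_sum cross[OF f h, of 0 N]] by (simp add: atLeast0LessThan)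
      then show "cmod (L2_inner f (\<lambda>z. \<Sum>k<N. ?A k h z)) \<le> \<tau> 0 * L2_fnorm h * L2_fnorm f"
        using partial[OF f h] by (simp add: mult_ac)
    qed (simp add: tau)
    finally show "L2_fnorm (B h) \<le> (\<tau> 0 + op_norm ?V (\<lambda>h z. (\<Sum>k<N. ?A k h z) - B h z)) * L2_fnorm h"
      by (simp add: distrib_right)
  qed
  then have "op_norm ?V B \<le> \<tau> 0 + 0"
    by (intro tendsto_lowerbound[OF tendsto_add[OF tendsto_const B_lim]] always_eventually allI) auto
  then show "op_norm ?V B \<le> \<tau> 0" by simp
qed

section \<open>Hankel operators in Fourier coefficients\<close>

abbreviation nonneg_freq :: "('d::finite \<Rightarrow> int) set" where
  "nonneg_freq \<equiv> {n. \<forall>i. 0 \<le> n i}"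

text \<open>Written with \<open>cnj (torus_char n z)\<close> rather than \<open>torus_char (- n) z\<close>: the two differ off the torus,
  and operators act on functions literally.\<close>

definition conj_trig :: "(('d::finite \<Rightarrow> int) \<Rightarrow> complex) \<Rightarrow> ('d \<Rightarrow> int) set \<Rightarrow> 'd torus_fun" where
  "conj_trig x G z = (\<Sum>n\<in>G. x n * cnj (torus_char n z))"

lemma conj_trig_eq: "conj_trig x G = (\<lambda>z. cnj (trig (\<lambda>n. cnj (x n)) G z))"
  by (simp add: conj_trig_def trig_def fun_eq_iff)

lemma conj_trig_in_conj_Hardy2: "finite G \<Longrightarrow> G \<subseteq> nonneg_freq \<Longrightarrow> conj_trig x G \<in> conj_Hardy2"
  unfolding conj_trig_eq conj_Hardy2_def Hardy_2_eq by (intro imageI spectral_L2_trig)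

lemma conj_analytic_polys_eq:
  "conj_analytic_polys = {conj_trig x G | x G. finite G \<and> G \<subseteq> nonneg_freq}"
proof (intro equalityI subsetI)
  fix p :: "('d::finite) torus_fun" assume "p \<in> conj_analytic_polys"
  then obtain A c where A: "finite A" "p = (\<lambda>z. \<Sum>n\<in>A. c n * cnj (torus_char (\<lambda>i. int (n i)) z))"
    by (auto simp: conj_analytic_polys_def)
  let ?j = "\<lambda>n i. int (n i)"
  have inj: "inj_on ?j A" by (auto simp: inj_on_def fun_eq_iff)
  have "p = conj_trig (\<lambda>n. c (\<lambda>i. nat (n i))) (?j ` A)"
    unfolding A(2) conj_trig_def by (simp add: sum.reindex[OF inj] o_def)
  moreover have "finite (?j ` A)" "?j ` A \<subseteq> nonneg_freq" using A(1) by auto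
  ultimately show "p \<in> {conj_trig x G | x G. finite G \<and> G \<subseteq> nonneg_freq}"
    unfolding mem_Collect_eq by (intro exI conjI)
next
  fix p :: "('d::finite) torus_fun" assume "p \<in> {conj_trig x G | x G. finite G \<and> G \<subseteq> nonneg_freq}"
  then obtain x G where G: "finite G" "G \<subseteq> nonneg_freq" "p = conj_trig x G" by blast
  let ?j = "\<lambda>n i. nat (n i)"
  have inv: "(\<lambda>i. int (?j n i)) = n" if "n \<in> G" for n
    using G(2) that by (auto simp: fun_eq_iff)
  have "inj_on ?j G" by (rule inj_on_inverseI[where g = "\<lambda>n i. int (n i)"]) (rule inv)
  then have "p = (\<lambda>z. \<Sum>n\<in>?j ` G. x (\<lambda>i. int (n i)) * cnj (torus_char (\<lambda>i. int (n i)) z))"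
    unfolding G(3) conj_trig_def
    by (subst sum.reindex) (simp_all only: o_def inv cong: sum.cong)
  moreover have "finite (?j ` G)" using G(1) by simp
  ultimately show "p \<in> conj_analytic_polys"
    unfolding conj_analytic_polys_def mem_Collect_eq
    by (intro exI[of _ "?j ` G"] exI[of _ "\<lambda>n. x (\<lambda>i. int (n i))"] conjI)
qed

lemma L2_fnorm_cnj: "L2_fnorm (\<lambda>z. cnj (f z)) = L2_fnorm f"
  by (simp add: L2_fnorm_def)

lemma L2_fnorm_conj_trig_square: "finite G \<Longrightarrow> (L2_fnorm (conj_trig x G))\<^sup>2 = (\<Sum>n\<in>G. (cmod (x n))\<^sup>2)"
  unfolding conj_trig_eq L2_fnorm_cnj by (simp add: L2_fnorm_trig_square)

lemma L2_inner_conj_trig: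
  assumes "finite G" "f \<in> Lp_fun 2"
  shows "L2_inner (conj_trig x G) f = (\<Sum>n\<in>G. x n * cnj (fourier_coeff f (\<lambda>i. - n i)))"
proof -
  have "L2_inner (conj_trig x G) f = cnj (L2_inner (trig (\<lambda>n. cnj (x n)) G) (\<lambda>z. cnj (f z)))"
    unfolding conj_trig_eq L2_inner_def Bochner_Integration.integral_cnj[symmetric] by simp
  then show ?thesis
    using assms by (simp add: L2_inner_trig L2_cnj fourier_coeff_cnj)
qed

lemma fourier_coeff_mult_conj_trig:
  fixes \<psi> :: "('d::finite) torus_fun"
  assumes \<psi>: "integrable torus \<psi>" and G: "finite G"
  shows "fourier_coeff (\<lambda>z. \<psi> z * conj_trig x G z) n = (\<Sum>m\<in>G. fourier_coeff \<psi> (n + m) * x m)"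
proof -
  have "fourier_coeff (\<lambda>z. \<psi> z * conj_trig x G z) n =
      (LINT z|torus. (\<Sum>m\<in>G. x m * (\<psi> z * cnj (torus_char (n + m) z))))"
    unfolding fourier_coeff_def
  proof (rule Bochner_Integration.integral_cong[OF refl])
    fix z :: "'d \<Rightarrow> complex" assume "z \<in> space torus"
    then have "torus_char (n + m) z = torus_char n z * torus_char m z" for m
      by (simp add: plus_fun_def torus_char_add)
    then show "\<psi> z * conj_trig x G z * cnj (torus_char n z) =
        (\<Sum>m\<in>G. x m * (\<psi> z * cnj (torus_char (n + m) z)))"
      by (simp add: conj_trig_def sum_distrib_left sum_distrib_right mult_ac)
  qed
  also have "\<dots> = (\<Sum>m\<in>G. x m * fourier_coeff \<psi> (n + m))"
    unfolding fourier_coeff_def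
    by (subst Bochner_Integration.integral_sum) (auto intro!: integrable_mult_right integrable_mult_cnj_char \<psi>)
  finally show ?thesis by (simp add: mult.commute)
qed

lemma hankel_coeff:
  assumes T: "is_hankel \<psi> T" and \<psi>: "integrable torus \<psi>"
    and G: "finite G" "G \<subseteq> nonneg_freq" and n: "n \<in> nonneg_freq"
  shows "fourier_coeff (T (conj_trig x G)) n = (\<Sum>m\<in>G. fourier_coeff \<psi> (n + m) * x m)"
proof -
  have "conj_trig x G \<in> conj_analytic_polys"
    unfolding conj_analytic_polys_eq using G by blast
  then have "is_riesz_proj (\<lambda>z. \<psi> z * conj_trig x G z) (T (conj_trig x G))"
    using T by (simp add: is_hankel_def)
  then show ?thesis
    using n by (simp add: is_riesz_proj_def fourier_coeff_mult_conj_trig[OF \<psi> G(1)])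
qed

text \<open>The matrix of the Hankel operator is read off from its action on polynomials; Bessel's inequality
  allows the restriction to finitely many rows.\<close>

lemma hankel_finite_section_le:
  assumes T: "is_hankel \<psi> T" and \<psi>: "integrable torus \<psi>"
    and F: "finite F" "F \<subseteq> nonneg_freq" and G: "finite G" "G \<subseteq> nonneg_freq"
  shows "(\<Sum>m\<in>F. (cmod (\<Sum>n\<in>G. fourier_coeff \<psi> (m + n) * x n))\<^sup>2) \<le>
    (op_norm conj_Hardy2 T)\<^sup>2 * (\<Sum>n\<in>G. (cmod (x n))\<^sup>2)"
proof -
  let ?p = "conj_trig x G"
  have bT: "bounded_op (spectral_L2 {n. \<forall>i. n i \<le> 0}) (spectral_L2 nonneg_freq) T"
    using T by (simp add: is_hankel_def conj_Hardy2_eq Hardy_2_eq)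
  have p: "?p \<in> spectral_L2 {n. \<forall>i. n i \<le> 0}"
    using conj_trig_in_conj_Hardy2[OF G] by (simp add: conj_Hardy2_eq)
  have "(\<Sum>m\<in>F. (cmod (\<Sum>n\<in>G. fourier_coeff \<psi> (m + n) * x n))\<^sup>2) = (\<Sum>m\<in>F. (cmod (fourier_coeff (T ?p) m))\<^sup>2)"
    using F(2) by (intro sum.cong refl) (subst hankel_coeff[OF T \<psi> G], auto)
  also have "\<dots> \<le> (L2_fnorm (T ?p))\<^sup>2"
    by (rule Bessel[OF spectral_L2_D[OF bounded_op_maps[OF bT p]] F(1)])
  also have "\<dots> \<le> (op_norm conj_Hardy2 T * L2_fnorm ?p)\<^sup>2"
    using norm_le_op_norm[OF bT p] by (intro power_mono) (auto simp: conj_Hardy2_eq)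
  finally show ?thesis by (simp add: power_mult_distrib L2_fnorm_conj_trig_square[OF G(1)])
qed

text \<open>The converse of \<open>hankel_finite_section_le\<close>. The rows of the matrix are square-summable, so each of them is
  the coefficient sequence of a function \<open>r m\<close>, and the \<open>m\<close>-th coefficient of the image of \<open>h\<close> can be
  defined as \<open>L2_inner h (r m)\<close>. This makes linearity evident, and Parseval's identity exhibits it as the limit of the
  finite sections.\<close>

theorem hankel_bounded_of_finite_sections:
  fixes \<psi> :: "('d::finite) torus_fun"
  assumes \<psi>: "integrable torus \<psi>" and C: "0 \<le> C"
    and sections: "\<And>F G x. finite F \<Longrightarrow> F \<subseteq> nonneg_freq \<Longrightarrow> finite G \<Longrightarrow> G \<subseteq> nonneg_freq \<Longrightarrow>
      (\<Sum>m\<in>F. (cmod (\<Sum>n\<in>G. fourier_coeff \<psi> (m + n) * x n))\<^sup>2) \<le> C\<^sup>2 * (\<Sum>n\<in>G. (cmod (x n))\<^sup>2)"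
  shows "hankel_bounded \<psi>"
proof -
  let ?N = "{n :: 'd \<Rightarrow> int. \<forall>i. n i \<le> 0}"
  \<comment> \<open>the row at \<open>m\<close> of the matrix, indexed by the frequency \<open>k = - n\<close> of the argument\<close>
  define row where "row m k = (if k \<in> ?N then cnj (fourier_coeff \<psi> (m - k)) else 0)" for m k
  have subset: "uminus ` (A \<inter> ?N) \<subseteq> nonneg_freq" for A by (auto simp: fun_Compl_def)
  have row_sum: "(\<Sum>k\<in>A. (cmod (row m k))\<^sup>2) \<le> C\<^sup>2" if m: "m \<in> nonneg_freq" and A: "finite A" for m A
  proof -
    let ?G = "uminus ` (A \<inter> ?N)"
    have "(\<Sum>k\<in>A. (cmod (row m k))\<^sup>2) = (\<Sum>k\<in>A \<inter> ?N. (cmod (row m k))\<^sup>2)"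
      using A by (intro sum.mono_neutral_right) (auto simp: row_def)
    also have "\<dots> = (\<Sum>n\<in>?G. (cmod (fourier_coeff \<psi> (m + n)))\<^sup>2)"
      by (subst sum.reindex) (auto simp: row_def)
    finally have eq: "(\<Sum>k\<in>A. (cmod (row m k))\<^sup>2) = (\<Sum>n\<in>?G. (cmod (fourier_coeff \<psi> (m + n)))\<^sup>2)" .
    let ?s = "\<Sum>n\<in>?G. (cmod (fourier_coeff \<psi> (m + n)))\<^sup>2"
    have s: "0 \<le> ?s" by (intro sum_nonneg) auto
    have "(\<Sum>n\<in>?G. fourier_coeff \<psi> (m + n) * cnj (fourier_coeff \<psi> (m + n))) = complex_of_real ?s"
      by (simp add: complex_norm_square del: of_real_power)
    moreover have "(cmod (\<Sum>n\<in>?G. fourier_coeff \<psi> (m + n) * cnj (fourier_coeff \<psi> (m + n))))\<^sup>2 \<le> C\<^sup>2 * ?s"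
      \<comment> \<open>the section with the single row \<open>m\<close>, applied to the conjugate of that row\<close>
      using sections[of "{m}" ?G "\<lambda>n. cnj (fourier_coeff \<psi> (m + n))"] m A subset[of A]
      by simp
    ultimately have "?s\<^sup>2 \<le> C\<^sup>2 * ?s" using s by (simp only: norm_of_real power2_abs)
    then have "?s \<le> C\<^sup>2"
      using s by (cases "?s = 0") (auto simp: power2_eq_square mult_le_cancel_right)
    then show ?thesis by (simp only: eq)
  qed
  have "\<exists>r. r \<in> Lp_fun 2 \<and> (\<forall>k. fourier_coeff r k = row m k)" if "m \<in> nonneg_freq" for m
  proof (rule Riesz_Fischer)
    show "(\<lambda>k. (cmod (row m k))\<^sup>2) summable_on UNIV"
      by (rule nonneg_bdd_above_summable_on) (auto intro!: bdd_aboveI[of _ "C\<^sup>2"] row_sum that)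
  qed blast
  then obtain r where r: "\<And>m. m \<in> nonneg_freq \<Longrightarrow> r m \<in> Lp_fun 2"
    and r_coeff: "\<And>m k. m \<in> nonneg_freq \<Longrightarrow> fourier_coeff (r m) k = row m k"
    by metis
  \<comment> \<open>the coefficients of the image of \<open>h\<close>\<close>
  define c where "c h m = (if m \<in> nonneg_freq then L2_inner h (r m) else 0)" for h m
  have c_lincomb: "c (\<lambda>z. a * f z + b * g z) m = a * c f m + b * c g m" if "f \<in> Lp_fun 2" "g \<in> Lp_fun 2" for a b f g m
    using that r by (simp add: c_def L2_inner_lincomb)
  have c_trig: "c (conj_trig x G) m = (\<Sum>n\<in>G. fourier_coeff \<psi> (m + n) * x n)"
    if "finite G" "G \<subseteq> nonneg_freq" "m \<in> nonneg_freq" for x G m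
  proof -
    have "c (conj_trig x G) m = (\<Sum>n\<in>G. x n * cnj (row m (- n)))"
      using that r by (simp add: c_def L2_inner_conj_trig r_coeff fun_Compl_def)
    also have "\<dots> = (\<Sum>n\<in>G. fourier_coeff \<psi> (m + n) * x n)"
      using that(2) by (intro sum.cong refl) (auto simp: row_def)
    finally show ?thesis .
  qed
  have c_bound: "(\<Sum>m\<in>F. (cmod (c h m))\<^sup>2) \<le> C\<^sup>2 * (L2_fnorm h)\<^sup>2"
    if h: "h \<in> spectral_L2 ?N" and F: "finite F" for h F
  proof -
    have L2h: "h \<in> Lp_fun 2" by (rule spectral_L2_D[OF h])
    let ?F = "F \<inter> nonneg_freq"
    let ?y = "\<lambda>A m. \<Sum>k\<in>A. fourier_coeff h k * cnj (fourier_coeff (r m) k)"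
    have "((\<lambda>A. \<Sum>m\<in>?F. (cmod (?y A m))\<^sup>2) \<longlongrightarrow> (\<Sum>m\<in>?F. (cmod (L2_inner h (r m)))\<^sup>2)) (finite_subsets_at_top UNIV)"
      by (intro tendsto_intros Parseval_inner[unfolded has_sum_def] L2h r) auto
    moreover have "(\<Sum>m\<in>?F. (cmod (?y A m))\<^sup>2) \<le> C\<^sup>2 * (L2_fnorm h)\<^sup>2" if A: "finite A" for A
    proof -
      let ?G = "uminus ` (A \<inter> ?N)"
      have "?y A m = (\<Sum>n\<in>?G. fourier_coeff \<psi> (m + n) * fourier_coeff h (- n))" if "m \<in> ?F" for m
      proof -
        have "?y A m = (\<Sum>k\<in>A \<inter> ?N. fourier_coeff h k * cnj (row m k))"
          using A that by (intro sum.mono_neutral_cong_right) (auto simp: row_def r_coeff)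
        also have "\<dots> = (\<Sum>n\<in>?G. fourier_coeff \<psi> (m + n) * fourier_coeff h (- n))"
          by (subst sum.reindex) (auto simp: row_def mult.commute)
        finally show ?thesis .
      qed
      then have "(\<Sum>m\<in>?F. (cmod (?y A m))\<^sup>2) =
          (\<Sum>m\<in>?F. (cmod (\<Sum>n\<in>?G. fourier_coeff \<psi> (m + n) * fourier_coeff h (- n)))\<^sup>2)"
        by (intro sum.cong refl) simp
      also have "\<dots> \<le> C\<^sup>2 * (\<Sum>n\<in>?G. (cmod (fourier_coeff h (- n)))\<^sup>2)"
        using A F subset by (intro sections) auto
      also have "(\<Sum>n\<in>?G. (cmod (fourier_coeff h (- n)))\<^sup>2) = (\<Sum>k\<in>A \<inter> ?N. (cmod (fourier_coeff h k))\<^sup>2)"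
        by (subst sum.reindex) auto
      also have "C\<^sup>2 * \<dots> \<le> C\<^sup>2 * (L2_fnorm h)\<^sup>2"
        using A by (intro mult_left_mono Bessel L2h) auto
      finally show ?thesis .
    qed
    then have "eventually (\<lambda>A. (\<Sum>m\<in>?F. (cmod (?y A m))\<^sup>2) \<le> C\<^sup>2 * (L2_fnorm h)\<^sup>2) (finite_subsets_at_top UNIV)"
      unfolding eventually_finite_subsets_at_top by blast
    ultimately have "(\<Sum>m\<in>?F. (cmod (L2_inner h (r m)))\<^sup>2) \<le> C\<^sup>2 * (L2_fnorm h)\<^sup>2"
      by (intro tendsto_upperbound[of _ _ "finite_subsets_at_top UNIV"]) auto
    moreover have "(\<Sum>m\<in>F. (cmod (c h m))\<^sup>2) = (\<Sum>m\<in>?F. (cmod (L2_inner h (r m)))\<^sup>2)"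
      using F by (intro sum.mono_neutral_cong_right) (auto simp: c_def)
    ultimately show ?thesis by simp
  qed
  have "\<exists>g. g \<in> Lp_fun 2 \<and> (\<forall>m. fourier_coeff g m = c h m)" if "h \<in> spectral_L2 ?N" for h
  proof (rule Riesz_Fischer)
    show "(\<lambda>m. (cmod (c h m))\<^sup>2) summable_on UNIV"
      by (rule nonneg_bdd_above_summable_on)
        (auto intro!: bdd_aboveI[of _ "C\<^sup>2 * (L2_fnorm h)\<^sup>2"] c_bound that)
  qed blast
  then obtain T where T: "\<And>h. h \<in> spectral_L2 ?N \<Longrightarrow> T h \<in> Lp_fun 2"
    and T_coeff: "\<And>h m. h \<in> spectral_L2 ?N \<Longrightarrow> fourier_coeff (T h) m = c h m"
    by metis
  have T_maps: "T h \<in> spectral_L2 nonneg_freq" if "h \<in> spectral_L2 ?N" for h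
    using that T by (simp add: spectral_L2_def T_coeff[OF that] c_def)
  have T_linear: "AE z in torus. T (\<lambda>z. a * f z + b * g z) z = a * T f z + b * T g z"
    if f: "f \<in> spectral_L2 ?N" and g: "g \<in> spectral_L2 ?N" for a b f g
  proof -
    let ?u = "\<lambda>z. a * f z + b * g z" and ?v = "\<lambda>z. a * T f z + b * T g z"
    have u: "?u \<in> spectral_L2 ?N" and v: "?v \<in> Lp_fun 2"
      by (auto intro: spectral_L2_lincomb L2_lincomb f g T)
    have "AE z in torus. 1 * T ?u z + (-1) * ?v z = 0"
    proof (rule fourier_coeff_unique[OF L2_integrable[OF L2_lincomb[OF T[OF u] v]]])
      fix m
      show "fourier_coeff (\<lambda>z. 1 * T ?u z + (-1) * ?v z) m = 0"
        unfolding fourier_coeff_lincomb[OF T[OF u] v] fourier_coeff_lincomb[OF T[OF f] T[OF g]]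
          T_coeff[OF u] T_coeff[OF f] T_coeff[OF g] c_lincomb[OF spectral_L2_D[OF f] spectral_L2_D[OF g]]
        by simp
    qed
    then show ?thesis
      by eventually_elim (simp only: mult_1_left mult_minus1 add_uminus_conv_diff right_minus_eq)
  qed
  have T_bound: "L2_fnorm (T h) \<le> C * L2_fnorm h" if h: "h \<in> spectral_L2 ?N" for h
  proof (rule power2_le_imp_le)
    have "((\<lambda>A. \<Sum>m\<in>A. (cmod (fourier_coeff (T h) m))\<^sup>2) \<longlongrightarrow> (L2_fnorm (T h))\<^sup>2) (finite_subsets_at_top UNIV)"
      using Parseval[OF T[OF h]] by (simp add: has_sum_def)
    moreover have "eventually (\<lambda>A. (\<Sum>m\<in>A. (cmod (fourier_coeff (T h) m))\<^sup>2) \<le> C\<^sup>2 * (L2_fnorm h)\<^sup>2) (finite_subsets_at_top UNIV)"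
      unfolding eventually_finite_subsets_at_top T_coeff[OF h] using c_bound[OF h] by blast
    ultimately have "(L2_fnorm (T h))\<^sup>2 \<le> C\<^sup>2 * (L2_fnorm h)\<^sup>2"
      by (intro tendsto_upperbound[of _ _ "finite_subsets_at_top UNIV"]) auto
    then show "(L2_fnorm (T h))\<^sup>2 \<le> (C * L2_fnorm h)\<^sup>2" by (simp add: power_mult_distrib)
  qed (use C in auto)
  have "is_hankel \<psi> T"
    unfolding is_hankel_def
  proof (intro conjI ballI)
    show "bounded_op conj_Hardy2 (Hardy 2) T"
      unfolding bounded_op_def conj_Hardy2_eq Hardy_2_eq
      using T_maps T_linear T_bound by blast
    fix p :: "('d::finite) torus_fun" assume "p \<in> conj_analytic_polys"
    then obtain x G where G: "finite G" "G \<subseteq> nonneg_freq" and p: "p = conj_trig x G"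
      by (auto simp: conj_analytic_polys_eq)
    have pN: "p \<in> spectral_L2 ?N"
      using conj_trig_in_conj_Hardy2[OF G] by (simp add: p conj_Hardy2_eq)
    have "fourier_coeff (T p) m = (if \<forall>i. 0 \<le> m i then fourier_coeff (\<lambda>z. \<psi> z * p z) m else 0)" for m
    proof (cases "m \<in> nonneg_freq")
      case True
      then show ?thesis
        unfolding p T_coeff[OF pN[unfolded p]] fourier_coeff_mult_conj_trig[OF \<psi> G(1)] c_trig[OF G True]
        by simp
    next
      case False
      then show ?thesis unfolding T_coeff[OF pN] c_def by auto
    qed
    then show "is_riesz_proj (\<lambda>z. \<psi> z * p z) (T p)"
      by (simp add: is_riesz_proj_def Lp_fun_1_iff L2_integrable[OF T[OF pN]])
  qed
  then show ?thesis by (auto simp: hankel_bounded_def)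
qed

section \<open>The square function of a sequence of Hankel operators\<close>

text \<open>The finite inequality with full inner products on the right, obtained by letting the set of frequencies
  \<open>E\<close> in it grow: the left-hand side does not depend on \<open>E\<close>.\<close>

lemma hankel_family_sections:
  fixes \<phi> :: "('d::finite) torus_fun" and f :: "nat \<Rightarrow> 'd torus_fun"
  assumes \<phi>: "integrable torus \<phi>" and T: "is_hankel (\<phi> \<star> dagger \<phi>) T"
    and f: "\<And>k. f k \<in> Lp_fun 2"
    and F: "finite F" "F \<subseteq> nonneg_freq" and G: "finite G" "G \<subseteq> nonneg_freq"
  shows "(\<Sum>k\<in>K. \<Sum>m\<in>F. (cmod (\<Sum>n\<in>G. fourier_coeff (f k \<star> \<phi>) (m + n) * x n))\<^sup>2) \<le>
    op_norm conj_Hardy2 T * sqrt (\<Sum>k\<in>K. \<Sum>l\<in>K. (cmod (L2_inner (f k) (f l)))\<^sup>2) * (\<Sum>n\<in>G. (cmod (x n))\<^sup>2)"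
proof -
  let ?a = "fourier_coeff \<phi>" and ?\<beta> = "op_norm conj_Hardy2 T"
  have psi: "integrable torus (\<phi> \<star> dagger \<phi>)"
    by (rule fourier_coeff_conv(1)[OF \<phi> dagger_integrable[OF \<phi>]])
  have psi_coeff: "fourier_coeff (\<phi> \<star> dagger \<phi>) n = complex_of_real ((cmod (?a n))\<^sup>2)" for n
    unfolding fourier_coeff_conv(2)[OF \<phi> dagger_integrable[OF \<phi>]] fourier_coeff_dagger[OF \<phi>]
    by (rule complex_norm_square[symmetric])
  have beta: "0 \<le> ?\<beta>"
    using T unfolding is_hankel_def conj_Hardy2_eq by (blast intro: op_norm_nonneg)
  have B: "(\<Sum>m\<in>F. (\<Sum>n\<in>G. (cmod (?a (m + n)))\<^sup>2 * u n)\<^sup>2) \<le> ?\<beta>\<^sup>2 * (\<Sum>n\<in>G. (u n)\<^sup>2)" for u :: "('d \<Rightarrow> int) \<Rightarrow> real"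
  proof -
    have "(cmod (\<Sum>n\<in>G. fourier_coeff (\<phi> \<star> dagger \<phi>) (m + n) * complex_of_real (u n)))\<^sup>2 =
        (\<Sum>n\<in>G. (cmod (?a (m + n)))\<^sup>2 * u n)\<^sup>2" for m
    proof -
      have "(\<Sum>n\<in>G. fourier_coeff (\<phi> \<star> dagger \<phi>) (m + n) * complex_of_real (u n)) =
          complex_of_real (\<Sum>n\<in>G. (cmod (?a (m + n)))\<^sup>2 * u n)"
        by (simp add: psi_coeff)
      then show ?thesis by (simp only: norm_of_real power2_abs)
    qed
    then show ?thesis
      using hankel_finite_section_le[OF T psi F G, of "\<lambda>n. complex_of_real (u n)"] by simp
  qed
  let ?E0 = "(\<lambda>(m, n). m + n) ` (F \<times> G)"
  let ?L = "\<Sum>k\<in>K. \<Sum>m\<in>F. (cmod (\<Sum>n\<in>G. fourier_coeff (f k \<star> \<phi>) (m + n) * x n))\<^sup>2"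
  let ?R = "\<lambda>E. ?\<beta> * sqrt (\<Sum>k\<in>K. \<Sum>l\<in>K. (cmod (\<Sum>i\<in>E. fourier_coeff (f k) i * cnj (fourier_coeff (f l) i)))\<^sup>2)
      * (\<Sum>n\<in>G. (cmod (x n))\<^sup>2)"
  have L_eq: "?L = (\<Sum>k\<in>K. \<Sum>m\<in>F. (cmod (\<Sum>n\<in>G. fourier_coeff (f k) (m + n) * ?a (m + n) * x n))\<^sup>2)"
    by (simp add: fourier_coeff_conv(2)[OF L2_integrable[OF f] \<phi>])
  have "?L \<le> ?R E" if "finite E" "?E0 \<subseteq> E" for E
    unfolding L_eq using that by (intro hankel_square_function_bound F G beta B) auto
  then have "eventually (\<lambda>E. ?L \<le> ?R E) (finite_subsets_at_top UNIV)"
    unfolding eventually_finite_subsets_at_top using F(1) G(1)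
    by (intro exI[of _ ?E0]) auto
  moreover have "(?R \<longlongrightarrow> ?\<beta> * sqrt (\<Sum>k\<in>K. \<Sum>l\<in>K. (cmod (L2_inner (f k) (f l)))\<^sup>2) * (\<Sum>n\<in>G. (cmod (x n))\<^sup>2))
      (finite_subsets_at_top UNIV)"
    by (intro tendsto_intros Parseval_inner[unfolded has_sum_def] f)
  ultimately show ?thesis
    by (intro tendsto_lowerbound[of _ _ "finite_subsets_at_top UNIV"]) auto
qed

lemma conj_Hardy2_approx:
  fixes h :: "('d::finite) torus_fun"
  assumes h: "h \<in> conj_Hardy2"
  shows "((\<lambda>A. L2_fnorm (\<lambda>z. h z - conj_trig (\<lambda>n. fourier_coeff h (\<lambda>i. - n i)) (A \<inter> nonneg_freq) z)) \<longlongrightarrow> 0)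
    (finite_subsets_at_top UNIV)"
proof -
  obtain g where g: "g \<in> spectral_L2 nonneg_freq" "h = (\<lambda>z. cnj (g z))"
    using h by (auto simp: conj_Hardy2_def Hardy_2_eq)
  have "L2_fnorm (\<lambda>z. g z - trig (fourier_coeff g) A z) =
      L2_fnorm (\<lambda>z. h z - conj_trig (\<lambda>n. fourier_coeff h (\<lambda>i. - n i)) (A \<inter> nonneg_freq) z)" if "finite A" for A
    unfolding spectral_L2_partial_sum[OF g(1) that] g(2) conj_trig_eq
    by (subst L2_fnorm_cnj[symmetric]) (simp add: fourier_coeff_cnj)
  then have "eventually (\<lambda>A. L2_fnorm (\<lambda>z. g z - trig (fourier_coeff g) A z) =
      L2_fnorm (\<lambda>z. h z - conj_trig (\<lambda>n. fourier_coeff h (\<lambda>i. - n i)) (A \<inter> nonneg_freq) z)) (finite_subsets_at_top UNIV)"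
    unfolding eventually_finite_subsets_at_top by blast
  with fourier_series_converges[OF spectral_L2_D[OF g(1)]] show ?thesis
    by (rule Lim_transform_eventually)
qed

text \<open>First the rows are exhausted for a polynomial \<open>h\<close>, then polynomials approximate a general \<open>h\<close>; the second
  limit uses that each single operator is bounded.\<close>

theorem hankel_square_function:
  fixes \<phi> :: "('d::finite) torus_fun" and f :: "nat \<Rightarrow> 'd torus_fun"
  assumes \<phi>: "integrable torus \<phi>" and T: "is_hankel (\<phi> \<star> dagger \<phi>) T"
    and f: "\<And>k. f k \<in> Lp_fun 2" and H: "\<And>k. is_hankel (f k \<star> \<phi>) (H k)"
    and K: "finite K" and h: "h \<in> conj_Hardy2"
  shows "(\<Sum>k\<in>K. (L2_fnorm (H k h))\<^sup>2) \<le>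
    op_norm conj_Hardy2 T * sqrt (\<Sum>k\<in>K. \<Sum>l\<in>K. (cmod (L2_inner (f k) (f l)))\<^sup>2) * (L2_fnorm h)\<^sup>2"
proof -
  let ?N = "{n :: 'd \<Rightarrow> int. \<forall>i. n i \<le> 0}"
  define \<gamma> where "\<gamma> = op_norm conj_Hardy2 T * sqrt (\<Sum>k\<in>K. \<Sum>l\<in>K. (cmod (L2_inner (f k) (f l)))\<^sup>2)"
  have gamma: "0 \<le> \<gamma>"
    using T unfolding is_hankel_def conj_Hardy2_eq \<gamma>_def
    by (intro mult_nonneg_nonneg) (auto intro!: op_norm_nonneg sum_nonneg)
  have bH: "bounded_op (spectral_L2 ?N) (spectral_L2 nonneg_freq) (H k)" for k
    using H by (simp add: is_hankel_def conj_Hardy2_eq Hardy_2_eq)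
  note L2H = spectral_L2_D[OF bounded_op_maps[OF bH]]
  have psi: "integrable torus (f k \<star> \<phi>)" for k
    by (rule fourier_coeff_conv(1)[OF L2_integrable[OF f] \<phi>])
  have hN: "h \<in> spectral_L2 ?N" using h by (simp add: conj_Hardy2_eq)
  have poly: "(\<Sum>k\<in>K. (L2_fnorm (H k (conj_trig x G)))\<^sup>2) \<le> \<gamma> * (\<Sum>n\<in>G. (cmod (x n))\<^sup>2)"
    if G: "finite G" "G \<subseteq> nonneg_freq" for x G
  proof -
    let ?p = "conj_trig x G"
    have p: "?p \<in> spectral_L2 ?N" using conj_trig_in_conj_Hardy2[OF G] by (simp add: conj_Hardy2_eq)
    have "((\<lambda>A. \<Sum>k\<in>K. \<Sum>m\<in>A. (cmod (fourier_coeff (H k ?p) m))\<^sup>2) \<longlongrightarrow> (\<Sum>k\<in>K. (L2_fnorm (H k ?p))\<^sup>2)) (finite_subsets_at_top UNIV)"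
      by (intro tendsto_sum Parseval[unfolded has_sum_def] L2H p)
    moreover have "(\<Sum>k\<in>K. \<Sum>m\<in>A. (cmod (fourier_coeff (H k ?p) m))\<^sup>2) \<le> \<gamma> * (\<Sum>n\<in>G. (cmod (x n))\<^sup>2)"
      if A: "finite A" for A
    proof -
      have "(\<Sum>m\<in>A. (cmod (fourier_coeff (H k ?p) m))\<^sup>2) =
          (\<Sum>m\<in>A \<inter> nonneg_freq. (cmod (\<Sum>n\<in>G. fourier_coeff (f k \<star> \<phi>) (m + n) * x n))\<^sup>2)" for k
      proof (rule sum.mono_neutral_cong_right[OF A])
        show "\<forall>m\<in>A - A \<inter> nonneg_freq. (cmod (fourier_coeff (H k ?p) m))\<^sup>2 = 0"
          using bounded_op_maps[OF bH p, of k] by (auto simp: spectral_L2_def)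
        show "(cmod (fourier_coeff (H k ?p) m))\<^sup>2 = (cmod (\<Sum>n\<in>G. fourier_coeff (f k \<star> \<phi>) (m + n) * x n))\<^sup>2"
          if "m \<in> A \<inter> nonneg_freq" for m
          using that by (subst hankel_coeff[OF H psi G]) auto
      qed auto
      then show ?thesis
        unfolding \<gamma>_def using hankel_family_sections[OF \<phi> T f _ _ G, where F = "A \<inter> nonneg_freq" and K = K] A
        by simp
    qed
    then have "eventually (\<lambda>A. (\<Sum>k\<in>K. \<Sum>m\<in>A. (cmod (fourier_coeff (H k ?p) m))\<^sup>2) \<le> \<gamma> * (\<Sum>n\<in>G. (cmod (x n))\<^sup>2))
        (finite_subsets_at_top UNIV)"
      unfolding eventually_finite_subsets_at_top by blast
    ultimately show ?thesis by (intro tendsto_upperbound[of _ _ "finite_subsets_at_top UNIV"]) auto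
  qed
  let ?x = "\<lambda>n. fourier_coeff h (\<lambda>i. - n i)"
  let ?p = "\<lambda>A. conj_trig ?x (A \<inter> nonneg_freq)"
  have p: "?p A \<in> spectral_L2 ?N" if "finite A" for A
    using conj_trig_in_conj_Hardy2[of "A \<inter> nonneg_freq" ?x] that by (auto simp: conj_Hardy2_eq)
  have lim: "((\<lambda>A. L2_fnorm (H k (?p A))) \<longlongrightarrow> L2_fnorm (H k h)) (finite_subsets_at_top UNIV)" for k
  proof -
    obtain C where C: "0 \<le> C" "\<And>g. g \<in> spectral_L2 ?N \<Longrightarrow> L2_fnorm (H k g) \<le> C * L2_fnorm g"
      by (rule bounded_op_bound[OF bH]) blast
    have "norm (L2_fnorm (H k (?p A)) - L2_fnorm (H k h)) \<le> C * L2_fnorm (\<lambda>z. h z - ?p A z)" if A: "finite A" for A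
    proof -
      let ?u = "H k h" and ?v = "H k (?p A)"
      note u = L2H[OF hN, of k] and v = L2H[OF p[OF A], of k]
      have d: "L2_fnorm (\<lambda>z. ?u z - ?v z) \<le> C * L2_fnorm (\<lambda>z. h z - ?p A z)"
        unfolding bounded_op_norm_diff[OF bH hN p[OF A], symmetric]
        using C(2) spectral_L2_lincomb[OF hN p[OF A], of 1 "-1"] by simp
      have "L2_fnorm ?u \<le> L2_fnorm (\<lambda>z. ?u z - ?v z) + L2_fnorm ?v"
        using L2_fnorm_triangle[OF L2_diff[OF u v] v] by simp
      moreover have "L2_fnorm ?v \<le> L2_fnorm (\<lambda>z. ?u z - ?v z) + L2_fnorm ?u"
        using L2_fnorm_triangle[OF L2_diff[OF v u] u] L2_fnorm_scale[of "-1" "\<lambda>z. ?u z - ?v z"] by simp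
      ultimately show ?thesis using d by (simp add: abs_le_iff)
    qed
    then have "eventually (\<lambda>A. norm (L2_fnorm (H k (?p A)) - L2_fnorm (H k h)) \<le> C * L2_fnorm (\<lambda>z. h z - ?p A z)) (finite_subsets_at_top UNIV)"
      unfolding eventually_finite_subsets_at_top by blast
    moreover have "((\<lambda>A. C * L2_fnorm (\<lambda>z. h z - ?p A z)) \<longlongrightarrow> 0) (finite_subsets_at_top UNIV)"
      using tendsto_mult[OF tendsto_const conj_Hardy2_approx[OF h], of C] by simp
    ultimately show ?thesis by (rule Lim_null_comparison[THEN LIM_zero_cancel])
  qed
  have "((\<lambda>A. \<Sum>k\<in>K. (L2_fnorm (H k (?p A)))\<^sup>2) \<longlongrightarrow> (\<Sum>k\<in>K. (L2_fnorm (H k h))\<^sup>2)) (finite_subsets_at_top UNIV)"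
    by (intro tendsto_sum tendsto_power lim)
  moreover have "(\<Sum>k\<in>K. (L2_fnorm (H k (?p A)))\<^sup>2) \<le> \<gamma> * (L2_fnorm h)\<^sup>2" if A: "finite A" for A
  proof -
    have "(\<Sum>n\<in>A \<inter> nonneg_freq. (cmod (?x n))\<^sup>2) = (\<Sum>n\<in>uminus ` (A \<inter> nonneg_freq). (cmod (fourier_coeff h n))\<^sup>2)"
      by (subst sum.reindex) (auto simp: fun_Compl_def)
    also have "\<dots> \<le> (L2_fnorm h)\<^sup>2" using A by (intro Bessel spectral_L2_D[OF hN]) auto
    finally have "\<gamma> * (\<Sum>n\<in>A \<inter> nonneg_freq. (cmod (?x n))\<^sup>2) \<le> \<gamma> * (L2_fnorm h)\<^sup>2"
      by (rule mult_left_mono[OF _ gamma])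
    then show ?thesis using poly[of "A \<inter> nonneg_freq" ?x] A by auto
  qed
  then have "eventually (\<lambda>A. (\<Sum>k\<in>K. (L2_fnorm (H k (?p A)))\<^sup>2) \<le> \<gamma> * (L2_fnorm h)\<^sup>2) (finite_subsets_at_top UNIV)"
    unfolding eventually_finite_subsets_at_top by blast
  ultimately show ?thesis
    unfolding \<gamma>_def by (intro tendsto_upperbound[of _ _ "finite_subsets_at_top UNIV"]) auto
qed

text \<open>The tail \<open>t N\<close> is the sum over \<open>k \<ge> N\<close> and all \<open>l\<close>: an upper bound for the square blocks starting at
  \<open>N\<close> that clearly tends to 0.\<close>

lemma double_series_tails:
  fixes g :: "nat \<Rightarrow> nat \<Rightarrow> real"
  assumes g: "\<And>k l. 0 \<le> g k l" and fin: "(\<Sum>k. \<Sum>l. ennreal (g k l)) \<noteq> \<top>"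
  obtains t where "\<And>N. 0 \<le> t N" "t \<longlonglongrightarrow> 0" "(\<Sum>k. \<Sum>l. ennreal (g k l)) = ennreal (t 0)"
    "\<And>N M. (\<Sum>k\<in>{N..<M}. \<Sum>l\<in>{N..<M}. g k l) \<le> t N"
proof -
  define a where "a k = (\<Sum>l. g k l)" for k
  have row: "(\<Sum>l. ennreal (g k l)) \<noteq> \<top>" for k
  proof
    assume "(\<Sum>l. ennreal (g k l)) = \<top>"
    moreover have "(\<Sum>j\<in>{k}. \<Sum>l. ennreal (g j l)) \<le> (\<Sum>j. \<Sum>l. ennreal (g j l))"
      by (intro sum_le_suminf) auto
    ultimately show False using fin by (simp add: top_unique)
  qed
  have g_summable: "summable (g k)" for k
    by (rule summable_suminf_not_top[OF g row])
  have a_eq: "(\<Sum>l. ennreal (g k l)) = ennreal (a k)" for k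
    unfolding a_def by (rule suminf_ennreal2[OF g g_summable])
  have a: "0 \<le> a k" for k
    unfolding a_def by (rule suminf_nonneg[OF g_summable g])
  have a_summable: "summable a"
    by (rule summable_suminf_not_top[OF a]) (use fin in \<open>simp add: a_eq\<close>)
  define t where "t N = (\<Sum>k. a (k + N))" for N
  have t_summable: "summable (\<lambda>k. a (k + N))" for N
    using a_summable by (rule summable_ignore_initial_segment)
  show ?thesis
  proof (rule that[of t])
    show "0 \<le> t N" for N unfolding t_def by (rule suminf_nonneg[OF t_summable a])
    have "(\<lambda>N. suminf a - sum a {..<N}) \<longlonglongrightarrow> suminf a - suminf a"
      by (intro tendsto_intros summable_LIMSEQ a_summable)
    then show "t \<longlonglongrightarrow> 0"
      by (simp add: t_def[abs_def] suminf_minus_initial_segment[OF a_summable])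
    show "(\<Sum>k. \<Sum>l. ennreal (g k l)) = ennreal (t 0)"
      unfolding a_eq t_def using suminf_ennreal2[OF a a_summable] by simp
    fix N M
    have "(\<Sum>k\<in>{N..<M}. \<Sum>l\<in>{N..<M}. g k l) \<le> (\<Sum>k\<in>{N..<M}. a k)"
      unfolding a_def by (intro sum_mono sum_le_suminf g_summable) (auto simp: g)
    also have "\<dots> \<le> t N"
    proof (cases "N \<le> M")
      case True
      have "(\<Sum>k\<in>{N..<M}. a k) = (\<Sum>k<M - N. a (k + N))"
        using sum.shift_bounds_nat_ivl[of a 0 N "M - N"] True by (simp add: atLeast0LessThan)
      also have "\<dots> \<le> t N"
        unfolding t_def by (intro sum_le_suminf t_summable) (auto simp: a)
      finally show ?thesis .
    qed (auto simp: t_def intro!: suminf_nonneg t_summable a)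
    finally show "(\<Sum>k\<in>{N..<M}. \<Sum>l\<in>{N..<M}. g k l) \<le> t N" .
  qed
qed

lemma epowr_ennreal: "0 \<le> x \<Longrightarrow> ennreal x epowr r = ennreal (x powr r)"
  by (simp add: epowr_def)


text \<open>The two inequalities have the same left-hand side, and for mutually orthogonal functions the double series
  reduces to its diagonal. Only the first one needs an argument, with the tails of
  \<open>double_series_tails\<close> as constants for \<open>op_sums_adjoint_self\<close>.\<close>

theorem corollary6p8:
  fixes \<phi> :: "('d::finite) torus_fun"
    and f :: "nat \<Rightarrow> 'd torus_fun"
  assumes "\<phi> \<in> Hardy 1"
    and "hankel_bounded (\<phi> \<star> dagger \<phi>)"
    and "\<And>k. f k \<in> Hardy 2"
  shows "(\<forall>k. hankel_bounded (f k \<star> \<phi>)) \<and>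
    op_series_norm conj_Hardy2 (\<lambda>k. op_adjoint conj_Hardy2 (\<Gamma> (f k \<star> \<phi>)) \<circ> \<Gamma> (f k \<star> \<phi>)) epowr (1/2)
      \<le> ennreal (op_norm conj_Hardy2 (\<Gamma> (\<phi> \<star> dagger \<phi>))) epowr (1/2)
        * (\<Sum>k. \<Sum>l. ennreal ((cmod (L2_inner (f k) (f l)))\<^sup>2)) epowr (1/4) \<and>
    ((\<forall>k l. k \<noteq> l \<longrightarrow> L2_inner (f k) (f l) = 0) \<longrightarrow>
      op_series_norm conj_Hardy2 (\<lambda>k. op_adjoint conj_Hardy2 (\<Gamma> (f k \<star> \<phi>)) \<circ> \<Gamma> (f k \<star> \<phi>)) epowr (1/2)
      \<le> ennreal (op_norm conj_Hardy2 (\<Gamma> (\<phi> \<star> dagger \<phi>))) epowr (1/2)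
        * (\<Sum>k. ennreal ((L2_fnorm (f k)) ^ 4)) epowr (1/4))"
proof -
  define B where "B = \<Gamma> (\<phi> \<star> dagger \<phi>)"
  define H where "H k = \<Gamma> (f k \<star> \<phi>)" for k
  define \<beta> where "\<beta> = op_norm conj_Hardy2 B"
  define G where "G = (\<Sum>k. \<Sum>l. ennreal ((cmod (L2_inner (f k) (f l)))\<^sup>2))"
  define X where "X = op_series_norm conj_Hardy2 (\<lambda>k. op_adjoint conj_Hardy2 (H k) \<circ> H k)"
  have \<phi>: "integrable torus \<phi>" using assms(1) by (simp add: Hardy_def Lp_fun_1_iff)
  have f: "f k \<in> Lp_fun 2" for k using assms(3)[of k] by (simp add: Hardy_def)
  have B: "is_hankel (\<phi> \<star> dagger \<phi>) B"
    unfolding B_def hankel_def using assms(2) unfolding hankel_bounded_def by (rule someI_ex)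
  have \<beta>: "0 \<le> \<beta>"
    using B unfolding \<beta>_def is_hankel_def conj_Hardy2_eq by (blast intro: op_norm_nonneg)
  have bounded: "hankel_bounded (f k \<star> \<phi>)" for k
  proof (rule hankel_bounded_of_finite_sections)
    let ?s = "\<beta> * sqrt (\<Sum>j\<in>{k}. \<Sum>l\<in>{k}. (cmod (L2_inner (f j) (f l)))\<^sup>2)"
    have s: "0 \<le> ?s" using \<beta> by simp
    show "integrable torus (f k \<star> \<phi>)" by (rule fourier_coeff_conv(1)[OF L2_integrable[OF f] \<phi>])
    show "0 \<le> sqrt ?s" using s by simp
    fix F G' :: "('d \<Rightarrow> int) set" and x
    assume FG: "finite F" "F \<subseteq> nonneg_freq" "finite G'" "G' \<subseteq> nonneg_freq"
    show "(\<Sum>m\<in>F. (cmod (\<Sum>n\<in>G'. fourier_coeff (f k \<star> \<phi>) (m + n) * x n))\<^sup>2) \<le>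
        (sqrt ?s)\<^sup>2 * (\<Sum>n\<in>G'. (cmod (x n))\<^sup>2)"
      unfolding real_sqrt_pow2[OF s]
      using hankel_family_sections[OF \<phi> B f FG, where K = "{k}" and x = x] by (simp add: \<beta>_def)
  qed
  then have H: "is_hankel (f k \<star> \<phi>) (H k)" for k
    unfolding H_def hankel_def hankel_bounded_def by (rule someI_ex)
  have bH: "bounded_op (spectral_L2 {n. \<forall>i. n i \<le> 0}) (spectral_L2 nonneg_freq) (H k)" for k
    using H by (simp add: is_hankel_def conj_Hardy2_eq Hardy_2_eq)
  \<comment> \<open>any null sequence of constants for the tails bounds the norm of the series by its first term\<close>
  have X_le: "X \<le> ennreal (\<tau> 0)"
    if tau: "\<And>N. 0 \<le> \<tau> N" "\<tau> \<longlonglongrightarrow> 0"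
      and le: "\<And>N M. \<beta> * sqrt (\<Sum>k\<in>{N..<M}. \<Sum>l\<in>{N..<M}. (cmod (L2_inner (f k) (f l)))\<^sup>2) \<le> \<tau> N" for \<tau>
  proof -
    have tail: "(\<Sum>k\<in>{N..<M}. (L2_fnorm (H k h))\<^sup>2) \<le> \<tau> N * (L2_fnorm h)\<^sup>2"
      if "h \<in> spectral_L2 {n. \<forall>i. n i \<le> 0}" for N M h
    proof -
      have "(\<Sum>k\<in>{N..<M}. (L2_fnorm (H k h))\<^sup>2) \<le>
          \<beta> * sqrt (\<Sum>k\<in>{N..<M}. \<Sum>l\<in>{N..<M}. (cmod (L2_inner (f k) (f l)))\<^sup>2) * (L2_fnorm h)\<^sup>2"
        unfolding \<beta>_def using that by (intro hankel_square_function[OF \<phi> B f H]) (auto simp: conj_Hardy2_eq)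
      also have "\<dots> \<le> \<tau> N * (L2_fnorm h)\<^sup>2" by (intro mult_right_mono le) auto
      finally show ?thesis .
    qed
    let ?A = "\<lambda>k. op_adjoint conj_Hardy2 (H k) \<circ> H k"
    have ex: "\<exists>S. op_sums conj_Hardy2 ?A S"
      unfolding conj_Hardy2_eq by (rule op_sums_adjoint_self(1)[OF bH tau tail])
    have "op_norm conj_Hardy2 S \<le> \<tau> 0" if "op_sums conj_Hardy2 ?A S" for S
      unfolding conj_Hardy2_eq
      by (rule op_sums_adjoint_self(2)[OF bH tau], erule tail, rule that[unfolded conj_Hardy2_eq])
    from this[OF someI_ex[OF ex]] show ?thesis
      unfolding X_def op_series_norm_def if_P[OF ex] by (rule ennreal_leI)
  qed
  have main: "X epowr (1/2) \<le> ennreal \<beta> epowr (1/2) * G epowr (1/4)"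
  \<comment> \<open>the product \<open>0 * \<infinity>\<close> is 0, so \<open>\<beta> = 0\<close> must give convergence without any condition on the \<open>f k\<close>\<close>
  proof (cases "\<beta> = 0")
    case True
    then have "X \<le> ennreal 0" by (intro X_le[of "\<lambda>_. 0"]) auto
    then show ?thesis by (simp add: epowr_def)
  next
    case False
    show ?thesis
    proof (cases "G = \<top>")
      case True
      have "0 < \<beta> powr (1/2)" using False by simp
      then have "ennreal \<beta> epowr (1/2) * G epowr (1/4) = \<top>"
        using \<beta> by (simp add: True epowr_ennreal) (simp add: epowr_def ennreal_mult_top)
      then show ?thesis by simp
    next
      case finite: False
      obtain t where t: "\<And>N. 0 \<le> t N" "t \<longlonglongrightarrow> 0" "G = ennreal (t 0)"
        and t_le: "\<And>N M. (\<Sum>k\<in>{N..<M}. \<Sum>l\<in>{N..<M}. (cmod (L2_inner (f k) (f l)))\<^sup>2) \<le> t N"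
        by (rule double_series_tails[of "\<lambda>k l. (cmod (L2_inner (f k) (f l)))\<^sup>2"])
          (rule zero_le_power2, use finite G_def in blast, unfold G_def, blast)
      have X: "X \<le> ennreal (\<beta> * sqrt (t 0))"
      proof (rule X_le)
        show "0 \<le> \<beta> * sqrt (t N)" for N using \<beta> t by simp
        show "(\<lambda>N. \<beta> * sqrt (t N)) \<longlonglongrightarrow> 0"
          using tendsto_mult[OF tendsto_const tendsto_real_sqrt[OF t(2)], of \<beta>] by simp
        show "\<beta> * sqrt (\<Sum>k\<in>{N..<M}. \<Sum>l\<in>{N..<M}. (cmod (L2_inner (f k) (f l)))\<^sup>2) \<le> \<beta> * sqrt (t N)" for N M
          using t_le \<beta> by (intro mult_left_mono real_sqrt_le_mono)
      qed
      then obtain x where x: "0 \<le> x" "X = ennreal x" by (cases X) (auto simp: top_unique)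
      have "x \<le> \<beta> * sqrt (t 0)" using X x \<beta> t(1)[of 0] by simp
      then have "x powr (1/2) \<le> (\<beta> * sqrt (t 0)) powr (1/2)" using x by (intro powr_mono2) auto
      also have "\<dots> = \<beta> powr (1/2) * (t 0) powr (1/4)"
        using \<beta> t(1)[of 0] by (simp add: powr_mult powr_half_sqrt[symmetric] powr_powr)
      finally show ?thesis
        using x \<beta> t(1)[of 0] by (simp add: epowr_ennreal t(3) ennreal_mult[symmetric])
    qed
  qed
  have orth: "G = (\<Sum>k. ennreal ((L2_fnorm (f k)) ^ 4))" if "\<forall>k l. k \<noteq> l \<longrightarrow> L2_inner (f k) (f l) = 0"
    unfolding G_def
  proof (rule suminf_cong)
    fix k
    have "(\<Sum>l. ennreal ((cmod (L2_inner (f k) (f l)))\<^sup>2)) = (\<Sum>l\<in>{k}. ennreal ((cmod (L2_inner (f k) (f l)))\<^sup>2))"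
      using that by (intro suminf_finite) auto
    also have "\<dots> = ennreal ((cmod (L2_inner (f k) (f k)))\<^sup>2)" by simp
    also have "(cmod (L2_inner (f k) (f k)))\<^sup>2 = (L2_fnorm (f k)) ^ 4"
      unfolding L2_inner_self norm_of_real by simp
    finally show "(\<Sum>l. ennreal ((cmod (L2_inner (f k) (f l)))\<^sup>2)) = ennreal ((L2_fnorm (f k)) ^ 4)" by simp
  qed
  show ?thesis
  proof (intro conjI impI)
    show "\<forall>k. hankel_bounded (f k \<star> \<phi>)" using bounded by blast
  next
    assume "\<forall>k l. k \<noteq> l \<longrightarrow> L2_inner (f k) (f l) = 0"
    from main[unfolded orth[OF this]] show "op_series_norm conj_Hardy2 (\<lambda>k. op_adjoint conj_Hardy2 (\<Gamma> (f k \<star> \<phi>)) \<circ> \<Gamma> (f k \<star> \<phi>)) epowr (1/2)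
      \<le> ennreal (op_norm conj_Hardy2 (\<Gamma> (\<phi> \<star> dagger \<phi>))) epowr (1/2)
        * (\<Sum>k. ennreal ((L2_fnorm (f k)) ^ 4)) epowr (1/4)"
      unfolding X_def \<beta>_def B_def H_def .
  qed (rule main[unfolded X_def \<beta>_def G_def B_def H_def])
qed

end
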